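(* Let $\{f(t;\cdot),\ t\in[0,\infty)\}$ be any chordal Loewner family. Then there is a unique measurable family $\{\mu_t,\ t\in[0,\infty)\}$ of probability measures on the real line, and a subset $N\subset[0,\infty)$ of Lebesgue measure zero, such that \[ \frac{\partial}{\partial t}f(t;z)=-\int_{\mathbb R}\frac{\mu_t(dx)}{z-x}\cdot\frac{\partial}{\partial z}f(t;z) \] for all $t\in[0,\infty)\setminus N$ and all $z\in\mathbb H$.
   Context: $\mathbb H=\{z\in\mathbb C:\Im(z)>0\}$. $\mathfrak R$ denotes the class of univalent (analytic and injective) functions $f:\mathbb H\to\mathbb H$ for which there is a constant $C\in[0,\infty)$ with $|f(z)-z|\le C/\Im(z)$ for all $z\in\mathbb H$. For $f\in\mathfrak R$ the limit $\lim_{y\to\infty}iy[iy-f(iy)]$ exists and equals the least such constant $C$. For $f,g\in\mathfrak R$, write $f\prec g$ if $f=g\circ h$ for some $h\in\mathfrak R$; this is a partial order. A chordal Loewner family is a maximal (with respect to inclusion) nonempty totally ordered subset of $\mathfrak R$, written in parametrized form $\{f(t;\cdot),\ t\in[0,\infty)\}$, where $f(t;\cdot)$ is the unique element $f$ of the family with $\lim_{y\to\infty}iy[iy-f(iy)]=t$ (every $t\in[0,\infty)$ occurs exactly once). A family $\{\mu_t\}$ of probability measures on $\mathbb R$ is measurable if $t\mapsto\mu_t$ is measurable as a map from $[0,\infty)$ into the space of probability measures on $\mathbb R$ with the Borel $\sigma$-field of the topology of weak convergence. Two measurable families $\{\mu_t\}$, $\{\nu_t\}$ are identified if $\mu_t=\nu_t$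 for all $t$ outside a set of Lebesgue measure zero; uniqueness is understood modulo this identification. *)

theory Defs
  imports "HOL-Complex_Analysis.Complex_Analysis" "HOL-Probability.Probability"
begin

definition upper_half_plane :: "complex set" where
  "upper_half_plane = {z. Im z > 0}"

text \<open>
  Self-maps of the half-plane are represented by total functions that are extensional
  (equal to \<^term>\<open>undefined\<close> off the half-plane), so that equality in HOL is equality
  of maps on the half-plane, and composition is \<^const>\<open>compose\<close>.
\<close>

definition class_R :: "(complex \<Rightarrow> complex) set" where
  "class_R = {f \<in> upper_half_plane \<rightarrow>\<^sub>E upper_half_plane.
     f holomorphic_on upper_half_plane \<and> inj_on f upper_half_plane \<and>
     (\<exists>C::real. C \<ge> 0 \<and> (\<forall>z\<in>upper_half_plane. norm (f z - z) \<le> C / Im z))}"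

definition prec_R :: "(complex \<Rightarrow> complex) \<Rightarrow> (complex \<Rightarrow> complex) \<Rightarrow> bool" where
  "prec_R f g \<longleftrightarrow> (\<exists>h\<in>class_R. f = compose upper_half_plane g h)"

definition has_capacity :: "(complex \<Rightarrow> complex) \<Rightarrow> real \<Rightarrow> bool" where
  "has_capacity f c \<longleftrightarrow>
     ((\<lambda>y::real. \<i> * of_real y * (\<i> * of_real y - f (\<i> * of_real y)))
        \<longlongrightarrow> of_real c) at_top"

text \<open>
  \<^const>\<open>pred_on.maxchain\<close> compares elements by the reflexive closure of the given relation;
  this changes nothing here, as \<^const>\<open>prec_R\<close> is already reflexive on \<^const>\<open>class_R\<close>.
  In the parametrized form, \<^term>\<open>f t\<close> is automatically the only element of the family with
  capacity \<^term>\<open>t\<close>, because the family is the image of \<^term>\<open>{0::real..}\<close> under \<^term>\<open>f\<close>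
  and limits are unique. Values of \<^term>\<open>f\<close> at negative times are irrelevant.
\<close>

definition chordal_Loewner_set :: "(complex \<Rightarrow> complex) set \<Rightarrow> bool" where
  "chordal_Loewner_set F \<longleftrightarrow> F \<noteq> {} \<and> pred_on.maxchain class_R prec_R F"

definition chordal_Loewner_family :: "(real \<Rightarrow> complex \<Rightarrow> complex) \<Rightarrow> bool" where
  "chordal_Loewner_family f \<longleftrightarrow>
     chordal_Loewner_set (f ` {0..}) \<and> (\<forall>t\<ge>0. has_capacity (f t) t)"

definition real_prob_measures :: "real measure set" where
  "real_prob_measures = {M. prob_space M \<and> sets M = sets borel}"

text \<open>
  The topology of weak convergence: the coarsest topology making integration against every
  bounded continuous function continuous.
\<close>

definition weak_topology :: "real measure topology" where
  "weak_topology = topology_generated_by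
     {{M \<in> real_prob_measures. (\<integral>x. g x \<partial>M) \<in> U} | (g :: real \<Rightarrow> real) U.
        continuous_on UNIV g \<and> bounded (range g) \<and> open U}"

lemma topspace_weak_topology [simp]: "topspace weak_topology = real_prob_measures"
proof -
  have "continuous_on UNIV (\<lambda>_::real. 0::real)" "bounded (range (\<lambda>_::real. 0::real))"
    by auto
  then have "real_prob_measures \<in>
      {{M \<in> real_prob_measures. (\<integral>x. g x \<partial>M) \<in> U} | (g :: real \<Rightarrow> real) U.
        continuous_on UNIV g \<and> bounded (range g) \<and> open U}"
    by (intro CollectI exI[of _ "\<lambda>_. 0"] exI[of _ UNIV]) auto
  then show ?thesis
    unfolding weak_topology_def topology_generated_by_topspace by blast
qed

definition weak_borel :: "real measure measure" where
  "weak_borel = sigma real_prob_measures {A. openin weak_topology A}"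

definition measurable_family :: "(real \<Rightarrow> real measure) \<Rightarrow> bool" where
  "measurable_family \<mu> \<longleftrightarrow> \<mu> \<in> restrict_space borel {0..} \<rightarrow>\<^sub>M weak_borel"

lemma measurable_familyD:
  assumes "measurable_family \<mu>" "t \<ge> 0"
  shows "\<mu> t \<in> real_prob_measures"
proof -
  have "{A. openin weak_topology A} \<subseteq> Pow real_prob_measures"
    using openin_subset[of weak_topology] by auto
  then have "space weak_borel = real_prob_measures"
    by (simp add: weak_borel_def space_measure_of)
  with assms show ?thesis
    unfolding measurable_family_def
    by (auto dest!: measurable_space[where x = t] simp: space_restrict_space)
qed

definition families_identified ::
    "(real \<Rightarrow> real measure) \<Rightarrow> (real \<Rightarrow> real measure) \<Rightarrow> bool" where
  "families_identified \<mu> \<nu> \<longleftrightarrow>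
     (\<exists>N\<in>null_sets lebesgue. N \<subseteq> {0..} \<and> (\<forall>t\<in>{0..} - N. \<mu> t = \<nu> t))"

text \<open>
  The time derivative is taken within \<^term>\<open>{0::real..}\<close>, i.e. it is one-sided at \<open>t = 0\<close>. The
  exceptional set does not depend on \<open>z\<close>.
\<close>

definition solves_Loewner_equation ::
    "(real \<Rightarrow> complex \<Rightarrow> complex) \<Rightarrow> (real \<Rightarrow> real measure) \<Rightarrow> bool" where
  "solves_Loewner_equation f \<mu> \<longleftrightarrow>
     (\<exists>N\<in>null_sets lebesgue. N \<subseteq> {0..} \<and>
        (\<forall>t\<in>{0..} - N. \<forall>z\<in>upper_half_plane.
           ((\<lambda>s. f s z) has_vector_derivative
              - (\<integral>x. 1 / (z - of_real x) \<partial>\<mu> t) * deriv (f t) z) (at t within {0..})))"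

end

(* A family of capacity t satisfies f t = f s o h for s < t, where h has the form
   h z = z - (t - s) * (Cauchy transform of a probability measure), by the half-plane representation
   theorem for analytic functions that map into the lower half-plane and are O(1 / Im z). Hence
   t |-> f t z is locally Lipschitz, so differentiable almost everywhere, first for z in a countable
   dense set and then, by equicontinuity in z, for all z at once. The limits of the difference
   quotients are again Cauchy transforms of measures of mass m t <= 1. Since the capacity of f T is T,
   the masses integrate to T over [0, T], which forces m t = 1 almost everywhere. Measures are
   determined by their Cauchy transforms, and so is weak convergence to a probability measure; this
   gives uniqueness and measurability. *)
theory Submission
  imports Defs
begin

section \<open>Cauchy transforms of probability measures\<close>

text \<open>The obstacle is loss of mass. By the resolvent identity, \<open>f t z - f s z\<close> is
  exactly \<open>- (t - s)\<close> times the Cauchy transform of a probability measure times a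
  divided difference of \<open>f s\<close>, and the latter tends to \<open>deriv (f s) z\<close> as
  \<open>t\<close> decreases to \<open>s\<close>. Division by the derivative, nonzero by univalence,
  exhibits the time derivative as a limit of Cauchy transforms at one fixed time. Such a limit
  inherits only the sign and decay bounds, so at a single time its measure may have mass below 1. An
  argument integrated over \<open>t\<close> repairs this; it looks at \<open>y * Im\<close> of the
  equation at \<open>\<i> * y\<close>, dominated uniformly for \<open>y \<ge> 1\<close>. Tightness
  always comes from the single quantity
  \<open>1 + y * Im (cauchy_transform M (Complex 0 y))\<close>, which controls the mass outside
  \<open>{- y<..y}\<close>. Differentiability almost everywhere rests on comparing the Stieltjes
  measures of \<open>F\<close> and \<open>L * x - F x\<close>. The representation of transition maps
  rests on \<open>Im (h z) \<ge> Im z\<close>, a Phragmen-Lindelof argument.\<close>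

definition cauchy_transform :: "real measure \<Rightarrow> complex \<Rightarrow> complex" where
  "cauchy_transform M z = (\<integral>x. 1 / (z - of_real x) \<partial>M)"

text \<open>For \<open>z \<noteq> w\<close> in the upper half-plane this is minus the divided
  difference of \<open>cauchy_transform M\<close>; for \<open>z = w\<close> it is minus its
  derivative.\<close>

definition resolvent_product :: "real measure \<Rightarrow> complex \<Rightarrow> complex \<Rightarrow> complex" where
  "resolvent_product M z w = (\<integral>x. 1 / ((z - of_real x) * (w - of_real x)) \<partial>M)"

lemma Im_le_norm_diff_of_real: "Im z \<le> norm (z - of_real x)"
  using abs_Im_le_cmod[of "z - of_real x"] by simp

lemma of_real_neq: "Im z > 0 \<Longrightarrow> z \<noteq> of_real x"
  by (auto simp: complex_eq_iff)

lemma norm_resolvent_le: "Im z > 0 \<Longrightarrow> norm (1 / (z - of_real x)) \<le> 1 / Im z"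
  using Im_le_norm_diff_of_real[of z x] by (simp add: norm_divide frac_le)

lemma norm_resolvent_product_le:
  assumes "Im z > 0" "Im w > 0"
  shows "norm (1 / ((z - of_real x) * (w - of_real x))) \<le> 1 / (Im z * Im w)"
proof -
  have "norm (1 / ((z - of_real x) * (w - of_real x))) = norm (1 / (z - of_real x)) * norm (1 / (w - of_real x))"
    by (simp add: norm_divide norm_mult)
  also have "\<dots> \<le> (1 / Im z) * (1 / Im w)"
    using assms by (intro mult_mono norm_resolvent_le) auto
  finally show ?thesis by simp
qed

lemma Im_resolvent: "Im (1 / (z - of_real x)) = - (Im z / (norm (z - of_real x))\<^sup>2)"
  by (simp add: Im_divide cmod_def power2_eq_square)

context real_distribution begin

lemma integrable_resolvent [simp, intro]:
  assumes "Im z > 0" shows "integrable M (\<lambda>x. 1 / (z - of_real x))"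
  by (rule integrable_const_bound[where B="1 / Im z"])
     (use assms norm_resolvent_le in \<open>auto simp: borel_measurable_if\<close>)

lemma integrable_resolvent_product [simp, intro]:
  assumes "Im z > 0" "Im w > 0"
  shows "integrable M (\<lambda>x. 1 / ((z - of_real x) * (w - of_real x)))"
  by (rule integrable_const_bound[where B="1 / (Im z * Im w)"])
     (use assms norm_resolvent_product_le in auto)

lemma norm_cauchy_transform_le:
  assumes "Im z > 0" shows "norm (cauchy_transform M z) \<le> 1 / Im z"
proof -
  have "norm (cauchy_transform M z) \<le> (\<integral>x. 1 / Im z \<partial>M)"
    unfolding cauchy_transform_def
    by (rule Bochner_Integration.integral_norm_bound_integral) (use assms norm_resolvent_le in auto)
  then show ?thesis by (simp add: prob_space[simplified])
qed

lemma norm_resolvent_product_integral_le: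
  assumes "Im z > 0" "Im w > 0" shows "norm (resolvent_product M z w) \<le> 1 / (Im z * Im w)"
proof -
  have "norm (resolvent_product M z w) \<le> (\<integral>x. 1 / (Im z * Im w) \<partial>M)"
    unfolding resolvent_product_def
    by (rule Bochner_Integration.integral_norm_bound_integral) (use assms norm_resolvent_product_le in auto)
  then show ?thesis by (simp add: prob_space[simplified])
qed

text \<open>The resolvent identity
  \<open>1 / (z - x) - 1 / (w - x) = (w - z) / ((z - x) * (w - x))\<close>, integrated.\<close>

lemma cauchy_transform_diff:
  assumes "Im z > 0" "Im w > 0"
  shows "cauchy_transform M z - cauchy_transform M w = (w - z) * resolvent_product M z w"
proof -
  have "cauchy_transform M z - cauchy_transform M w
      = (\<integral>x. 1 / (z - of_real x) - 1 / (w - of_real x) \<partial>M)"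
    using assms by (simp add: cauchy_transform_def)
  also have "\<dots> = (\<integral>x. (w - z) * (1 / ((z - of_real x) * (w - of_real x))) \<partial>M)"
    using assms by (intro Bochner_Integration.integral_cong) 
      (auto simp: divide_simps of_real_neq)
  also have "\<dots> = (w - z) * resolvent_product M z w"
    unfolding resolvent_product_def by (rule integral_mult_right_zero)
  finally show ?thesis .
qed

text \<open>A second use of the resolvent identity. The estimate serves both the derivative of
  \<open>cauchy_transform\<close> and, later, the equicontinuity in \<open>z\<close> of difference
  quotients in time.\<close>

lemma resolvent_product_diff_le:
  assumes "Im z > 0" "Im w > 0" "Im v > 0"
  shows "norm (resolvent_product M z w - resolvent_product M z v) \<le> norm (w - v) / (Im z * Im w * Im v)"
proof -
  have "resolvent_product M z w - resolvent_product M z v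
      = (\<integral>x. 1 / ((z - of_real x) * (w - of_real x)) - 1 / ((z - of_real x) * (v - of_real x)) \<partial>M)"
    using assms by (simp add: resolvent_product_def)
  also have "norm \<dots> \<le> (\<integral>x. norm (w - v) / (Im z * Im w * Im v) \<partial>M)"
  proof (rule Bochner_Integration.integral_norm_bound_integral)
    fix x assume "x \<in> space M"
    have "1 / ((z - of_real x) * (w - of_real x)) - 1 / ((z - of_real x) * (v - of_real x))
      = (v - w) * (1 / (z - of_real x)) * (1 / ((w - of_real x) * (v - of_real x)))"
      using assms by (simp add: divide_simps of_real_neq)
    also have "norm \<dots> = norm (w - v) * (norm (1 / (z - of_real x)) * norm (1 / ((w - of_real x) * (v - of_real x))))"
      by (simp only: norm_mult norm_minus_commute mult.assoc)
    also have "\<dots> \<le> norm (w - v) * (1 / Im z * (1 / (Im w * Im v)))"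
      using assms by (intro mult_left_mono mult_mono norm_resolvent_le norm_resolvent_product_le) auto
    finally show "norm (1 / ((z - of_real x) * (w - of_real x)) - 1 / ((z - of_real x) * (v - of_real x)))
      \<le> norm (w - v) / (Im z * Im w * Im v)" by (simp add: mult.assoc)
  qed (use assms in auto)
  finally show ?thesis by (simp add: prob_space[simplified])
qed

lemma isCont_resolvent_product:
  assumes "Im z > 0" "Im v > 0" shows "isCont (resolvent_product M z) v"
proof -
  have "((\<lambda>w. norm (w - v) / (Im z * Im w * Im v)) \<longlongrightarrow> norm (v - v) / (Im z * Im v * Im v)) (at v)"
    using assms by (intro tendsto_intros) auto
  moreover have "\<forall>\<^sub>F w in at v. Im w > 0"
    using assms(2) by (intro order_tendstoD(1)[where y="Im v"] tendsto_intros)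
  then have "\<forall>\<^sub>F w in at v. norm (resolvent_product M z w - resolvent_product M z v) \<le> norm (w - v) / (Im z * Im w * Im v)"
    by eventually_elim (use assms resolvent_product_diff_le in auto)
  ultimately have "((\<lambda>w. resolvent_product M z w - resolvent_product M z v) \<longlongrightarrow> 0) (at v)"
    by (auto intro: Lim_null_comparison)
  then show ?thesis by (simp add: isCont_def LIM_zero_iff)
qed

lemma cauchy_transform_has_field_derivative:
  assumes "Im z > 0"
  shows "(cauchy_transform M has_field_derivative - resolvent_product M z z) (at z)"
proof -
  have "((\<lambda>w. - resolvent_product M z w) \<longlongrightarrow> - resolvent_product M z z) (at z)"
    using isCont_resolvent_product[OF assms assms] by (auto simp: isCont_def intro: tendsto_minus)
  moreover have "\<forall>\<^sub>F w in at z. Im w > 0"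
    using assms by (intro order_tendstoD(1)[where y="Im z"] tendsto_intros)
  moreover have "\<forall>\<^sub>F w in at z. w \<noteq> z" by (simp add: eventually_at_filter)
  ultimately show ?thesis
    unfolding has_field_derivative_iff
  proof (elim Lim_transform_eventually)
    assume "\<forall>\<^sub>F w in at z. Im w > 0" "\<forall>\<^sub>F w in at z. w \<noteq> z"
    then show "\<forall>\<^sub>F w in at z. - resolvent_product M z w = (cauchy_transform M w - cauchy_transform M z) / (w - z)"
      by eventually_elim (use cauchy_transform_diff[OF assms] in \<open>auto simp: field_simps\<close>)
  qed
qed

lemma holomorphic_cauchy_transform: "cauchy_transform M holomorphic_on upper_half_plane"
  unfolding upper_half_plane_def holomorphic_on_def
  using cauchy_transform_has_field_derivative
  by (auto simp: field_differentiable_def intro: has_field_derivative_at_within)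

lemma integrable_Poisson_kernel:
  assumes "Im z > 0" shows "integrable M (\<lambda>x. Im z / (norm (z - of_real x))\<^sup>2)"
  using integrable_minus[OF integrable_Im[OF integrable_resolvent[OF assms]]]
  by (simp only: Im_resolvent minus_minus)

lemma Im_cauchy_transform:
  assumes "Im z > 0"
  shows "Im (cauchy_transform M z) = - (\<integral>x. Im z / (norm (z - of_real x))\<^sup>2 \<partial>M)"
  using integral_Im[OF integrable_resolvent[OF assms]]
  by (simp only: Im_resolvent cauchy_transform_def integral_minus)

text \<open>Dominated convergence: \<open>\<i> * y / (\<i> * y - x)\<close> has modulus at most 1
  and tends to 1. Total mass is thus visible at infinity, which is how capacities and the masses of
  limit measures are read off.\<close>

lemma cauchy_transform_asymptotics:
  "((\<lambda>y::real. \<i> * of_real y * cauchy_transform M (\<i> * of_real y)) \<longlongrightarrow> 1) at_top"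
proof -
  have "((\<lambda>y::real. \<integral>x. \<i> * of_real y / (\<i> * of_real y - of_real x) \<partial>M) \<longlongrightarrow> (\<integral>x. 1 \<partial>M)) at_top"
  proof (rule integral_dominated_convergence_at_top)
    show "integrable M (\<lambda>x. 1::real)" by simp
    show "\<forall>\<^sub>F y in at_top. AE x in M. norm (\<i> * of_real y / (\<i> * of_real y - of_real x)) \<le> (1::real)"
      using eventually_gt_at_top[of "0::real"]
    proof eventually_elim
      case (elim y)
      show ?case
        using Im_le_norm_diff_of_real[of "\<i> * of_real y"] elim
        by (intro AE_I2) (auto simp: norm_divide divide_simps norm_mult)
    qed
    show "AE x in M. ((\<lambda>y::real. \<i> * of_real y / (\<i> * of_real y - of_real x)) \<longlongrightarrow> 1) at_top"
    proof (rule AE_I2)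
      fix x :: real
      have "((\<lambda>y. \<i> / (\<i> - of_real (x / y))) \<longlongrightarrow> \<i> / (\<i> - of_real 0)) at_top"
        by (intro tendsto_intros tendsto_divide_0[OF tendsto_const] filterlim_at_top_imp_at_infinity[OF filterlim_ident]) auto
      then have "((\<lambda>y. \<i> / (\<i> - of_real (x / y))) \<longlongrightarrow> 1) at_top" by simp
      then show "((\<lambda>y::real. \<i> * of_real y / (\<i> * of_real y - of_real x)) \<longlongrightarrow> 1) at_top"
      proof (rule Lim_transform_eventually)
        show "\<forall>\<^sub>F y in at_top. \<i> / (\<i> - of_real (x / y)) = \<i> * of_real y / (\<i> * of_real y - of_real x)"
          using eventually_gt_at_top[of "0::real"]
          by eventually_elim (simp add: field_simps)
      qed
    qed
  qed auto
  moreover have "\<forall>\<^sub>F y in at_top. (\<integral>x. \<i> * of_real y / (\<i> * of_real y - of_real x) \<partial>M)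
      = \<i> * of_real y * cauchy_transform M (\<i> * of_real y)"
    using eventually_gt_at_top[of "0::real"]
  proof eventually_elim
    case (elim y)
    have "(\<integral>x. \<i> * of_real y * (1 / (\<i> * of_real y - of_real x)) \<partial>M)
      = \<i> * of_real y * cauchy_transform M (\<i> * of_real y)"
      unfolding cauchy_transform_def by (rule integral_mult_right_zero)
    then show ?case by simp
  qed
  ultimately show ?thesis
    by (auto simp: prob_space[simplified] intro: Lim_transform_eventually)
qed

end

section \<open>Uniqueness and continuity theorems\<close>

text \<open>Stieltjes inversion before the limit in \<open>e\<close>. The imaginary part is, up to
  sign and the factor \<open>1 / pi\<close>, the Poisson kernel of height \<open>e\<close>
  integrated against \<open>M\<close>; Tonelli lets the \<open>s\<close>-integral act first, and the
  kernel has the antiderivative \<open>arctan ((s - x) / e)\<close>.\<close>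

lemma (in real_distribution) nn_integral_Im_cauchy_transform:
  assumes "e > 0" "a \<le> b"
  shows "(\<integral>\<^sup>+s. ennreal (- Im (cauchy_transform M (Complex s e))) * indicator {a..b} s \<partial>lborel)
    = (\<integral>\<^sup>+x. ennreal (arctan ((b - x) / e) - arctan ((a - x) / e)) \<partial>M)"
proof -
  interpret pair_sigma_finite lborel M ..
  define k where "k = (\<lambda>s x. e / (norm (Complex s e - of_real x))\<^sup>2)"
  have k_nonneg: "k s x \<ge> 0" for s x using assms by (simp add: k_def)
  have k_eq: "k s x = e / ((s - x)\<^sup>2 + e\<^sup>2)" for s x
    by (simp add: k_def cmod_def)
  have "(\<integral>\<^sup>+s. ennreal (- Im (cauchy_transform M (Complex s e))) * indicator {a..b} s \<partial>lborel)
     = (\<integral>\<^sup>+s. (\<integral>\<^sup>+x. ennreal (k s x) * indicator {a..b} s \<partial>M) \<partial>lborel)"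
  proof (rule nn_integral_cong)
    fix s
    have "integrable M (k s)" 
      using integrable_Poisson_kernel[of "Complex s e"] assms by (simp add: k_def)
    then have "(\<integral>\<^sup>+x. ennreal (k s x) \<partial>M) = ennreal (\<integral>x. k s x \<partial>M)"
      using k_nonneg by (intro nn_integral_eq_integral) auto
    also have "(\<integral>x. k s x \<partial>M) = - Im (cauchy_transform M (Complex s e))"
      using Im_cauchy_transform[of "Complex s e"] assms by (simp add: k_def)
    finally show "ennreal (- Im (cauchy_transform M (Complex s e))) * indicator {a..b} s
        = (\<integral>\<^sup>+x. ennreal (k s x) * indicator {a..b} s \<partial>M)"
      by (auto split: split_indicator)
  qed
  also have "\<dots> = (\<integral>\<^sup>+x. (\<integral>\<^sup>+s. ennreal (k s x) * indicator {a..b} s \<partial>lborel) \<partial>M)"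
    unfolding k_eq by (rule Fubini'[symmetric]) measurable
  also have "\<dots> = (\<integral>\<^sup>+x. ennreal (arctan ((b - x) / e) - arctan ((a - x) / e)) \<partial>M)"
  proof (rule nn_integral_cong)
    fix x
    show "(\<integral>\<^sup>+s. ennreal (k s x) * indicator {a..b} s \<partial>lborel)
        = ennreal (arctan ((b - x) / e) - arctan ((a - x) / e))"
    proof (rule nn_integral_FTC_Icc)
      show "(\<lambda>s. k s x) \<in> borel_measurable borel" unfolding k_eq by measurable
      fix s
      have "((\<lambda>s. arctan ((s - x) / e)) has_real_derivative inverse (1 + ((s - x) / e)\<^sup>2) * (1 / e)) (at s)"
        using assms by (auto intro!: derivative_eq_intros)
      also have "inverse (1 + ((s - x) / e)\<^sup>2) * (1 / e) = k s x"
        using assms by (simp add: k_eq field_simps power2_eq_square)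
      finally show "((\<lambda>s. arctan ((s - x) / e)) has_real_derivative k s x) (at s)" .
    qed (use assms k_nonneg in auto)
  qed
  finally show ?thesis .
qed

lemma integral_eq_in_limit:
  assumes "real_distribution M" "real_distribution N"
    and meas: "\<And>n::nat. f n \<in> borel_measurable borel" and bd: "\<And>n x. \<bar>f n x\<bar> \<le> (B::real)" 
    and lim: "\<And>x. (\<lambda>n. f n x) \<longlonglongrightarrow> g x"
    and eq: "\<And>n. (\<integral>x. f n x \<partial>M) = (\<integral>x. f n x \<partial>N)"
  shows "(\<integral>x. g x \<partial>M) = (\<integral>x. g x \<partial>N)"
proof -
  interpret M: real_distribution M by fact
  interpret N: real_distribution N by fact
  have [measurable]: "g \<in> borel_measurable borel"
    by (rule borel_measurable_LIMSEQ_real[OF lim meas])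
  have "(\<lambda>n. \<integral>x. f n x \<partial>M) \<longlonglongrightarrow> (\<integral>x. g x \<partial>M)"
    using meas bd lim by (intro integral_dominated_convergence[where w="\<lambda>_. B"]) auto
  moreover have "(\<lambda>n. \<integral>x. f n x \<partial>N) \<longlonglongrightarrow> (\<integral>x. g x \<partial>N)"
    using meas bd lim by (intro integral_dominated_convergence[where w="\<lambda>_. B"]) auto
  ultimately show ?thesis unfolding eq by (rule LIMSEQ_unique)
qed

lemma arctan_mult_at_top: "(\<lambda>n. arctan (y * real (Suc n))) \<longlonglongrightarrow> pi / 2 * sgn y"
proof -
  have *: "(\<lambda>n. arctan (y * real (Suc n))) \<longlonglongrightarrow> pi / 2" if "y > 0" for y
  proof -
    have "filterlim (\<lambda>n. y * real (Suc n)) at_top sequentially"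
      using that by real_asymp
    then show ?thesis using tendsto_arctan_at_top by (rule filterlim_compose[rotated])
  qed
  consider "y = 0" | "y > 0" | "y < 0" by linarith
  then show ?thesis
  proof cases
    case 3
    then have "(\<lambda>n. - arctan (- y * real (Suc n))) \<longlonglongrightarrow> - (pi / 2)"
      by (intro tendsto_minus *) auto
    then show ?thesis using 3 by (simp add: arctan_minus)
  qed (use * in auto)
qed

text \<open>Stieltjes inversion in three bounded pointwise limits. Height \<open>1 / Suc n\<close>
  tending to 0 turns the arctan difference into \<open>pi / 2\<close> times a difference of signs;
  sending the left end \<open>b - n\<close> to minus infinity leaves one sign; letting
  \<open>b = c + 1 / Suc n\<close> decrease to \<open>c\<close> gives the cdf.\<close>

theorem cauchy_transform_unique:
  assumes M: "real_distribution M" and N: "real_distribution N"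
    and eq: "\<And>z. Im z > 0 \<Longrightarrow> cauchy_transform M z = cauchy_transform N z"
  shows "M = N"
proof -
  interpret M: real_distribution M by fact
  interpret N: real_distribution N by fact
  have arctan_bound: "\<bar>arctan u - arctan v\<bar> \<le> pi" for u v
    using arctan_bounded[of u] arctan_bounded[of v] by linarith
  have arctan_eq: "(\<integral>x. arctan ((b - x) * Suc n) - arctan ((a - x) * Suc n) \<partial>M)
      = (\<integral>x. arctan ((b - x) * Suc n) - arctan ((a - x) * Suc n) \<partial>N)" if "a \<le> b" for a b and n :: nat
  proof -
    have nonneg: "arctan ((b - x) * Suc n) - arctan ((a - x) * Suc n) \<ge> 0" for x
      using \<open>a \<le> b\<close> by (simp add: arctan_monotone' mult_right_mono)
    have *: "ennreal (\<integral>x. arctan ((b - x) * Suc n) - arctan ((a - x) * Suc n) \<partial>L)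
        = (\<integral>\<^sup>+s. ennreal (- Im (cauchy_transform L (Complex s (1 / Suc n)))) * indicator {a..b} s \<partial>lborel)"
      if "real_distribution L" for L
    proof -
      interpret L: real_distribution L by fact
      have "integrable L (\<lambda>x. arctan ((b - x) * Suc n) - arctan ((a - x) * Suc n))"
        using arctan_bound by (intro L.integrable_const_bound[where B=pi]) auto
      then have "ennreal (\<integral>x. arctan ((b - x) * Suc n) - arctan ((a - x) * Suc n) \<partial>L)
          = (\<integral>\<^sup>+x. ennreal (arctan ((b - x) * Suc n) - arctan ((a - x) * Suc n)) \<partial>L)"
        using nonneg by (intro nn_integral_eq_integral[symmetric]) auto
      then show ?thesis
        using L.nn_integral_Im_cauchy_transform[of "1 / Suc n" a b] \<open>a \<le> b\<close> by simp
    qed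
    have "ennreal (\<integral>x. arctan ((b - x) * Suc n) - arctan ((a - x) * Suc n) \<partial>M)
        = ennreal (\<integral>x. arctan ((b - x) * Suc n) - arctan ((a - x) * Suc n) \<partial>N)"
      unfolding *[OF M] *[OF N] using eq by simp
    then show ?thesis
      using nonneg by (subst (asm) ennreal_inj) (auto intro!: integral_nonneg_AE)
  qed
  have sgn_diff: "(\<integral>x. pi / 2 * sgn (b - x) - pi / 2 * sgn (a - x) \<partial>M)
      = (\<integral>x. pi / 2 * sgn (b - x) - pi / 2 * sgn (a - x) \<partial>N)" if "a \<le> b" for a b
    by (rule integral_eq_in_limit[OF M N _ arctan_bound tendsto_diff[OF arctan_mult_at_top arctan_mult_at_top] arctan_eq[OF that]])
       measurable
  have sgn_eq: "(\<integral>x. pi / 2 * sgn (b - x) + pi / 2 \<partial>M) = (\<integral>x. pi / 2 * sgn (b - x) + pi / 2 \<partial>N)" for b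
  proof (rule integral_eq_in_limit[OF M N])
    show "\<bar>pi / 2 * sgn (b - x) - pi / 2 * sgn (b - real n - x)\<bar> \<le> pi" for n x
      by (auto simp: sgn_if)
    show "(\<lambda>n. pi / 2 * sgn (b - x) - pi / 2 * sgn (b - real n - x)) \<longlonglongrightarrow> pi / 2 * sgn (b - x) + pi / 2" for x
    proof (rule tendsto_eventually)
      obtain m :: nat where m: "b - x < m" using reals_Archimedean2 by blast
      show "\<forall>\<^sub>F n in sequentially. pi / 2 * sgn (b - x) - pi / 2 * sgn (b - real n - x) = pi / 2 * sgn (b - x) + pi / 2"
        using eventually_ge_at_top[of m]
      proof eventually_elim
        case (elim n)
        then have "sgn (b - real n - x) = -1" using m by (simp add: sgn_if)
        then show ?case by simp
      qed
    qed
    show "(\<lambda>x. pi / 2 * sgn (b - x) - pi / 2 * sgn (b - real n - x)) \<in> borel_measurable borel" for n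
      by measurable
    show "(\<integral>x. pi / 2 * sgn (b - x) - pi / 2 * sgn (b - real n - x) \<partial>M)
      = (\<integral>x. pi / 2 * sgn (b - x) - pi / 2 * sgn (b - real n - x) \<partial>N)" for n
      by (rule sgn_diff) simp
  qed
  \<comment> \<open>At \<open>x = b\<close> the previous integrand is \<open>pi / 2\<close>, so an
    atom there would count with weight one half. Approaching \<open>c\<close> from the right avoids
    this.\<close>
  have cdf_eq: "(\<integral>x. pi * indicator {..c} x \<partial>M) = (\<integral>x. pi * indicator {..c} x \<partial>N)" for c
  proof (rule integral_eq_in_limit[OF M N])
    show "\<bar>pi / 2 * sgn (c + 1 / Suc n - x) + pi / 2\<bar> \<le> pi" for n x
      by (auto simp: sgn_if)
    show "(\<lambda>n. pi / 2 * sgn (c + 1 / Suc n - x) + pi / 2) \<longlonglongrightarrow> pi * indicator {..c} x" for x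
    proof (rule tendsto_eventually, cases "x \<le> c")
      case True
      have "sgn (c + 1 / Suc n - x) = 1" for n
      proof -
        have "1 / Suc n > (0::real)" by simp
        then have "c + 1 / Suc n - x > 0" using True by linarith
        then show ?thesis by (rule sgn_pos)
      qed
      then show "\<forall>\<^sub>F n in sequentially. pi / 2 * sgn (c + 1 / Suc n - x) + pi / 2 = pi * indicator {..c} x"
        using True by simp
    next
      case False
      have "(\<lambda>n. 1 / real (Suc n)) \<longlonglongrightarrow> 0" by real_asymp
      then have "\<forall>\<^sub>F n in sequentially. 1 / real (Suc n) < x - c"
        using False by (intro order_tendstoD(2)) auto
      then show "\<forall>\<^sub>F n in sequentially. pi / 2 * sgn (c + 1 / Suc n - x) + pi / 2 = pi * indicator {..c} x"
      proof eventually_elim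
        case (elim n)
        then have "c + 1 / Suc n - x < 0" by linarith
        then have "sgn (c + 1 / Suc n - x) = -1" by (rule sgn_neg)
        then show ?case using False by simp
      qed
    qed
    show "(\<lambda>x. pi / 2 * sgn (c + 1 / Suc n - x) + pi / 2) \<in> borel_measurable borel" for n
      by measurable
  qed (rule sgn_eq)
  have "cdf M = cdf N"
  proof
    fix c show "cdf M c = cdf N c"
      using cdf_eq[of c] by (simp add: cdf_def)
  qed
  then show ?thesis by (rule cdf_unique[OF M N])
qed

section \<open>Tightness from Cauchy transforms on the imaginary axis\<close>

text \<open>The tail functional: its integrand is small for \<open>x\<close> well inside scale
  \<open>y\<close> and near 1 well outside, yet the integral is known from the Cauchy transform at a
  single point.\<close>

lemma (in real_distribution) one_plus_Im_cauchy_transform: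
  assumes "y > 0"
  shows "integrable M (\<lambda>x. x\<^sup>2 / (x\<^sup>2 + y\<^sup>2))"
    and "1 + y * Im (cauchy_transform M (Complex 0 y)) = (\<integral>x. x\<^sup>2 / (x\<^sup>2 + y\<^sup>2) \<partial>M)"
proof -
  have pos: "x\<^sup>2 + y\<^sup>2 > 0" for x using assms by (simp add: add_nonneg_pos)
  show int: "integrable M (\<lambda>x. x\<^sup>2 / (x\<^sup>2 + y\<^sup>2))"
    using pos by (intro integrable_const_bound[where B=1]) (auto simp: divide_simps)
  have "y * Im (cauchy_transform M (Complex 0 y)) = - (y * (\<integral>x. y / (x\<^sup>2 + y\<^sup>2) \<partial>M))"
    using assms by (subst Im_cauchy_transform) (auto simp: cmod_def)
  also have "\<dots> = - (\<integral>x. y * (y / (x\<^sup>2 + y\<^sup>2)) \<partial>M)"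
    by (simp only: integral_mult_right_zero)
  also have "(\<integral>x. y * (y / (x\<^sup>2 + y\<^sup>2)) \<partial>M) = (\<integral>x. 1 - x\<^sup>2 / (x\<^sup>2 + y\<^sup>2) \<partial>M)"
  proof (intro Bochner_Integration.integral_cong refl)
    fix x show "y * (y / (x\<^sup>2 + y\<^sup>2)) = 1 - x\<^sup>2 / (x\<^sup>2 + y\<^sup>2)"
    proof -
      have "1 - x\<^sup>2 / d = (d - x\<^sup>2) / d" if "d > 0" for d
        using that by (simp add: diff_divide_distrib)
      from this[OF pos[of x]] show ?thesis by (simp add: power2_eq_square)
    qed
  qed
  also have "\<dots> = 1 - (\<integral>x. x\<^sup>2 / (x\<^sup>2 + y\<^sup>2) \<partial>M)"
    using int by (simp add: prob_space[simplified])
  finally show "1 + y * Im (cauchy_transform M (Complex 0 y)) = (\<integral>x. x\<^sup>2 / (x\<^sup>2 + y\<^sup>2) \<partial>M)" by simp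
qed

lemma (in real_distribution) one_plus_Im_cauchy_transform_antimono:
  assumes "0 < y" "y \<le> y'"
  shows "1 + y' * Im (cauchy_transform M (Complex 0 y')) \<le> 1 + y * Im (cauchy_transform M (Complex 0 y))"
proof -
  have "y\<^sup>2 \<le> y'\<^sup>2" "0 < y\<^sup>2" using assms by (auto intro: power_mono)
  then show ?thesis using assms
    by (subst (1 2) one_plus_Im_cauchy_transform)
       (auto intro!: integral_mono one_plus_Im_cauchy_transform divide_left_mono mult_pos_pos add_nonneg_pos)
qed

text \<open>A Chebyshev bound: outside \<open>{- y<..y}\<close> the integrand
  \<open>x\<^sup>2 / (x\<^sup>2 + y\<^sup>2)\<close> is at least one half.\<close>

lemma (in real_distribution) tail_le_cauchy_transform:
  assumes "y > 0"
  shows "measure M {- y<..y} \<ge> 1 - 2 * (1 + y * Im (cauchy_transform M (Complex 0 y)))"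
proof -
  have "measure M (UNIV - {- y<..y}) = (\<integral>x. indicator (UNIV - {- y<..y}) x \<partial>M)"
    by simp
  also have "\<dots> \<le> (\<integral>x. 2 * (x\<^sup>2 / (x\<^sup>2 + y\<^sup>2)) \<partial>M)"
  proof (rule integral_mono)
    show "integrable M (\<lambda>x. 2 * (x\<^sup>2 / (x\<^sup>2 + y\<^sup>2)))"
      by (intro integrable_mult_right one_plus_Im_cauchy_transform(1) assms)
    fix x :: real
    have "x\<^sup>2 + y\<^sup>2 > 0" using assms by (simp add: add_nonneg_pos)
    moreover have "y\<^sup>2 \<le> x\<^sup>2" if "x \<notin> {- y<..y}"
      using that assms by (intro abs_le_square_iff[THEN iffD1]) auto
    ultimately show "indicator (UNIV - {- y<..y}) x \<le> 2 * (x\<^sup>2 / (x\<^sup>2 + y\<^sup>2))"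
      by (auto simp: divide_simps split: split_indicator)
  qed (auto intro!: integrable_real_indicator simp: emeasure_eq_measure)
  also have "\<dots> = 2 * (1 + y * Im (cauchy_transform M (Complex 0 y)))"
    by (simp only: one_plus_Im_cauchy_transform[OF assms] integral_mult_right_zero)
  finally show ?thesis using prob_compl[of "{- y<..y}"] by simp
qed

lemma (in real_distribution) one_plus_Im_cauchy_transform_tendsto:
  "((\<lambda>y. 1 + y * Im (cauchy_transform M (Complex 0 y))) \<longlongrightarrow> 0) at_top"
proof -
  have "((\<lambda>y::real. 1 - Re (\<i> * of_real y * cauchy_transform M (\<i> * of_real y))) \<longlongrightarrow> 1 - Re 1) at_top"
    by (intro tendsto_intros cauchy_transform_asymptotics)
  moreover have "\<i> * complex_of_real y = Complex 0 y" for y by (simp add: complex_eq_iff)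
  moreover have "Re (Complex 0 y * c) = - (y * Im c)" for y c by simp
  ultimately show ?thesis by simp
qed

text \<open>The hypothesis gives one scale \<open>y0\<close> for all late \<open>n\<close>. Each of
  the finitely many other measures has a scale of its own, since its tail functional tends to 0. The
  functional decreases in \<open>y\<close>, so the maximum of these scales works for all.\<close>

lemma tight_of_cauchy_transform:
  fixes M :: "nat \<Rightarrow> real measure"
  assumes M: "\<And>n. real_distribution (M n)"
    and small: "\<And>e. e > 0 \<Longrightarrow> \<exists>y>0. \<forall>\<^sub>F n in sequentially. 1 + y * Im (cauchy_transform (M n) (Complex 0 y)) < e"
  shows "tight M"
  unfolding tight_def
proof (intro conjI allI impI M)
  fix e :: real assume "e > 0"
  define \<phi> where "\<phi> = (\<lambda>n y. 1 + y * Im (cauchy_transform (M n) (Complex 0 y)))"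
  obtain y0 N where y0: "y0 > 0" "\<And>n. n \<ge> N \<Longrightarrow> \<phi> n y0 < e / 2"
  proof -
    obtain y where "y > 0" "\<forall>\<^sub>F n in sequentially. \<phi> n y < e / 2"
      using small[of "e / 2"] \<open>e > 0\<close> unfolding \<phi>_def by auto
    then show thesis using that unfolding eventually_sequentially by blast
  qed
  have "\<exists>y>0. \<phi> n y < e / 2" for n
  proof -
    interpret real_distribution "M n" by (rule M)
    have "\<forall>\<^sub>F y in at_top. \<phi> n y < e / 2"
      using one_plus_Im_cauchy_transform_tendsto \<open>e > 0\<close> unfolding \<phi>_def 
      by (intro order_tendstoD(2)) auto
    then have "\<forall>\<^sub>F y in at_top. 0 < y \<and> \<phi> n y < e / 2"
      using eventually_gt_at_top[of 0] by eventually_elim simp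
    from eventually_happens'[OF trivial_limit_at_top_linorder this] show ?thesis by blast
  qed
  then obtain Y where Y: "\<And>n. Y n > 0" "\<And>n. \<phi> n (Y n) < e / 2" by (metis (mono_tags))
  define y where "y = Max (insert y0 (Y ` {..N}))"
  have ge: "y0 \<le> y" "\<And>n. n \<le> N \<Longrightarrow> Y n \<le> y"
    unfolding y_def by (rule Max_ge; simp)+
  have "y > 0" using ge y0 by linarith
  have 1: "\<phi> n y < e / 2" for n
  proof -
    interpret real_distribution "M n" by (rule M)
    show ?thesis
    proof (cases "n \<ge> N")
      case True
      have "\<phi> n y \<le> \<phi> n y0"
        unfolding \<phi>_def by (rule one_plus_Im_cauchy_transform_antimono[OF y0(1) ge(1)])
      then show ?thesis using y0(2)[OF True] by simp
    next
      case False
      have "\<phi> n y \<le> \<phi> n (Y n)"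
        unfolding \<phi>_def using False by (intro one_plus_Im_cauchy_transform_antimono[OF Y(1) ge(2)]) simp
      then show ?thesis using Y(2)[of n] by simp
    qed
  qed
  have 2: "measure (M n) {- y<..y} \<ge> 1 - 2 * \<phi> n y" for n
    unfolding \<phi>_def by (rule real_distribution.tail_le_cauchy_transform[OF M \<open>y > 0\<close>])
  have "measure (M n) {- y<..y} > 1 - e" for n
    using 1[of n] 2[of n] by linarith
  then show "\<exists>a b. a < b \<and> (\<forall>n. measure (M n) {a<..b} > 1 - e)"
    using \<open>y > 0\<close> by (intro exI[of _ "- y"] exI[of _ y]) auto
qed

lemma weak_conv_imp_cauchy_transform_tendsto:
  assumes "\<And>n. real_distribution (\<mu> n)" "real_distribution M" "weak_conv_m \<mu> M" "Im z > 0"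
  shows "(\<lambda>n. cauchy_transform (\<mu> n) z) \<longlonglongrightarrow> cauchy_transform M z"
  unfolding cauchy_transform_def
proof (rule weak_conv_imp_integral_bdd_continuous_conv[where B="1 / Im z"])
  show "isCont (\<lambda>x. 1 / (z - of_real x)) x" for x
    using of_real_neq[OF assms(4), of x] by (intro continuous_intros) auto
qed (use assms norm_resolvent_le in auto)

text \<open>As \<open>M\<close> is a probability measure, its tail functional is small at a suitable
  \<open>y\<close>, and convergence at that point gives tightness. Every subsequential weak limit
  has the Cauchy transform of \<open>M\<close>, hence equals \<open>M\<close>.\<close>

theorem cauchy_transform_tendsto_imp_weak_conv:
  assumes \<mu>: "\<And>n. real_distribution (\<mu> n)" and M: "real_distribution M"
    and lim: "\<And>z. Im z > 0 \<Longrightarrow> (\<lambda>n. cauchy_transform (\<mu> n) z) \<longlonglongrightarrow> cauchy_transform M z"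
  shows "weak_conv_m \<mu> M"
proof (rule tight_subseq_weak_converge[OF \<mu> M])
  show "tight \<mu>"
  proof (rule tight_of_cauchy_transform[OF \<mu>])
    fix e :: real assume "e > 0"
    interpret real_distribution M by (rule M)
    have "\<forall>\<^sub>F y in at_top. 1 + y * Im (cauchy_transform M (Complex 0 y)) < e"
      using one_plus_Im_cauchy_transform_tendsto \<open>e > 0\<close> by (intro order_tendstoD(2)) auto
    then have "\<forall>\<^sub>F y in at_top. 0 < y \<and> 1 + y * Im (cauchy_transform M (Complex 0 y)) < e"
      using eventually_gt_at_top[of 0] by eventually_elim simp
    from eventually_happens'[OF trivial_limit_at_top_linorder this]
    obtain y where y: "y > 0" "1 + y * Im (cauchy_transform M (Complex 0 y)) < e" by blast
    have "(\<lambda>n. 1 + y * Im (cauchy_transform (\<mu> n) (Complex 0 y))) \<longlonglongrightarrow> 1 + y * Im (cauchy_transform M (Complex 0 y))"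
      using y by (intro tendsto_intros lim) simp
    from order_tendstoD(2)[OF this y(2)] 
    show "\<exists>y>0. \<forall>\<^sub>F n in sequentially. 1 + y * Im (cauchy_transform (\<mu> n) (Complex 0 y)) < e"
      using y(1) by blast
  qed
  fix s :: "nat \<Rightarrow> nat" and \<nu> assume s: "strict_mono s" and \<nu>: "real_distribution \<nu>" and w: "weak_conv_m (\<mu> \<circ> s) \<nu>"
  have "cauchy_transform \<nu> z = cauchy_transform M z" if "Im z > 0" for z
  proof (rule LIMSEQ_unique)
    show "(\<lambda>n. cauchy_transform ((\<mu> \<circ> s) n) z) \<longlonglongrightarrow> cauchy_transform \<nu> z"
      using \<mu> by (intro weak_conv_imp_cauchy_transform_tendsto \<nu> w that) simp
    show "(\<lambda>n. cauchy_transform ((\<mu> \<circ> s) n) z) \<longlonglongrightarrow> cauchy_transform M z"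
      using LIMSEQ_subseq_LIMSEQ[OF lim[OF that] s] by (simp add: o_def)
  qed
  then have "\<nu> = M" by (rule cauchy_transform_unique[OF \<nu> M])
  then show "weak_conv_m (\<mu> \<circ> s) M" using w by simp
qed

section \<open>Measurability in the weak topology\<close>

lemma real_prob_measures_iff: "M \<in> real_prob_measures \<longleftrightarrow> real_distribution M"
  by (auto simp: real_prob_measures_def real_distribution_def real_distribution_axioms_def)

lemma upper_half_plane_dense_sequence:
  "\<exists>d :: nat \<Rightarrow> complex. (\<forall>n. Im (d n) > 0) \<and> (\<forall>z e. Im z > 0 \<longrightarrow> e > 0 \<longrightarrow> (\<exists>n. dist (d n) z < e))"
proof -
  obtain D :: "complex set" where D: "countable D" "\<And>X. open X \<Longrightarrow> X \<noteq> {} \<Longrightarrow> \<exists>d\<in>D. d \<in> X"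
    by (erule countable_dense_setE)
  define D' where "D' = D \<inter> {z. Im z > 0}"
  have dense: "\<exists>d\<in>D'. dist d z < e" if "Im z > 0" "e > 0" for z e
  proof -
    have "z \<in> {z. Im z > 0} \<inter> ball z e" using that by simp
    then have "\<exists>d\<in>D. d \<in> {z. Im z > 0} \<inter> ball z e"
      by (intro D(2) open_Int open_halfspace_Im_gt open_ball) blast
    then show ?thesis by (auto simp: D'_def dist_commute)
  qed
  have "D' \<noteq> {}" using dense[of \<i> 1] by auto
  moreover have "countable D'" using D(1) by (simp add: D'_def)
  ultimately have "range (from_nat_into D') = D'" by (rule range_from_nat_into)
  moreover have "Im w > 0" if "w \<in> D'" for w using that by (simp add: D'_def)
  ultimately show ?thesis
    using dense by (intro exI[of _ "from_nat_into D'"]) (metis rangeI rangeE)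
qed

lemma (in real_distribution) dist_cauchy_transform_le:
  assumes "Im z > 0" "Im w > 0"
  shows "dist (cauchy_transform M z) (cauchy_transform M w) \<le> dist z w / (Im z * Im w)"
proof -
  have "dist (cauchy_transform M z) (cauchy_transform M w) = norm (w - z) * norm (resolvent_product M z w)"
    unfolding dist_norm cauchy_transform_diff[OF assms] by (rule norm_mult)
  also have "\<dots> \<le> norm (w - z) * (1 / (Im z * Im w))"
    by (intro mult_left_mono norm_resolvent_product_integral_le assms) simp
  finally show ?thesis by (simp add: dist_norm norm_minus_commute)
qed

text \<open>Cauchy transforms of all probability measures share one Lipschitz bound near
  \<open>z\<close>, so convergence on a dense set spreads to \<open>z\<close>.\<close>

lemma cauchy_transform_tendsto_of_dense:
  assumes \<mu>: "\<And>n. real_distribution (\<mu> n)" and M: "real_distribution M"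
    and d: "\<And>i. Im (d i) > 0" and dense: "\<And>z e. Im z > 0 \<Longrightarrow> e > 0 \<Longrightarrow> \<exists>i. dist (d i) z < e"
    and lim: "\<And>i. (\<lambda>n. cauchy_transform (\<mu> n) (d i)) \<longlonglongrightarrow> cauchy_transform M (d i)"
    and z: "Im z > 0"
  shows "(\<lambda>n. cauchy_transform (\<mu> n) z) \<longlonglongrightarrow> cauchy_transform M z"
proof (rule tendstoI)
  fix e :: real assume "e > 0"
  \<comment> \<open>The first bound keeps \<open>d i\<close> at height at least
    \<open>Im z / 2\<close>; the second makes the Lipschitz error
    \<open>2 * r / (Im z)\<^sup>2\<close> at most \<open>e / 4\<close>, below
    \<open>e / 3\<close>.\<close>
  define r where "r = min (Im z / 2) (e * (Im z)\<^sup>2 / 8)"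
  have "r > 0" using z \<open>e > 0\<close> by (simp add: r_def)
  then obtain i where i: "dist (d i) z < r" using dense z by blast
  have "\<bar>Im (d i) - Im z\<bar> \<le> dist (d i) z"
    using abs_Im_le_cmod[of "d i - z"] by (simp add: dist_norm)
  then have Im_d: "Im (d i) \<ge> Im z / 2" using i z unfolding r_def by linarith
  have close: "dist (cauchy_transform L z) (cauchy_transform L (d i)) < e / 3" if "real_distribution L" for L
  proof -
    have "dist (cauchy_transform L z) (cauchy_transform L (d i)) \<le> dist z (d i) / (Im z * Im (d i))"
      by (rule real_distribution.dist_cauchy_transform_le[OF that z d])
    also have "\<dots> \<le> dist z (d i) / (Im z * (Im z / 2))"
      using Im_d z d[of i] by (intro divide_left_mono mult_left_mono mult_pos_pos) auto
    also have "\<dots> < e / 3"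
    proof -
      have "dist z (d i) * 8 < e * (Im z)\<^sup>2" using i by (simp add: r_def dist_commute)
      then have "dist z (d i) * 6 < e * (Im z)\<^sup>2" using zero_le_dist[of z "d i"] by linarith
      then show ?thesis using z by (simp add: field_simps power2_eq_square)
    qed
    finally show ?thesis .
  qed
  have "\<forall>\<^sub>F n in sequentially. dist (cauchy_transform (\<mu> n) (d i)) (cauchy_transform M (d i)) < e / 3"
    using lim[of i] \<open>e > 0\<close> by (intro tendstoD) auto
  then show "\<forall>\<^sub>F n in sequentially. dist (cauchy_transform (\<mu> n) z) (cauchy_transform M z) < e"
  proof eventually_elim
    case (elim n)
    have "dist (cauchy_transform (\<mu> n) z) (cauchy_transform M z)
       \<le> dist (cauchy_transform (\<mu> n) z) (cauchy_transform (\<mu> n) (d i))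
         + dist (cauchy_transform (\<mu> n) (d i)) (cauchy_transform M (d i))
         + dist (cauchy_transform M (d i)) (cauchy_transform M z)"
      by metric
    also have "\<dots> < e"
      using close[OF \<mu>[of n]] close[OF M] elim by (simp add: dist_commute)
    finally show ?case .
  qed
qed

text \<open>\<open>weak_topology\<close> is given by a subbasis and \<open>weak_conv_m\<close> by
  sequences. Induction over the generation of open sets reduces the comparison to one bounded
  continuous \<open>g\<close>.\<close>

lemma openin_weak_topology_sequential:
  assumes "openin weak_topology A" "M \<in> A"
    and N: "\<And>n. N n \<in> real_prob_measures" and w: "weak_conv_m N M"
  shows "\<forall>\<^sub>F n in sequentially. N n \<in> A"
proof -
  define S where "S = {{M \<in> real_prob_measures. (\<integral>x. g x \<partial>M) \<in> U} | (g :: real \<Rightarrow> real) U.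
        continuous_on UNIV g \<and> bounded (range g) \<and> open U}"
  have "generate_topology_on S A"
    using assms(1) unfolding weak_topology_def S_def by (simp add: openin_topology_generated_by_iff)
  then show ?thesis using \<open>M \<in> A\<close>
  proof (induction rule: generate_topology_on.induct)
    case (Int a b)
    then show ?case by (auto intro: eventually_conj)
  next
    case (UN K)
    then obtain k where k: "k \<in> K" "M \<in> k" by blast
    from UN.IH[OF this] show ?case by eventually_elim (use k in blast)
  next
    case (Basis s)
    then obtain g :: "real \<Rightarrow> real" and U where s: "s = {M \<in> real_prob_measures. (\<integral>x. g x \<partial>M) \<in> U}"
      and g: "continuous_on UNIV g" "bounded (range g)" and U: "open U"
      by (auto simp: S_def)
    obtain B where B: "\<And>x. norm (g x) \<le> B" using g(2) by (auto simp: bounded_iff)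
    have "(\<lambda>n. \<integral>x. g x \<partial>N n) \<longlonglongrightarrow> (\<integral>x. g x \<partial>M)"
    proof (rule weak_conv_imp_integral_bdd_continuous_conv)
      show "isCont g x" for x using g(1) by (simp add: continuous_on_eq_continuous_at)
    qed (use N Basis s w B in \<open>auto simp: real_prob_measures_iff\<close>)
    then have "\<forall>\<^sub>F n in sequentially. (\<integral>x. g x \<partial>N n) \<in> U"
      using U Basis s by (intro topological_tendstoD) auto
    then show ?case by eventually_elim (use N s in auto)
  qed simp
qed

text \<open>The map \<open>\<Phi>\<close>, which takes a measure to the values of its Cauchy
  transform on a dense sequence, lands in a countable product, where measurability is
  coordinatewise. By the continuity theorem, every weakly open set of probability measures is the
  preimage under \<open>\<Phi>\<close> of an open set.\<close>

theorem measurable_familyI: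
  assumes prob: "\<And>t. t \<ge> 0 \<Longrightarrow> \<mu> t \<in> real_prob_measures"
    and meas: "\<And>z. Im z > 0 \<Longrightarrow> (\<lambda>t. cauchy_transform (\<mu> t) z) \<in> borel_measurable (restrict_space borel {0..})"
  shows "measurable_family \<mu>"
proof -
  obtain d :: "nat \<Rightarrow> complex" where "\<forall>n. Im (d n) > 0"
    and "\<forall>z e. Im z > 0 \<longrightarrow> e > 0 \<longrightarrow> (\<exists>n. dist (d n) z < e)"
    using upper_half_plane_dense_sequence by blast
  then have d: "\<And>n. Im (d n) > 0" and dense: "\<And>z e. Im z > 0 \<Longrightarrow> e > 0 \<Longrightarrow> \<exists>n. dist (d n) z < e"
    by auto
  define \<Phi> where "\<Phi> = (\<lambda>M (i::nat). cauchy_transform M (d i))"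
  have \<Phi>_meas: "(\<lambda>t. \<Phi> (\<mu> t)) \<in> borel_measurable (restrict_space borel {0..})"
    unfolding \<Phi>_def using meas d by (intro measurable_coordinatewise_then_product) auto
  have nbhd: "\<exists>W. open W \<and> \<Phi> M \<in> W \<and> (\<forall>N\<in>real_prob_measures. \<Phi> N \<in> W \<longrightarrow> N \<in> A)"
    if A: "openin weak_topology A" and M: "M \<in> A" for A M
  proof (rule ccontr)
    assume no: "\<not> ?thesis"
    have M': "M \<in> real_prob_measures" using openin_subset[OF A] M by auto
    \<comment> \<open>Only the first \<open>n + 1\<close> coordinates are restricted, so
      \<open>W n\<close> is open in the product. If no neighbourhood worked, measures outside
      \<open>A\<close> chosen from the \<open>W n\<close> would converge weakly to
      \<open>M\<close>.\<close>
    define W where "W = (\<lambda>n. {g. \<forall>i\<le>n. dist (g i) (\<Phi> M i) < 1 / Suc n})"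
    have "open (W n)" for n
    proof -
      have "W n = (\<Inter>i\<in>{..n}. (\<lambda>g. g i) -` ball (\<Phi> M i) (1 / Suc n))"
        by (auto simp: W_def dist_commute)
      also have "open \<dots>"
        by (intro open_INT ballI open_vimage continuous_on_product_coordinates) auto
      finally show ?thesis .
    qed
    moreover have "\<Phi> M \<in> W n" for n by (simp add: W_def)
    ultimately have "\<exists>N\<in>real_prob_measures. \<Phi> N \<in> W n \<and> N \<notin> A" for n using no by blast
    then obtain N where N: "\<And>n. N n \<in> real_prob_measures" "\<And>n. \<Phi> (N n) \<in> W n" "\<And>n. N n \<notin> A" by metis
    have lim: "(\<lambda>n. cauchy_transform (N n) (d i)) \<longlonglongrightarrow> cauchy_transform M (d i)" for i
    proof (rule metric_tendsto_imp_tendsto)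
      show "(\<lambda>n. 1 / real (Suc n)) \<longlonglongrightarrow> 0" by real_asymp
      show "\<forall>\<^sub>F n in sequentially. dist (cauchy_transform (N n) (d i)) (cauchy_transform M (d i)) \<le> dist (1 / real (Suc n)) 0"
        using eventually_ge_at_top[of i]
      proof eventually_elim
        case (elim n)
        then show ?case using N(2)[of n] by (auto simp: W_def \<Phi>_def intro: less_imp_le)
      qed
    qed
    have dist: "\<And>n. real_distribution (N n)" "real_distribution M"
      using N(1) M' by (auto simp: real_prob_measures_iff)
    have "weak_conv_m N M"
      by (rule cauchy_transform_tendsto_imp_weak_conv[OF dist])
         (rule cauchy_transform_tendsto_of_dense[OF dist d dense lim])
    then have "\<forall>\<^sub>F n in sequentially. N n \<in> A"
      by (intro openin_weak_topology_sequential[OF A M N(1)])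
    then show False using N(3) by simp
  qed
  show ?thesis
    unfolding measurable_family_def weak_borel_def
  proof (rule measurable_measure_of)
    show "{A. openin weak_topology A} \<subseteq> Pow real_prob_measures"
      using openin_subset[of weak_topology] by auto
    show "\<mu> \<in> space (restrict_space borel {0..}) \<rightarrow> real_prob_measures"
      using prob by (auto simp: space_restrict_space)
    fix A assume "A \<in> {A. openin weak_topology A}"
    then have A: "openin weak_topology A" by simp
    \<comment> \<open>The union of all open sets that do not lead out of \<open>A\<close>; by
      \<open>nbhd\<close> its preimage is exactly \<open>A\<close>.\<close>
    define W where "W = \<Union>{W. open W \<and> (\<forall>N\<in>real_prob_measures. \<Phi> N \<in> W \<longrightarrow> N \<in> A)}"
    have "open W" by (auto simp: W_def)
    have "M \<in> A \<longleftrightarrow> \<Phi> M \<in> W" if "M \<in> real_prob_measures" for M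
      using nbhd[OF A, of M] that unfolding W_def by blast
    then have "\<mu> -` A \<inter> space (restrict_space borel {0..})
      = (\<lambda>t. \<Phi> (\<mu> t)) -` W \<inter> space (restrict_space borel {0..})"
      using prob by (auto simp: space_restrict_space)
    also have "\<dots> \<in> sets (restrict_space borel {0..})"
      using \<open>open W\<close> by (intro measurable_sets[OF \<Phi>_meas]) auto
    finally show "\<mu> -` A \<inter> space (restrict_space borel {0..}) \<in> sets (restrict_space borel {0..})" .
  qed
qed

section \<open>The half-plane representation theorem\<close>

text \<open>Weighting Cauchy's formula by \<open>2 \<i> Im z / (w - cnj z)\<close> makes the kernel decay quadratically, so that
  boundedness of \<open>G\<close> suffices to discard the other three sides of a large rectangle.\<close>

lemma half_plane_Poisson_formula:
  fixes G :: "complex \<Rightarrow> complex"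
  assumes hol: "G holomorphic_on {z. Im z > - \<eta>}" and \<eta>: "\<eta> > 0"
    and bd: "\<And>w. Im w \<ge> 0 \<Longrightarrow> norm (G w) \<le> B" and y: "Im z > 0"
  shows "(\<lambda>n. integral {- real n..real n} (\<lambda>x. G (of_real x) * of_real (Im z / (norm (z - of_real x))\<^sup>2)))
     \<longlonglongrightarrow> pi * G z"
proof -
  define k where "k = (\<lambda>w. G w * (\<i> * of_real (Im z)) / (w - cnj z) / (w - z))"
  have B: "B \<ge> 0" using bd[of 0] by (smt (verit) norm_ge_zero zero_complex.simps(2))
  have k_real: "k (of_real x) = \<i> * (G (of_real x) * of_real (Im z / (norm (z - of_real x))\<^sup>2))" for x
  proof -
    have "(of_real x - cnj z) * (of_real x - z) = (z - of_real x) * cnj (z - of_real x)"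
      by (simp add: algebra_simps)
    also have "\<dots> = of_real ((norm (z - of_real x))\<^sup>2)" by (rule complex_norm_square[symmetric])
    finally show ?thesis by (simp add: k_def mult_ac)
  qed
  \<comment> \<open>The three discarded sides have total length \<open>4 * R\<close>, and on them
    both factors of the denominator are at least \<open>R - norm z\<close>.\<close>
  have bound: "norm (integral {- real n..real n} (\<lambda>x. G (of_real x) * of_real (Im z / (norm (z - of_real x))\<^sup>2)) - pi * G z)
     \<le> 4 * real n * (B * Im z / (real n - norm z)\<^sup>2)" if n: "real n > norm z" for n
  proof -
    define R where "R = real n"
    have R: "R > norm z" using n by (simp add: R_def)
    have Rpos: "R > 0" using R norm_ge_zero[of z] by linarith
    \<comment> \<open>Depth at most \<open>Im z\<close> keeps the pole \<open>cnj z\<close> of the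
      weight out of the convex domain \<open>S\<close>, while the real axis stays inside.\<close>
    define \<delta> where "\<delta> = min \<eta> (Im z)"
    define S where "S = {w. Im w > - \<delta>}"
    have \<delta>: "\<delta> > 0" using \<eta> y by (simp add: \<delta>_def)
    define a1 a2 a3 a4 where "a1 = Complex (- R) 0" and "a2 = Complex R 0" and "a3 = Complex R R" and "a4 = Complex (- R) R"
    have holF: "(\<lambda>w. G w * (\<i> * of_real (Im z)) / (w - cnj z)) holomorphic_on S"
      using y by (intro holomorphic_intros holomorphic_on_subset[OF hol]) (auto simp: S_def \<delta>_def)
    have "((\<lambda>w. k w) has_contour_integral
        (2 * pi * \<i> * winding_number (rectpath a1 a3) z * (G z * (\<i> * of_real (Im z)) / (z - cnj z)))) (rectpath a1 a3)"
      unfolding k_def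
    proof (rule Cauchy_integral_formula_convex_simple[OF _ holF])
      show "convex S" unfolding S_def by (rule convex_halfspace_Im_gt)
      have "open S" unfolding S_def by (rule open_halfspace_Im_gt)
      then show "z \<in> interior S" using y \<delta> by (simp add: interior_open S_def)
      have "z \<in> box a1 a3"
        using R y abs_Re_le_cmod[of z] abs_Im_le_cmod[of z] by (auto simp: in_box_complex_iff a1_def a3_def)
      moreover have "path_image (rectpath a1 a3) = cbox a1 a3 - box a1 a3"
        using Rpos by (intro path_image_rectpath_cbox_minus_box) (auto simp: a1_def a3_def)
      moreover have "cbox a1 a3 \<subseteq> S"
        using \<delta> by (auto simp: in_cbox_complex_iff S_def a1_def)
      ultimately show "path_image (rectpath a1 a3) \<subseteq> S - {z}" by blast
      show "valid_path (rectpath a1 a3)" by (rule valid_path_rectpath)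
      show "pathfinish (rectpath a1 a3) = pathstart (rectpath a1 a3)"
        by (simp only: pathfinish_rectpath pathstart_rectpath)
    qed
    moreover have "winding_number (rectpath a1 a3) z = 1"
      using R y abs_Re_le_cmod[of z] abs_Im_le_cmod[of z]
      by (intro winding_number_rectpath) (auto simp: in_box_complex_iff a1_def a3_def)
    moreover have "z - cnj z = 2 * \<i> * of_real (Im z)" by (simp add: complex_eq_iff)
    ultimately have int: "(k has_contour_integral (\<i> * (pi * G z))) (rectpath a1 a3)"
      using y by (simp add: field_simps)
    have cont: "k contour_integrable_on linepath u v" 
      if "Im u \<ge> 0" "Im v \<ge> 0" "z \<notin> closed_segment u v" for u v
    proof (rule contour_integrable_continuous_linepath)
      have seg: "Im w \<ge> 0" if "w \<in> closed_segment u v" for w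
        using that \<open>Im u \<ge> 0\<close> \<open>Im v \<ge> 0\<close> by (auto simp: in_segment)
      have "continuous_on (closed_segment u v) G"
      proof (rule holomorphic_on_imp_continuous_on[OF holomorphic_on_subset[OF hol]])
        show "closed_segment u v \<subseteq> {z. - \<eta> < Im z}" using seg \<eta> by force
      qed
      moreover have "w - z \<noteq> 0" if "w \<in> closed_segment u v" for w
        using that \<open>z \<notin> _\<close> by auto
      moreover have "w - cnj z \<noteq> 0" if "w \<in> closed_segment u v" for w
        using seg[OF that] y by (auto simp: complex_eq_iff)
      ultimately show "continuous_on (closed_segment u v) k"
        unfolding k_def by (intro continuous_intros) auto
    qed
    have side: "k contour_integrable_on linepath u v \<and> norm (contour_integral (linepath u v) k) \<le> B * Im z / (R - norm z)\<^sup>2 * norm (v - u)"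
      if uv: "Im u \<ge> 0" "Im v \<ge> 0" "\<And>w. w \<in> closed_segment u v \<Longrightarrow> norm w \<ge> R" for u v
    proof
      show int: "k contour_integrable_on linepath u v"
        using uv R by (intro cont) force+
      show "norm (contour_integral (linepath u v) k) \<le> B * Im z / (R - norm z)\<^sup>2 * norm (v - u)"
      proof (rule contour_integral_bound_linepath[OF int])
        show "0 \<le> B * Im z / (R - norm z)\<^sup>2" using B y by simp
        fix w assume w: "w \<in> closed_segment u v"
        have "Im w \<ge> 0" using w uv(1,2) by (auto simp: in_segment)
        have "norm (w - z) \<ge> R - norm z" using uv(3)[OF w] norm_triangle_ineq2[of w z] by linarith
        moreover have "norm (w - cnj z) \<ge> R - norm z" using uv(3)[OF w] norm_triangle_ineq2[of w "cnj z"] by simp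
        ultimately have "(R - norm z)\<^sup>2 \<le> norm (w - cnj z) * norm (w - z)"
          unfolding power2_eq_square using R by (intro mult_mono) auto
        moreover have "norm (k w) = norm (G w) * Im z / (norm (w - cnj z) * norm (w - z))"
          using y by (simp add: k_def norm_divide norm_mult)
        ultimately show "norm (k w) \<le> B * Im z / (R - norm z)\<^sup>2"
          using bd[OF \<open>Im w \<ge> 0\<close>] y R B by (auto intro!: frac_le mult_right_mono)
      qed
    qed
    have nge: "norm w \<ge> R" if "\<bar>Re w\<bar> = R \<or> Im w = R" for w
      using that abs_Re_le_cmod[of w] abs_Im_le_cmod[of w] by auto
    have seg: "w \<in> closed_segment a2 a3 \<Longrightarrow> Re w = R" "w \<in> closed_segment a3 a4 \<Longrightarrow> Im w = R"
      "w \<in> closed_segment a4 a1 \<Longrightarrow> Re w = - R" for w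
      by (auto simp: in_segment a1_def a2_def a3_def a4_def) (simp_all add: algebra_simps)
    have s2: "k contour_integrable_on linepath a2 a3 \<and> norm (contour_integral (linepath a2 a3) k) \<le> B * Im z / (R - norm z)\<^sup>2 * norm (a3 - a2)"
      using Rpos seg(1) by (intro side nge) (auto simp: a2_def a3_def)
    have s3: "k contour_integrable_on linepath a3 a4 \<and> norm (contour_integral (linepath a3 a4) k) \<le> B * Im z / (R - norm z)\<^sup>2 * norm (a4 - a3)"
      using Rpos seg(2) by (intro side nge) (auto simp: a3_def a4_def)
    have s4: "k contour_integrable_on linepath a4 a1 \<and> norm (contour_integral (linepath a4 a1) k) \<le> B * Im z / (R - norm z)\<^sup>2 * norm (a1 - a4)"
      using Rpos seg(3) by (intro side nge) (auto simp: a4_def a1_def)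
    have s1: "k contour_integrable_on linepath a1 a2"
      using y by (intro cont) (auto simp: a1_def a2_def in_segment)
    have rect: "rectpath a1 a3 = linepath a1 a2 +++ linepath a2 a3 +++ linepath a3 a4 +++ linepath a4 a1"
      by (simp add: rectpath_def Let_def a1_def a2_def a3_def a4_def)
    have "\<i> * (pi * G z) = contour_integral (rectpath a1 a3) k"
      using contour_integral_unique[OF int] by simp
    also have "\<dots> = contour_integral (linepath a1 a2) k + (contour_integral (linepath a2 a3) k
        + (contour_integral (linepath a3 a4) k + contour_integral (linepath a4 a1) k))"
      unfolding rect using s1 s2 s3 s4 by (simp add: contour_integrable_joinI valid_path_join)
    also have "contour_integral (linepath a1 a2) k = integral {- R..R} (\<lambda>x. k (of_real x))"
      using Rpos by (subst contour_integral_linepath_Reals_eq) (auto simp: a1_def a2_def complex_is_Real_iff)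
    also have "\<dots> = \<i> * integral {- R..R} (\<lambda>x. G (of_real x) * of_real (Im z / (norm (z - of_real x))\<^sup>2))"
      unfolding k_real by (rule Henstock_Kurzweil_Integration.integral_mult_right)
    finally have "\<i> * (integral {- R..R} (\<lambda>x. G (of_real x) * of_real (Im z / (norm (z - of_real x))\<^sup>2)) - pi * G z)
       = - (contour_integral (linepath a2 a3) k + (contour_integral (linepath a3 a4) k + contour_integral (linepath a4 a1) k))"
      by (simp add: algebra_simps)
    moreover have "norm a = norm b" if "\<i> * a = - b" for a b :: complex
      using arg_cong[OF that, of norm] by (simp add: norm_mult)
    ultimately have "norm (integral {- R..R} (\<lambda>x. G (of_real x) * of_real (Im z / (norm (z - of_real x))\<^sup>2)) - pi * G z)
       = norm (contour_integral (linepath a2 a3) k + (contour_integral (linepath a3 a4) k + contour_integral (linepath a4 a1) k))"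
      by blast
    also have "\<dots> \<le> norm (contour_integral (linepath a2 a3) k) + (norm (contour_integral (linepath a3 a4) k) + norm (contour_integral (linepath a4 a1) k))"
      by (intro order.trans[OF norm_triangle_ineq] add_left_mono norm_triangle_ineq)
    also have "\<dots> \<le> B * Im z / (R - norm z)\<^sup>2 * R + (B * Im z / (R - norm z)\<^sup>2 * (2 * R) + B * Im z / (R - norm z)\<^sup>2 * R)"
    proof -
      have norms: "norm (a3 - a2) = R" "norm (a4 - a3) = 2 * R" "norm (a1 - a4) = R"
        using Rpos by (auto simp: a1_def a2_def a3_def a4_def cmod_def real_sqrt_mult)
      show ?thesis
        using s2[unfolded norms] s3[unfolded norms] s4[unfolded norms] by (intro add_mono) simp_all
    qed
    also have "\<dots> = 4 * R * (B * Im z / (R - norm z)\<^sup>2)" by (simp add: algebra_simps)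
    finally show ?thesis by (simp add: R_def)
  qed
  have "(\<lambda>n. 4 * real n * (B * Im z / (real n - norm z)\<^sup>2)) \<longlonglongrightarrow> 0"
    by real_asymp
  moreover have "\<forall>\<^sub>F n in sequentially. real n > norm z"
    using filterlim_real_sequentially by (rule filterlim_at_top_dense[THEN iffD1, rule_format])
  then have "\<forall>\<^sub>F n in sequentially. norm (integral {- real n..real n} (\<lambda>x. G (of_real x) * of_real (Im z / (norm (z - of_real x))\<^sup>2)) - pi * G z)
     \<le> 4 * real n * (B * Im z / (real n - norm z)\<^sup>2)"
    by eventually_elim (rule bound)
  ultimately have "(\<lambda>n. integral {- real n..real n} (\<lambda>x. G (of_real x) * of_real (Im z / (norm (z - of_real x))\<^sup>2)) - pi * G z) \<longlonglongrightarrow> 0"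
    by (rule Lim_null_comparison[rotated])
  then show ?thesis by (rule LIM_zero_cancel)
qed

lemma nn_integral_lborel_eq_limit:
  fixes f :: "real \<Rightarrow> real"
  assumes cont: "continuous_on UNIV f" and nonneg: "\<And>x. f x \<ge> 0"
    and lim: "(\<lambda>n. integral {- real n..real n} f) \<longlonglongrightarrow> c"
  shows "(\<integral>\<^sup>+x. ennreal (f x) \<partial>lborel) = ennreal c"
proof (rule LIMSEQ_unique)
  define g where "g = (\<lambda>(n::nat) x. ennreal (indicator {- real n..real n} x * f x))"
  have "incseq g"
    using nonneg by (auto simp: g_def incseq_def le_fun_def split: split_indicator)
  moreover have "(\<lambda>n. g n x) \<longlonglongrightarrow> ennreal (f x)" for x
  proof (rule tendsto_eventually)
    obtain m :: nat where m: "\<bar>x\<bar> \<le> m" using real_arch_simple by blast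
    show "\<forall>\<^sub>F n in sequentially. g n x = ennreal (f x)"
      using eventually_ge_at_top[of m] by eventually_elim (use m in \<open>auto simp: g_def indicator_def\<close>)
  qed
  moreover have "g n \<in> borel_measurable lborel" for n
    using borel_measurable_continuous_onI[OF cont] unfolding g_def by simp
  ultimately show "(\<lambda>n. \<integral>\<^sup>+x. g n x \<partial>lborel) \<longlonglongrightarrow> (\<integral>\<^sup>+x. ennreal (f x) \<partial>lborel)"
    by (intro nn_integral_LIMSEQ) auto
  have "(\<integral>\<^sup>+x. g n x \<partial>lborel) = ennreal (integral {- real n..real n} f)" for n
  proof -
    have int: "set_integrable lborel {- real n..real n} f"
      by (intro borel_integrable_atLeastAtMost' continuous_on_subset[OF cont]) simp
    then have "(\<integral>\<^sup>+x. g n x \<partial>lborel) = ennreal (\<integral>x. indicator {- real n..real n} x * f x \<partial>lborel)"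
      unfolding g_def set_integrable_def using nonneg by (intro nn_integral_eq_integral) auto
    then show ?thesis
      using set_borel_integral_eq_integral(2)[OF int] by (simp add: set_lebesgue_integral_def)
  qed
  then show "(\<lambda>n. \<integral>\<^sup>+x. g n x \<partial>lborel) \<longlonglongrightarrow> ennreal c"
    using lim by (simp add: tendsto_ennrealI)
qed

lemma norm_diff_of_real_square: "(norm (z - of_real x))\<^sup>2 = (Re z - x)\<^sup>2 + (Im z)\<^sup>2"
  by (simp add: cmod_def)

text \<open>Imaginary parts of the Poisson formula have an integrand of constant sign, so the limit
  of truncated integrals is a Lebesgue integral over the whole line.\<close>

lemma nn_integral_Poisson:
  fixes G :: "complex \<Rightarrow> complex"
  assumes hol: "G holomorphic_on {z. Im z > - \<eta>}" and \<eta>: "\<eta> > 0"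
    and bd: "\<And>w. Im w \<ge> 0 \<Longrightarrow> norm (G w) \<le> B" and y: "Im z > 0"
    and nonpos: "\<And>w. Im w \<ge> 0 \<Longrightarrow> Im (G w) \<le> 0"
  shows "(\<integral>\<^sup>+x. ennreal (- Im (G (of_real x)) / pi * (Im z / (norm (z - of_real x))\<^sup>2)) \<partial>lborel) = ennreal (- Im (G z))"
proof (rule nn_integral_lborel_eq_limit)
  have "continuous_on {z. Im z > - \<eta>} G" using hol by (rule holomorphic_on_imp_continuous_on)
  then have contG: "continuous_on UNIV (\<lambda>x. G (complex_of_real x))"
    by (rule continuous_on_compose2) (use \<eta> in \<open>auto intro!: continuous_intros\<close>)
  have nz: "norm (z - of_real x) \<noteq> 0" for x
    using of_real_neq[OF y, of x] by simp
  show "continuous_on UNIV (\<lambda>x. - Im (G (of_real x)) / pi * (Im z / (norm (z - of_real x))\<^sup>2))"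
    using nz by (intro continuous_intros contG) auto
  show "0 \<le> - Im (G (of_real x)) / pi * (Im z / (norm (z - of_real x))\<^sup>2)" for x
    using nonpos[of "of_real x"] y by (intro mult_nonneg_nonneg divide_nonneg_nonneg) auto
  have contk: "continuous_on UNIV (\<lambda>x. G (of_real x) * of_real (Im z / (norm (z - of_real x))\<^sup>2))"
    using nz by (intro continuous_intros contG) auto
  have "(\<lambda>n. - (1 / pi) * Im (integral {- real n..real n} (\<lambda>x. G (of_real x) * of_real (Im z / (norm (z - of_real x))\<^sup>2))))
      \<longlonglongrightarrow> - (1 / pi) * Im (pi * G z)"
    by (intro tendsto_intros half_plane_Poisson_formula[OF hol \<eta> bd y])
  moreover have "- (1 / pi) * Im (integral {- real n..real n} (\<lambda>x. G (of_real x) * of_real (Im z / (norm (z - of_real x))\<^sup>2)))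
     = integral {- real n..real n} (\<lambda>x. - Im (G (of_real x)) / pi * (Im z / (norm (z - of_real x))\<^sup>2))" for n
  proof -
    have "(\<lambda>x. G (of_real x) * of_real (Im z / (norm (z - of_real x))\<^sup>2)) integrable_on {- real n..real n}"
      by (intro integrable_continuous_interval continuous_on_subset[OF contk]) simp
    then have "Im (integral {- real n..real n} (\<lambda>x. G (of_real x) * of_real (Im z / (norm (z - of_real x))\<^sup>2)))
       = integral {- real n..real n} (\<lambda>x. Im (G (of_real x) * of_real (Im z / (norm (z - of_real x))\<^sup>2)))"
      by (rule integral_linear[OF _ bounded_linear_Im, unfolded o_def, symmetric])
    also have "- (1 / pi) * \<dots> = integral {- real n..real n} (\<lambda>x. - (1 / pi) * Im (G (of_real x) * of_real (Im z / (norm (z - of_real x))\<^sup>2)))"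
      by (rule Henstock_Kurzweil_Integration.integral_mult_right[symmetric])
    also have "\<dots> = integral {- real n..real n} (\<lambda>x. - Im (G (of_real x)) / pi * (Im z / (norm (z - of_real x))\<^sup>2))"
      by (intro arg_cong[where f="integral _"] ext) simp
    finally show ?thesis by simp
  qed
  ultimately show "(\<lambda>n. integral {- real n..real n} (\<lambda>x. - Im (G (of_real x)) / pi * (Im z / (norm (z - of_real x))\<^sup>2))) \<longlonglongrightarrow> - Im (G z)"
    by simp
qed

text \<open>When \<open>G\<close> extends holomorphically across the real axis, the measure has the
  explicit density \<open>p\<close>, the boundary value of \<open>- Im G / pi\<close>, and it only
  remains to bound and normalise its mass.\<close>

lemma Im_cauchy_representation_smooth:
  fixes G :: "complex \<Rightarrow> complex"
  assumes hol: "G holomorphic_on {z. Im z > - \<eta>}" and \<eta>: "\<eta> > 0"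
    and bd: "\<And>w. Im w \<ge> 0 \<Longrightarrow> norm (G w) \<le> B"
    and nonpos: "\<And>w. Im w \<ge> 0 \<Longrightarrow> Im (G w) \<le> 0"
    and decay: "\<And>w. Im w > 0 \<Longrightarrow> norm (G w) \<le> C / Im w"
  shows "\<exists>m D. 0 \<le> m \<and> m \<le> C \<and> real_distribution D \<and> (\<forall>z. Im z > 0 \<longrightarrow> Im (G z) = m * Im (cauchy_transform D z))"
proof -
  define p where "p = (\<lambda>x. - Im (G (of_real x)) / pi)"
  have p_nonneg: "p x \<ge> 0" for x using nonpos[of "of_real x"] unfolding p_def by (intro divide_nonneg_pos) auto
  have "continuous_on {z. Im z > - \<eta>} G" using hol by (rule holomorphic_on_imp_continuous_on)
  then have "continuous_on UNIV (\<lambda>x. G (complex_of_real x))"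
    by (rule continuous_on_compose2) (use \<eta> in \<open>auto intro!: continuous_intros\<close>)
  then have "continuous_on UNIV p" unfolding p_def by (intro continuous_intros) auto
  then have p_meas [measurable]: "p \<in> borel_measurable borel" by (rule borel_measurable_continuous_onI)
  have Poisson: "(\<integral>\<^sup>+x. ennreal (p x * (Im z / (norm (z - of_real x))\<^sup>2)) \<partial>lborel) = ennreal (- Im (G z))"
    if "Im z > 0" for z
    unfolding p_def using nn_integral_Poisson[OF hol \<eta> bd that nonpos] .
  have C: "C \<ge> 0" using order.trans[OF norm_ge_zero decay[of \<i>]] by simp
  \<comment> \<open>The weight \<open>n\<^sup>2 / (x\<^sup>2 + n\<^sup>2)\<close> increases to 1. By
    the Poisson formula the mass of \<open>p\<close> is therefore the limit of
    \<open>- n * Im (G (Complex 0 n))\<close>, which the decay of \<open>G\<close> bounds by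
    \<open>C\<close>.\<close>
  have "(\<lambda>n. \<integral>\<^sup>+x. ennreal (p x * (real n * (real n / (norm (Complex 0 (real n) - of_real x))\<^sup>2))) \<partial>lborel) \<longlonglongrightarrow> (\<integral>\<^sup>+x. ennreal (p x) \<partial>lborel)"
  proof (rule nn_integral_LIMSEQ)
    show "incseq (\<lambda>n x. ennreal (p x * (real n * (real n / (norm (Complex 0 (real n) - of_real x))\<^sup>2))))"
    proof (intro incseq_SucI le_funI ennreal_leI mult_left_mono p_nonneg)
      fix n x
      show "real n * (real n / (norm (Complex 0 (real n) - of_real x))\<^sup>2)
        \<le> real (Suc n) * (real (Suc n) / (norm (Complex 0 (real (Suc n)) - of_real x))\<^sup>2)"
      proof (cases "n = 0")
        case False
        have "(real n)\<^sup>2 * x\<^sup>2 \<le> (real (Suc n))\<^sup>2 * x\<^sup>2"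
          by (intro mult_right_mono power_mono) auto
        then have "(real n)\<^sup>2 * (x\<^sup>2 + (real (Suc n))\<^sup>2) \<le> (real (Suc n))\<^sup>2 * (x\<^sup>2 + (real n)\<^sup>2)"
          by (simp add: algebra_simps)
        then have "(real n)\<^sup>2 / (x\<^sup>2 + (real n)\<^sup>2) \<le> (real (Suc n))\<^sup>2 / (x\<^sup>2 + (real (Suc n))\<^sup>2)"
          using False by (subst frac_le_eq) (auto simp: divide_le_0_iff add_nonneg_eq_0_iff)
        then show ?thesis by (simp only: norm_diff_of_real_square) (simp add: power2_eq_square)
      qed simp
    qed
    show "(\<lambda>n. ennreal (p x * (real n * (real n / (norm (Complex 0 (real n) - of_real x))\<^sup>2)))) \<longlonglongrightarrow> ennreal (p x)" for x
    proof (rule tendsto_ennrealI)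
      have "(\<lambda>n. p x * (real n * (real n / (x\<^sup>2 + (real n)\<^sup>2)))) \<longlonglongrightarrow> p x" by real_asymp
      then show "(\<lambda>n. p x * (real n * (real n / (norm (Complex 0 (real n) - of_real x))\<^sup>2))) \<longlonglongrightarrow> p x"
        by (simp add: norm_diff_of_real_square)
    qed
  qed (simp add: norm_diff_of_real_square)
  then have "(\<integral>\<^sup>+x. ennreal (p x) \<partial>lborel) \<le> ennreal C"
  proof (rule LIMSEQ_le_const2, intro exI[of _ 1] allI impI)
    fix n :: nat assume "1 \<le> n"
    then have "(\<integral>\<^sup>+x. ennreal (p x * (real n * (real n / (norm (Complex 0 (real n) - of_real x))\<^sup>2))) \<partial>lborel)
       = (\<integral>\<^sup>+x. ennreal (real n) * ennreal (p x * (real n / (norm (Complex 0 (real n) - of_real x))\<^sup>2)) \<partial>lborel)"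
      by (intro nn_integral_cong) (simp add: mult_ac flip: ennreal_mult')
    also have "\<dots> = ennreal (real n) * (\<integral>\<^sup>+x. ennreal (p x * (real n / (norm (Complex 0 (real n) - of_real x))\<^sup>2)) \<partial>lborel)"
      by (intro nn_integral_cmult) (simp add: norm_diff_of_real_square)
    also have "\<dots> = ennreal (real n * (- Im (G (Complex 0 (real n)))))"
      using Poisson[of "Complex 0 (real n)"] \<open>1 \<le> n\<close> by (simp only: ennreal_mult'[OF of_nat_0_le_iff]) simp
    also have "\<dots> \<le> ennreal C"
    proof (rule ennreal_leI)
      have "- Im (G (Complex 0 (real n))) \<le> C / real n"
        using decay[of "Complex 0 (real n)"] abs_Im_le_cmod[of "G (Complex 0 (real n))"] \<open>1 \<le> n\<close> by simp
      then show "real n * (- Im (G (Complex 0 (real n)))) \<le> C"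
        using \<open>1 \<le> n\<close> by (simp add: field_simps)
    qed
    finally show "(\<integral>\<^sup>+x. ennreal (p x * (real n * (real n / (norm (Complex 0 (real n) - of_real x))\<^sup>2))) \<partial>lborel) \<le> ennreal C" .
  qed
  moreover obtain m where m: "(\<integral>\<^sup>+x. ennreal (p x) \<partial>lborel) = ennreal m" "m \<ge> 0"
    using calculation by (cases "\<integral>\<^sup>+x. ennreal (p x) \<partial>lborel") (auto simp: top_unique)
  ultimately have "m \<le> C" using C by simp
  show ?thesis
  proof (cases "m = 0")
    \<comment> \<open>A density of mass 0 cannot be normalised. Then \<open>Im (G z)\<close>
      vanishes and any distribution serves; the point mass at 0 is taken.\<close>
    case True
    have "(AE x in lborel. ennreal (p x) = 0)"
      using m True nn_integral_0_iff_AE[of "\<lambda>x. ennreal (p x)" lborel] by simp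
    then have "Im (G z) = 0" if "Im z > 0" for z
    proof -
      have "ennreal (- Im (G z)) = (\<integral>\<^sup>+x. ennreal (p x) * ennreal (Im z / (norm (z - of_real x))\<^sup>2) \<partial>lborel)"
        unfolding Poisson[OF that, symmetric]
        by (intro nn_integral_cong ennreal_mult p_nonneg) (use that in simp)
      also have "\<dots> = (\<integral>\<^sup>+x. 0 \<partial>(lborel :: real measure))"
      proof (rule nn_integral_cong_AE)
        show "AE x in lborel. ennreal (p x) * ennreal (Im z / (norm (z - of_real x))\<^sup>2) = 0"
          using \<open>AE x in lborel. ennreal (p x) = 0\<close> by eventually_elim simp
      qed
      finally show ?thesis using nonpos[of z] that by (simp add: ennreal_eq_0_iff)
    qed
    moreover have "real_distribution (return borel (0::real))"
      by (auto simp: real_distribution_def real_distribution_axioms_def intro: prob_space_return)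
    ultimately show ?thesis using C by (intro exI[of _ 0] exI[of _ "return borel 0"]) auto
  next
    case False
    then have m0: "m > 0" using m by simp
    define D where "D = density lborel (\<lambda>x. ennreal (p x / m))"
    have "emeasure D (space D) = (\<integral>\<^sup>+x. ennreal (1 / m) * ennreal (p x) \<partial>lborel)"
      using m0 p_nonneg by (simp add: D_def emeasure_density flip: ennreal_mult)
    also have "\<dots> = ennreal (1 / m) * ennreal m"
      by (subst nn_integral_cmult) (auto simp: m)
    also have "\<dots> = 1" using m0 by (simp flip: ennreal_mult)
    finally have "prob_space D" by (rule prob_spaceI)
    then have D: "real_distribution D"
      by (auto simp: real_distribution_def real_distribution_axioms_def D_def)
    interpret real_distribution D by (rule D)
    have "Im (G z) = m * Im (cauchy_transform D z)" if z: "Im z > 0" for z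
    proof -
      have "ennreal (- Im (cauchy_transform D z)) = (\<integral>\<^sup>+x. ennreal (Im z / (norm (z - of_real x))\<^sup>2) \<partial>D)"
        using integrable_Poisson_kernel[OF z] z
        by (subst Im_cauchy_transform[OF z], subst nn_integral_eq_integral) auto
      also have "\<dots> = (\<integral>\<^sup>+x. ennreal (p x / m) * ennreal (Im z / (norm (z - of_real x))\<^sup>2) \<partial>lborel)"
        unfolding D_def by (rule nn_integral_density) (auto simp: norm_diff_of_real_square)
      also have "\<dots> = (\<integral>\<^sup>+x. ennreal (1 / m) * ennreal (p x * (Im z / (norm (z - of_real x))\<^sup>2)) \<partial>lborel)"
        using m0 p_nonneg z by (intro nn_integral_cong) (simp flip: ennreal_mult)
      also have "\<dots> = ennreal (1 / m) * ennreal (- Im (G z))"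
        unfolding Poisson[OF z, symmetric]
        by (rule nn_integral_cmult) (auto simp: norm_diff_of_real_square)
      also have "\<dots> = ennreal (- Im (G z) / m)"
        using m0 nonpos[of z] z by (subst ennreal_mult[symmetric]) auto
      finally have "- Im (cauchy_transform D z) = - Im (G z) / m"
        using m0 nonpos[of z] z Im_cauchy_transform[OF z]
        by (subst (asm) ennreal_inj) (auto intro!: integral_nonneg_AE divide_nonpos_pos)
      then show ?thesis using m0 by (simp add: field_simps)
    qed
    then show ?thesis using m \<open>m \<le> C\<close> D by blast
  qed
qed

text \<open>The difference takes values on a horizontal line, so it is not an open map and must be
  constant; the decay along the imaginary axis makes the constant 0.\<close>

lemma holomorphic_Im_eq_imp_eq:
  assumes F: "F holomorphic_on upper_half_plane" and G: "G holomorphic_on upper_half_plane"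
    and Im_eq: "\<And>z. Im z > 0 \<Longrightarrow> Im (F z) = Im (G z)"
    and decay: "\<And>z. Im z > 0 \<Longrightarrow> norm (F z - G z) \<le> C / Im z"
    and z: "Im z > 0"
  shows "F z = G z"
proof -
  define H where "H = (\<lambda>z. F z - G z)"
  have "H holomorphic_on upper_half_plane" unfolding H_def using F G by (intro holomorphic_intros)
  have "H constant_on upper_half_plane"
  proof (rule ccontr)
    assume "\<not> H constant_on upper_half_plane"
    then have "open (H ` upper_half_plane)"
      using \<open>H holomorphic_on _\<close>
      by (intro open_mapping_thm[where S=upper_half_plane])
         (auto simp: upper_half_plane_def open_halfspace_Im_gt convex_halfspace_Im_gt convex_connected)
    moreover have "H \<i> \<in> H ` upper_half_plane" by (auto simp: upper_half_plane_def)
    ultimately obtain e where e: "e > 0" "ball (H \<i>) e \<subseteq> H ` upper_half_plane"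
      by (rule openE)
    have "H \<i> + \<i> * of_real (e / 2) \<in> ball (H \<i>) e" using e(1) by (simp add: dist_norm norm_mult)
    then obtain w where "Im w > 0" "H w = H \<i> + \<i> * of_real (e / 2)"
      using e(2) by (force simp: upper_half_plane_def)
    then show False using Im_eq[of w] Im_eq[of \<i>] e(1) by (auto simp: H_def complex_eq_iff)
  qed
  then obtain c where c: "\<And>w. Im w > 0 \<Longrightarrow> H w = c"
    by (auto simp: constant_on_def upper_half_plane_def)
  have "norm c \<le> C / y" if "y > 0" for y
    using decay[of "Complex 0 y"] c[of "Complex 0 y"] that by (simp add: H_def)
  then have "\<forall>\<^sub>F y in at_top. norm c \<le> C / y"
    using eventually_gt_at_top[of 0] by (rule eventually_mono[rotated])
  moreover have "((\<lambda>y. C / y) \<longlongrightarrow> 0) at_top" by real_asymp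
  ultimately have "norm c \<le> 0"
    by (intro tendsto_lowerbound[of "\<lambda>y. C / y"]) auto
  then show ?thesis using c[OF z] by (simp add: H_def)
qed

text \<open>Shifting up by \<open>Complex 0 e\<close> makes \<open>G\<close> holomorphic across the
  real axis and bounded by \<open>C / e\<close>, so the smooth case applies. As \<open>e\<close>
  tends to 0 no mass is lost, because the mass is read off at infinity, where the shift is
  invisible. Finally the imaginary part together with the decay determines \<open>G\<close>.\<close>

theorem cauchy_representation:
  fixes G :: "complex \<Rightarrow> complex"
  assumes hol: "G holomorphic_on upper_half_plane"
    and nonpos: "\<And>z. Im z > 0 \<Longrightarrow> Im (G z) \<le> 0"
    and decay: "\<And>z. Im z > 0 \<Longrightarrow> norm (G z) \<le> C / Im z"
  shows "\<exists>m D. 0 \<le> m \<and> m \<le> C \<and> real_distribution D \<and>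
    (\<forall>z. Im z > 0 \<longrightarrow> G z = of_real m * cauchy_transform D z)"
proof -
  have C: "C \<ge> 0" using order.trans[OF norm_ge_zero decay[of \<i>]] by simp
  have "\<exists>m D. 0 \<le> m \<and> m \<le> C \<and> real_distribution D \<and>
      (\<forall>z. Im z > 0 \<longrightarrow> Im (G (z + Complex 0 e)) = m * Im (cauchy_transform D z))" if e: "e > 0" for e
  proof (rule Im_cauchy_representation_smooth[OF _ e])
    show "(\<lambda>z. G (z + Complex 0 e)) holomorphic_on {z. - e < Im z}"
      by (rule holomorphic_on_compose_gen[OF _ hol, unfolded o_def])
         (auto simp: upper_half_plane_def intro!: holomorphic_intros)
    show "Im (G (w + Complex 0 e)) \<le> 0" if "0 \<le> Im w" for w
      using that e by (intro nonpos) simp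
    show "norm (G (w + Complex 0 e)) \<le> C / e" if "0 \<le> Im w" for w
    proof -
      have "norm (G (w + Complex 0 e)) \<le> C / (Im w + e)"
        using decay[of "w + Complex 0 e"] that e by simp
      also have "\<dots> \<le> C / e" using that e C by (intro divide_left_mono) auto
      finally show ?thesis .
    qed
    show "norm (G (w + Complex 0 e)) \<le> C / Im w" if "0 < Im w" for w
    proof -
      have "norm (G (w + Complex 0 e)) \<le> C / (Im w + e)"
        using decay[of "w + Complex 0 e"] that e by simp
      also have "\<dots> \<le> C / Im w" using that e C by (intro divide_left_mono) auto
      finally show ?thesis .
    qed
  qed
  then obtain \<mu> D where \<mu>: "\<And>e. e > 0 \<Longrightarrow> 0 \<le> \<mu> e" "\<And>e. e > 0 \<Longrightarrow> \<mu> e \<le> C"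
    and D: "\<And>e. e > 0 \<Longrightarrow> real_distribution (D e)"
    and rep: "\<And>e z. e > 0 \<Longrightarrow> Im z > 0 \<Longrightarrow> Im (G (z + Complex 0 e)) = \<mu> e * Im (cauchy_transform (D e) z)"
    by metis
  \<comment> \<open>The limit does not mention \<open>e\<close>, so all the shifted functions have
    the same mass. Passing from \<open>y\<close> to \<open>y + e\<close> costs
    \<open>e * Im (G (Complex 0 (y + e)))\<close>, which tends to 0 by decay.\<close>
  have lim: "((\<lambda>y. y * Im (G (Complex 0 y))) \<longlongrightarrow> - \<mu> e) at_top" if e: "e > 0" for e
  proof -
    interpret real_distribution "D e" by (rule D[OF e])
    have "((\<lambda>y. \<mu> e * ((1 + y * Im (cauchy_transform (D e) (Complex 0 y))) - 1)) \<longlongrightarrow> \<mu> e * (0 - 1)) at_top"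
      by (intro tendsto_intros one_plus_Im_cauchy_transform_tendsto)
    moreover have "((\<lambda>y. e * Im (G (Complex 0 (y + e)))) \<longlongrightarrow> 0) at_top"
    proof (rule Lim_null_comparison)
      show "\<forall>\<^sub>F y in at_top. norm (e * Im (G (Complex 0 (y + e)))) \<le> e * (C / (y + e))"
        using eventually_gt_at_top[of 0]
      proof eventually_elim
        case (elim y)
        have "\<bar>Im (G (Complex 0 (y + e)))\<bar> \<le> C / (y + e)"
          using order.trans[OF abs_Im_le_cmod decay[of "Complex 0 (y + e)"]] elim e by simp
        then show ?case using e by (simp add: abs_mult del: times_divide_eq_right)
      qed
      show "((\<lambda>y. e * (C / (y + e))) \<longlongrightarrow> 0) at_top" by real_asymp
    qed
    ultimately have "((\<lambda>y. \<mu> e * ((1 + y * Im (cauchy_transform (D e) (Complex 0 y))) - 1) + e * Im (G (Complex 0 (y + e))))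
        \<longlongrightarrow> \<mu> e * (0 - 1) + 0) at_top"
      by (rule tendsto_add)
    moreover have "\<forall>\<^sub>F y in at_top. \<mu> e * ((1 + y * Im (cauchy_transform (D e) (Complex 0 y))) - 1) + e * Im (G (Complex 0 (y + e)))
        = (y + e) * Im (G (Complex 0 (y + e)))"
      using eventually_gt_at_top[of 0]
    proof eventually_elim
      case (elim y)
      have "Complex 0 y + Complex 0 e = Complex 0 (y + e)" by (simp add: complex_eq_iff)
      then have "Im (G (Complex 0 (y + e))) = \<mu> e * Im (cauchy_transform (D e) (Complex 0 y))"
        using rep[OF e, of "Complex 0 y"] elim by simp
      then show ?case by (simp add: algebra_simps)
    qed
    ultimately have "((\<lambda>y. (y + e) * Im (G (Complex 0 (y + e)))) \<longlongrightarrow> - \<mu> e) at_top"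
      by (auto intro: Lim_transform_eventually)
    moreover have "filterlim (\<lambda>y. y - e) at_top at_top" by real_asymp
    ultimately have "((\<lambda>y. (y - e + e) * Im (G (Complex 0 (y - e + e)))) \<longlongrightarrow> - \<mu> e) at_top"
      by (rule filterlim_compose)
    then show ?thesis by simp
  qed
  define m where "m = \<mu> 1"
  have m: "\<mu> e = m" if "e > 0" for e
    using tendsto_unique[OF _ lim[OF that] lim[of 1]] by (simp add: m_def)
  have "\<exists>D. real_distribution D \<and> (\<forall>z. Im z > 0 \<longrightarrow> Im (G z) = m * Im (cauchy_transform D z))"
  proof (cases "m = 0")
    case True
    \<comment> \<open>Lowering \<open>z\<close> by half its height and shifting back by the same
      amount uses the representation directly, without a limit in \<open>e\<close>.\<close>
    have "Im (G z) = 0" if "Im z > 0" for z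
      using rep[of "Im z / 2" "z - Complex 0 (Im z / 2)"] m[of "Im z / 2"] that True by simp
    then show ?thesis using True D[of 1] by (intro exI[of _ "D 1"]) simp
  next
    case False
    then have m0: "m > 0" using \<mu>(1)[of 1] by (simp add: m_def)
    define E where "E = (\<lambda>n. D (1 / real (Suc n)))"
    have E: "real_distribution (E n)" for n by (simp add: E_def D)
    have repE: "Im (cauchy_transform (E n) z) = Im (G (z + Complex 0 (1 / Suc n))) / m" if "Im z > 0" for n z
      using rep[of "1 / Suc n" z] m[of "1 / Suc n"] that m0 by (simp add: E_def)
    have limE: "(\<lambda>n. Im (cauchy_transform (E n) z)) \<longlonglongrightarrow> Im (G z) / m" if z: "Im z > 0" for z
    proof -
      have "isCont G z"
        using hol z by (intro holomorphic_on_imp_continuous_on[THEN continuous_on_interior])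
          (auto simp: upper_half_plane_def interior_open open_halfspace_Im_gt)
      moreover have "(\<lambda>n. z + Complex 0 (1 / real (Suc n))) \<longlonglongrightarrow> z + Complex 0 0"
        by (intro tendsto_intros tendsto_Complex LIMSEQ_inverse_real_of_nat[unfolded inverse_eq_divide])
      then have "(\<lambda>n. z + Complex 0 (1 / real (Suc n))) \<longlonglongrightarrow> z"
        by (simp add: zero_complex.code[symmetric])
      ultimately have "(\<lambda>n. G (z + Complex 0 (1 / real (Suc n)))) \<longlonglongrightarrow> G z"
        by (rule isCont_tendsto_compose)
      then show ?thesis unfolding repE[OF z] by (intro tendsto_intros) (use m0 in auto)
    qed
    have "tight E"
    proof (rule tight_of_cauchy_transform[OF E])
      fix e :: real assume "e > 0"
      \<comment> \<open>For fixed \<open>y\<close> this is the limit of the tail functionals of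
        \<open>E n\<close>. It tends to 0 as \<open>y\<close> grows precisely because every shift
        has the mass \<open>m\<close>.\<close>
      have "((\<lambda>y. 1 + y * Im (G (Complex 0 y)) / m) \<longlongrightarrow> 1 + - \<mu> 1 / m) at_top"
        using m0 by (intro tendsto_intros lim) auto
      then have "((\<lambda>y. 1 + y * Im (G (Complex 0 y)) / m) \<longlongrightarrow> 0) at_top"
        using m0 by (simp add: m_def)
      then have "\<forall>\<^sub>F y in at_top. 1 + y * Im (G (Complex 0 y)) / m < e"
        using \<open>e > 0\<close> by (rule order_tendstoD(2))
      then have "\<forall>\<^sub>F y in at_top. 0 < y \<and> 1 + y * Im (G (Complex 0 y)) / m < e"
        using eventually_gt_at_top[of 0] by eventually_elim simp
      from eventually_happens'[OF trivial_limit_at_top_linorder this]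
      obtain y where y: "y > 0" "1 + y * (Im (G (Complex 0 y)) / m) < e" by auto
      have "(\<lambda>n. 1 + y * Im (cauchy_transform (E n) (Complex 0 y))) \<longlonglongrightarrow> 1 + y * (Im (G (Complex 0 y)) / m)"
        using y by (intro tendsto_intros limE) simp
      from order_tendstoD(2)[OF this y(2)]
      show "\<exists>y>0. \<forall>\<^sub>F n in sequentially. 1 + y * Im (cauchy_transform (E n) (Complex 0 y)) < e"
        using y(1) by blast
    qed
    then obtain r L where r: "strict_mono (r :: nat \<Rightarrow> nat)" and L: "real_distribution L"
      and w: "weak_conv_m (E \<circ> id \<circ> r) L"
      using tight_imp_convergent_subsubsequence[of E id] by (auto simp: strict_mono_id)
    have "Im (G z) = m * Im (cauchy_transform L z)" if z: "Im z > 0" for z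
    proof -
      have "(\<lambda>n. cauchy_transform ((E \<circ> id \<circ> r) n) z) \<longlonglongrightarrow> cauchy_transform L z"
        by (rule weak_conv_imp_cauchy_transform_tendsto[OF _ L w z]) (simp add: E)
      then have "(\<lambda>n. Im (cauchy_transform (E (r n)) z)) \<longlonglongrightarrow> Im (cauchy_transform L z)"
        by (auto intro: tendsto_Im)
      moreover have "(\<lambda>n. Im (cauchy_transform (E (r n)) z)) \<longlonglongrightarrow> Im (G z) / m"
        using LIMSEQ_subseq_LIMSEQ[OF limE[OF z] r] by (simp add: o_def)
      ultimately show ?thesis using m0 LIMSEQ_unique by (fastforce simp: field_simps)
    qed
    then show ?thesis using L by blast
  qed
  then obtain L where L: "real_distribution L" and Im_eq: "\<And>z. Im z > 0 \<Longrightarrow> Im (G z) = m * Im (cauchy_transform L z)"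
    by blast
  interpret real_distribution L by (rule L)
  have "0 \<le> m" "m \<le> C" using \<mu>[of 1] by (simp_all add: m_def)
  have "G z = of_real m * cauchy_transform L z" if z: "Im z > 0" for z
  proof (rule holomorphic_Im_eq_imp_eq[OF hol _ _ _ z])
    show "(\<lambda>z. of_real m * cauchy_transform L z) holomorphic_on upper_half_plane"
      by (intro holomorphic_intros holomorphic_cauchy_transform)
    show "norm (G w - of_real m * cauchy_transform L w) \<le> (C + m) / Im w" if w: "Im w > 0" for w
    proof -
      have "norm (G w - of_real m * cauchy_transform L w) \<le> norm (G w) + m * norm (cauchy_transform L w)"
        using norm_triangle_ineq4[of "G w" "of_real m * cauchy_transform L w"] \<open>0 \<le> m\<close> by (simp add: norm_mult)
      also have "\<dots> \<le> C / Im w + m * (1 / Im w)"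
        using \<open>0 \<le> m\<close> by (intro add_mono mult_left_mono decay norm_cauchy_transform_le w) auto
      finally show ?thesis by (simp add: add_divide_distrib)
    qed
  qed (use Im_eq in simp)
  then show ?thesis using \<open>0 \<le> m\<close> \<open>m \<le> C\<close> L by blast
qed

section \<open>The class of maps normalised at infinity\<close>

text \<open>Phragmen-Lindelof for \<open>exp (\<i> * (h w - w))\<close>, whose modulus is
  \<open>exp (Im w - Im (h w))\<close>. On the line \<open>Im w = e\<close> it is at most
  \<open>exp e\<close> since \<open>Im (h w) > 0\<close>; above that line the bound on
  \<open>h w - w\<close> gives \<open>exp (C / e)\<close>. Division by
  \<open>1 - \<i> * d * w\<close>, of modulus at least 1, damps it at infinity, and in the end
  \<open>d\<close> and \<open>e\<close> tend to 0.\<close>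

lemma class_R_Im_ge:
  assumes h: "h \<in> class_R" and z0: "Im z0 > 0"
  shows "Im z0 \<le> Im (h z0)"
proof -
  obtain C where hol: "h holomorphic_on upper_half_plane" and C: "C \<ge> 0"
    and bd: "\<And>z. Im z > 0 \<Longrightarrow> norm (h z - z) \<le> C / Im z"
    and pos: "\<And>z. Im z > 0 \<Longrightarrow> Im (h z) > 0"
    using h unfolding class_R_def upper_half_plane_def by (auto simp: PiE_iff)
  have key: "Im z0 - Im (h z0) \<le> e + d * norm z0" if e: "0 < e" "e < Im z0" and d: "d > 0" for e d
  proof -
    \<comment> \<open>The radius makes \<open>d * R - 1 \<ge> exp (C / e)\<close>, so
      \<open>norm (Q w) \<le> 1\<close> on the arc; the summand \<open>norm z0\<close> puts
      \<open>z0\<close> into the disc.\<close>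
    define R where "R = norm z0 + (exp (C / e) + 1) / d"
    define S where "S = cball 0 R \<inter> {w. Im w \<ge> e}"
    define Q where "Q = (\<lambda>w. exp (\<i> * (h w - w)) / (1 - \<i> * of_real d * w))"
    have den: "norm (1 - \<i> * of_real d * w) \<ge> 1" if "Im w > 0" for w
    proof -
      have "1 \<le> Re (1 - \<i> * of_real d * w)" using that d by simp
      also have "\<dots> \<le> norm (1 - \<i> * of_real d * w)" by (rule complex_Re_le_cmod)
      finally show ?thesis .
    qed
    have S_sub: "S \<subseteq> upper_half_plane" using e by (auto simp: S_def upper_half_plane_def)
    have holQ: "Q holomorphic_on upper_half_plane"
    proof -
      have "1 - \<i> * of_real d * w \<noteq> 0" if "w \<in> upper_half_plane" for w
        using den[of w] that by (auto simp: upper_half_plane_def)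
      then show ?thesis unfolding Q_def by (intro holomorphic_intros hol) auto
    qed
    have closed: "closed S" unfolding S_def by (intro closed_Int closed_halfspace_Im_ge closed_cball)
    have "norm (Q z0) \<le> exp e"
    proof (rule maximum_modulus_frontier[where f=Q and S=S])
      show "Q holomorphic_on interior S"
        using holQ S_sub interior_subset by (metis holomorphic_on_subset subset_trans)
      show "continuous_on (closure S) Q"
        using holQ S_sub closed by (metis closure_closed holomorphic_on_imp_continuous_on holomorphic_on_subset)
      show "bounded S" unfolding S_def by (intro bounded_Int) auto
      have "R \<ge> norm z0" unfolding R_def using d by (simp add: add_nonneg_nonneg)
      then show "z0 \<in> S" using e by (simp add: S_def)
      fix w assume w: "w \<in> frontier S"
      have wS: "w \<in> S" using w closed by (auto simp: frontier_def)
      then have Im_w: "Im w \<ge> e" "Im w > 0" using e by (auto simp: S_def)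
      have bdry: "norm w = R \<or> Im w = e"
      proof (rule ccontr)
        assume "\<not> ?thesis"
        then have "w \<in> ball 0 R \<inter> {w. Im w > e}" using wS by (auto simp: S_def)
        moreover have "open (ball 0 R \<inter> {w. Im w > e})" by (intro open_Int open_halfspace_Im_gt open_ball)
        moreover have "ball 0 R \<inter> {w. Im w > e} \<subseteq> S" by (auto simp: S_def)
        ultimately have "w \<in> interior S" by (meson interiorI)
        then show False using w by (simp add: frontier_def)
      qed
      have norm_Q: "norm (Q w) = exp (Im w - Im (h w)) / norm (1 - \<i> * of_real d * w)"
        by (simp add: Q_def norm_divide norm_exp_eq_Re)
      show "norm (Q w) \<le> exp e"
        using bdry
      proof
        assume "Im w = e"
        then have "exp (Im w - Im (h w)) \<le> exp e" using pos[OF Im_w(2)] by simp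
        then have "norm (Q w) \<le> exp e / 1"
          unfolding norm_Q using den[OF Im_w(2)] by (intro frac_le) auto
        then show ?thesis by simp
      next
        assume R: "norm w = R"
        have "Im w - Im (h w) \<le> norm (h w - w)"
          using abs_Im_le_cmod[of "h w - w"] by simp
        also have "\<dots> \<le> C / Im w" using Im_w by (intro bd) auto
        also have "\<dots> \<le> C / e" using Im_w e C by (intro divide_left_mono) auto
        finally have 1: "exp (Im w - Im (h w)) \<le> exp (C / e)" by simp
        have "exp (C / e) + 1 \<le> d * R"
          using d by (simp add: R_def field_simps)
        also have "d * R - 1 \<le> norm (1 - \<i> * of_real d * w)"
          using norm_triangle_ineq3[of 1 "\<i> * of_real d * w"] R d by (simp add: norm_mult)
        finally have 2: "exp (C / e) \<le> norm (1 - \<i> * of_real d * w)" by simp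
        have "norm (Q w) \<le> exp (C / e) / exp (C / e)"
          unfolding norm_Q using 1 2 by (intro frac_le) auto
        also have "\<dots> \<le> exp e" using e by simp
        finally show ?thesis .
      qed
    qed
    have "exp (Im z0 - Im (h z0)) = norm (Q z0) * norm (1 - \<i> * of_real d * z0)"
    proof -
      have gen: "a = a / b * b" if "b \<noteq> 0" for a b :: real using that by simp
      have "norm (1 - \<i> * of_real d * z0) \<noteq> 0" using den[OF z0] by linarith
      then have "norm (exp (\<i> * (h z0 - z0))) = norm (Q z0) * norm (1 - \<i> * of_real d * z0)"
        unfolding Q_def norm_divide using gen by blast
      then show ?thesis by (simp add: norm_exp_eq_Re)
    qed
    also have "\<dots> \<le> exp e * exp (d * norm z0)"
    proof (intro mult_mono)
      have "norm (1 - \<i> * of_real d * z0) \<le> 1 + d * norm z0"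
        using norm_triangle_ineq4[of 1 "\<i> * of_real d * z0"] d by (simp add: norm_mult)
      also have "\<dots> \<le> exp (d * norm z0)" by (rule exp_ge_add_one_self)
      finally show "norm (1 - \<i> * of_real d * z0) \<le> exp (d * norm z0)" .
    qed (use \<open>norm (Q z0) \<le> exp e\<close> in auto)
    finally show ?thesis by (simp flip: exp_add)
  qed
  have "Im z0 - Im (h z0) \<le> r" if "r > 0" for r
  proof -
    define e where "e = min (r / 2) (Im z0 / 2)"
    define d where "d = r / 2 / (norm z0 + 1)"
    have "norm z0 + 1 > 0" by (simp add: add_nonneg_pos)
    then have "d > 0" "d * norm z0 \<le> r / 2" using that by (auto simp: d_def field_simps)
    moreover have "0 < e" "e < Im z0" "e \<le> r / 2" using that z0 by (auto simp: e_def)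
    ultimately show ?thesis using key[of e d] by linarith
  qed
  then have "Im z0 - Im (h z0) \<le> 0" by (rule field_le_epsilon[where y=0, simplified])
  then show ?thesis by simp
qed

lemma (in real_distribution) Im_cauchy_transform_nonpos:
  "Im z > 0 \<Longrightarrow> Im (cauchy_transform M z) \<le> 0"
  by (simp add: Im_cauchy_transform)

lemma has_capacity_cauchy:
  assumes "real_distribution D" and rep: "\<And>z. Im z > 0 \<Longrightarrow> h z = z - of_real c * cauchy_transform D z"
  shows "has_capacity h c"
proof -
  interpret real_distribution D by fact
  have "((\<lambda>y::real. of_real c * (\<i> * of_real y * cauchy_transform D (\<i> * of_real y))) \<longlongrightarrow> of_real c * 1) at_top"
    by (intro tendsto_intros cauchy_transform_asymptotics)
  moreover have "\<forall>\<^sub>F y::real in at_top. of_real c * (\<i> * of_real y * cauchy_transform D (\<i> * of_real y))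
      = \<i> * of_real y * (\<i> * of_real y - h (\<i> * of_real y))"
    using eventually_gt_at_top[of 0] by eventually_elim (simp add: rep)
  ultimately show ?thesis unfolding has_capacity_def by (auto intro: Lim_transform_eventually)
qed

lemma has_capacity_unique: "has_capacity h c \<Longrightarrow> has_capacity h c' \<Longrightarrow> c = c'"
  unfolding has_capacity_def using tendsto_unique[OF trivial_limit_at_top_linorder] of_real_eq_iff by blast

text \<open>\<open>class_R_Im_ge\<close> puts \<open>z - h z\<close> into the closed lower
  half-plane, and membership in the class supplies the decay. The mass of the representing measure
  then is the capacity.\<close>

theorem class_R_representation:
  assumes h: "h \<in> class_R"
  shows "\<exists>c D. c \<ge> 0 \<and> real_distribution D \<and> has_capacity h c \<and>
    (\<forall>z. Im z > 0 \<longrightarrow> h z = z - of_real c * cauchy_transform D z)"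
proof -
  obtain C where hol: "h holomorphic_on upper_half_plane"
    and bd: "\<And>z. Im z > 0 \<Longrightarrow> norm (h z - z) \<le> C / Im z"
    using h unfolding class_R_def upper_half_plane_def by auto
  have "\<exists>c D. 0 \<le> c \<and> c \<le> C \<and> real_distribution D \<and>
      (\<forall>z. Im z > 0 \<longrightarrow> z - h z = of_real c * cauchy_transform D z)"
  proof (rule cauchy_representation)
    show "(\<lambda>z. z - h z) holomorphic_on upper_half_plane" by (intro holomorphic_intros hol)
    show "Im (z - h z) \<le> 0" if "Im z > 0" for z using class_R_Im_ge[OF h that] by simp
    show "norm (z - h z) \<le> C / Im z" if "Im z > 0" for z
      using bd[OF that] by (simp add: norm_minus_commute)
  qed
  then obtain c D where cD: "0 \<le> c" "real_distribution D" "\<And>z. Im z > 0 \<Longrightarrow> h z = z - of_real c * cauchy_transform D z"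
    by (auto simp: algebra_simps)
  moreover have "has_capacity h c" using cD by (intro has_capacity_cauchy) auto
  ultimately show ?thesis by blast
qed

text \<open>With \<open>z = \<i> * y\<close>, write \<open>z - g (h z)\<close> as
  \<open>z - h z\<close> plus \<open>a\<close> times the transform of \<open>D\<close> at
  \<open>h z\<close>. Moving the argument back to \<open>z\<close> costs at most
  \<open>b / y ^ 3\<close>, since \<open>h z - z\<close> is at most \<open>b / y\<close> and
  \<open>h\<close> does not lower heights; times \<open>y\<close> this vanishes in the
  limit.\<close>

lemma has_capacity_compose:
  assumes g: "g \<in> class_R" "has_capacity g a" and h: "h \<in> class_R" "has_capacity h b"
  shows "has_capacity (compose upper_half_plane g h) (a + b)"
proof -
  obtain D where D: "real_distribution D" "a \<ge> 0" "\<And>z. Im z > 0 \<Longrightarrow> g z = z - of_real a * cauchy_transform D z"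
    using class_R_representation[OF g(1)] has_capacity_unique[OF g(2)] by blast
  obtain E where E: "real_distribution E" "b \<ge> 0" "\<And>z. Im z > 0 \<Longrightarrow> h z = z - of_real b * cauchy_transform E z"
    using class_R_representation[OF h(1)] has_capacity_unique[OF h(2)] by blast
  interpret D: real_distribution D by (rule D)
  interpret E: real_distribution E by (rule E)
  have "((\<lambda>y::real. of_real a * (\<i> * of_real y * (cauchy_transform D (h (\<i> * of_real y)) - cauchy_transform D (\<i> * of_real y)))) \<longlongrightarrow> 0) at_top"
  proof (rule Lim_null_comparison)
    show "\<forall>\<^sub>F y in at_top. norm (of_real a * (\<i> * of_real y * (cauchy_transform D (h (\<i> * of_real y)) - cauchy_transform D (\<i> * of_real y)))) \<le> a * (y * ((b / y) / (y * y)))"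
      using eventually_gt_at_top[of "0::real"]
    proof eventually_elim
      case (elim y)
      define z where "z = \<i> * complex_of_real y"
      have z: "Im z = y" by (simp add: z_def)
      have hz: "Im (h z) \<ge> y" using class_R_Im_ge[OF h(1), of z] elim z by simp
      have "norm (h z - z) \<le> b / y"
        using E(3)[of z] E(2) E.norm_cauchy_transform_le[of z] elim z
        by (simp add: norm_mult) (metis mult_left_mono times_divide_eq_right mult.right_neutral)
      have "norm (cauchy_transform D (h z) - cauchy_transform D z) \<le> norm (h z - z) / (Im (h z) * Im z)"
        using D.dist_cauchy_transform_le[of "h z" z] hz z elim by (simp add: dist_norm)
      also have "\<dots> \<le> (b / y) / (y * y)"
        using \<open>norm (h z - z) \<le> b / y\<close> hz z elim E(2) by (intro frac_le mult_mono) auto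
      finally have "norm (cauchy_transform D (h z) - cauchy_transform D z) \<le> (b / y) / (y * y)" .
      then have "a * (y * norm (cauchy_transform D (h z) - cauchy_transform D z)) \<le> a * (y * ((b / y) / (y * y)))"
        using D(2) elim by (intro mult_left_mono) auto
      then show ?case using D(2) elim by (simp add: norm_mult z_def del: times_divide_eq_right divide_divide_eq_left)
    qed
    show "((\<lambda>y. a * (y * ((b / y) / (y * y)))) \<longlongrightarrow> 0) at_top" by real_asymp
  qed
  moreover have "((\<lambda>y::real. of_real a * (\<i> * of_real y * cauchy_transform D (\<i> * of_real y))) \<longlongrightarrow> of_real a * 1) at_top"
    by (intro tendsto_intros D.cauchy_transform_asymptotics)
  moreover have "((\<lambda>y::real. \<i> * of_real y * (\<i> * of_real y - h (\<i> * of_real y))) \<longlongrightarrow> of_real b) at_top"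
    using h(2) by (simp add: has_capacity_def)
  ultimately have "((\<lambda>y::real. of_real a * (\<i> * of_real y * (cauchy_transform D (h (\<i> * of_real y)) - cauchy_transform D (\<i> * of_real y)))
       + of_real a * (\<i> * of_real y * cauchy_transform D (\<i> * of_real y))
       + \<i> * of_real y * (\<i> * of_real y - h (\<i> * of_real y))) \<longlongrightarrow> 0 + of_real a * 1 + of_real b) at_top"
    by (intro tendsto_add)
  moreover have "\<forall>\<^sub>F y::real in at_top. of_real a * (\<i> * of_real y * (cauchy_transform D (h (\<i> * of_real y)) - cauchy_transform D (\<i> * of_real y)))
       + of_real a * (\<i> * of_real y * cauchy_transform D (\<i> * of_real y))
       + \<i> * of_real y * (\<i> * of_real y - h (\<i> * of_real y))
      = \<i> * of_real y * (\<i> * of_real y - compose upper_half_plane g h (\<i> * of_real y))"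
    using eventually_gt_at_top[of 0]
  proof eventually_elim
    case (elim y)
    define z where "z = \<i> * complex_of_real y"
    have z: "Im z > 0" using elim by (simp add: z_def)
    then have "Im (h z) > 0" using class_R_Im_ge[OF h(1) z] by linarith
    then have eq: "compose upper_half_plane g h z = h z - of_real a * cauchy_transform D (h z)"
      using z D(3) by (simp add: compose_def upper_half_plane_def)
    show ?case unfolding z_def[symmetric] eq by (simp add: algebra_simps)
  qed
  ultimately show ?thesis unfolding has_capacity_def by (auto intro: Lim_transform_eventually)
qed

text \<open>Capacities add under composition and are nonnegative, so in a chain the element of
  larger capacity must be the one that factors through the other, and the inner map has capacity
  \<open>t - s\<close>.\<close>

lemma Loewner_transition:
  assumes f: "chordal_Loewner_family f" and st: "0 \<le> s" "s < t"
  shows "\<exists>D. real_distribution D \<and>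
    (\<forall>z. Im z > 0 \<longrightarrow> f t z = f s (z - of_real (t - s) * cauchy_transform D z))"
proof -
  have chain: "pred_on.chain class_R prec_R (f ` {0..})" and cap: "\<And>t. t \<ge> 0 \<Longrightarrow> has_capacity (f t) t"
    using f by (auto simp: chordal_Loewner_family_def chordal_Loewner_set_def pred_on.maxchain_def)
  have R: "f t \<in> class_R" if "t \<ge> 0" for t
    using chain that by (auto simp: pred_on.chain_def)
  have cap_le: "b \<le> a \<and> (\<exists>h\<in>class_R. f a = compose upper_half_plane (f b) h \<and> has_capacity h (a - b))"
    if ab: "a \<ge> 0" "b \<ge> 0" and prec: "prec_R (f a) (f b)" for a b
  proof -
    obtain h where h: "h \<in> class_R" "f a = compose upper_half_plane (f b) h"
      using prec by (auto simp: prec_R_def)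
    obtain c where c: "c \<ge> 0" "has_capacity h c" using class_R_representation[OF h(1)] by blast
    have "has_capacity (f a) (b + c)"
      unfolding h(2) by (rule has_capacity_compose[OF R[OF ab(2)] cap[OF ab(2)] h(1) c(2)])
    then have "a = b + c" using has_capacity_unique cap[OF ab(1)] by blast
    then show ?thesis using h c by auto
  qed
  have "f s \<noteq> f t" using cap[of s] cap[of t] st has_capacity_unique[of "f s" s t] by auto
  moreover have "prec_R (f s) (f t) \<or> f s = f t \<or> prec_R (f t) (f s)"
    using chain st unfolding pred_on.chain_def by force
  moreover have "\<not> prec_R (f s) (f t)" using cap_le[of s t] st by auto
  ultimately obtain h where h: "h \<in> class_R" "f t = compose upper_half_plane (f s) h" "has_capacity h (t - s)"
    using cap_le[of t s] st by auto
  obtain D where D: "real_distribution D" "\<And>z. Im z > 0 \<Longrightarrow> h z = z - of_real (t - s) * cauchy_transform D z"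
    using class_R_representation[OF h(1)] has_capacity_unique[OF h(3)] by blast
  have "f t z = f s (z - of_real (t - s) * cauchy_transform D z)" if "Im z > 0" for z
    using h(2) D(2)[OF that] that by (simp add: compose_def upper_half_plane_def)
  then show ?thesis using D(1) by blast
qed

lemma Loewner_representation:
  assumes f: "chordal_Loewner_family f" and t: "t \<ge> 0"
  shows "\<exists>D. real_distribution D \<and> (\<forall>z. Im z > 0 \<longrightarrow> f t z = z - of_real t * cauchy_transform D z)"
proof -
  have "f t \<in> class_R" "has_capacity (f t) t"
    using f t by (auto simp: chordal_Loewner_family_def chordal_Loewner_set_def pred_on.maxchain_def pred_on.chain_def)
  then show ?thesis using class_R_representation[of "f t"] has_capacity_unique by blast
qed

section \<open>Differentiation of Lipschitz functions\<close>

text \<open>Both sides are measures in \<open>A\<close> that agree on half-open intervals. With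
  \<open>G x = c * x - F x\<close> it splits a multiple of Lebesgue measure into two Stieltjes
  measures.\<close>

lemma emeasure_interval_measure_add:
  fixes F G :: "real \<Rightarrow> real"
  assumes mono: "mono F" "mono G" and cont: "continuous_on UNIV F" "continuous_on UNIV G"
    and sum: "\<And>x. F x + G x = c * x" and "c \<ge> 0" and A: "A \<in> sets borel"
  shows "emeasure (interval_measure F) A + emeasure (interval_measure G) A = ennreal c * emeasure lborel A"
proof -
  define \<nu> where "\<nu> = (\<lambda>A. emeasure (interval_measure F) A + emeasure (interval_measure G) A)"
  define N where "N = measure_of UNIV (sets borel) \<nu>"
  have N: "emeasure N B = \<nu> B" if "B \<in> sets borel" for B
  proof (rule emeasure_measure_of[OF N_def])
    show "countably_additive (sets N) \<nu>"
      by (auto simp: countably_additive_def N_def \<nu>_def sets.sigma_sets_eq[of borel, simplified]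
          suminf_emeasure suminf_add[OF summableI summableI, symmetric])
  qed (use that in \<open>auto simp: N_def \<nu>_def positive_def\<close>)
  have Ioc: "emeasure (interval_measure H) {a<..b} = ennreal (H b - H a)" 
    if "a \<le> b" "mono H" "continuous_on UNIV H" for a b H
    using that by (intro emeasure_interval_measure_Ioc)
      (auto simp: mono_def continuous_on_eq_continuous_within continuous_at_imp_continuous_within)
  have "N = scale_measure (ennreal c) lborel"
  proof (rule measure_eqI_generator_eq)
    let ?E = "range (\<lambda>(a, b). {a<..b::real})"
    show "Int_stable ?E"
      by (auto simp: Int_stable_def) 
    show "sets N = sigma_sets UNIV ?E" "sets (scale_measure (ennreal c) lborel) = sigma_sets UNIV ?E"
      by (simp_all add: N_def borel_sigma_sets_Ioc sigma_sets_sigma_sets_eq)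
    show "emeasure N X = emeasure (scale_measure (ennreal c) lborel) X" if XE: "X \<in> ?E" for X
    proof -
      obtain a b where X: "X = {a<..b}" using XE by auto
      show ?thesis
      proof (cases "a \<le> b")
        case True
        have "F a \<le> F b" "G a \<le> G b" using True mono by (auto simp: mono_def)
        moreover have "F b - F a + (G b - G a) = c * (b - a)"
          using sum[of a] sum[of b] by (simp add: algebra_simps)
        ultimately show ?thesis using True mono cont \<open>c \<ge> 0\<close>
          by (simp add: X N \<nu>_def Ioc ennreal_mult flip: ennreal_plus)
      qed (simp add: X N \<nu>_def)
    qed
    show "range (\<lambda>i::nat. {- real i<..real i}) \<subseteq> ?E" by auto
    show "(\<Union>i::nat. {- real i<..real i}) = UNIV" by (rule UN_Ioc_eq_UNIV)
    show "emeasure N {- real i<..real i} \<noteq> \<infinity>" for i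
      using mono cont by (simp add: N \<nu>_def Ioc)
  qed auto
  then have "emeasure N A = ennreal c * emeasure lborel A" by simp
  then show ?thesis using A by (simp add: N \<nu>_def)
qed

lemma mono_linear_minus_lipschitz:
  assumes "L-lipschitz_on UNIV (F::real \<Rightarrow> real)" shows "mono (\<lambda>x. L * x - F x)"
proof (rule monoI)
  fix x y :: real assume "x \<le> y"
  then have "F y - F x \<le> L * (y - x)"
    using lipschitz_onD[OF assms, of y x] by (simp add: dist_real_def)
  then show "L * x - F x \<le> L * y - F y" by (simp add: algebra_simps)
qed

text \<open>The Stieltjes measure of \<open>F\<close> is one summand of \<open>L\<close> times
  Lebesgue measure, the other coming from \<open>L * x - F x\<close>.\<close>

lemma absolutely_continuous_interval_measure:
  fixes F :: "real \<Rightarrow> real"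
  assumes mono: "mono F" and lip: "L-lipschitz_on UNIV F" and N: "N \<in> null_sets lborel"
  shows "N \<in> null_sets (interval_measure F)"
proof -
  have cont: "continuous_on UNIV F" using lip by (rule lipschitz_on_continuous_on)
  have "emeasure (interval_measure F) N + emeasure (interval_measure (\<lambda>x. L * x - F x)) N = ennreal L * emeasure lborel N"
    using N lip by (intro emeasure_interval_measure_add mono mono_linear_minus_lipschitz continuous_intros cont)
      (auto intro: lipschitz_on_nonneg)
  then show ?thesis using N by (auto simp: null_sets_def)
qed

text \<open>Inside any open \<open>U\<close> around \<open>E\<close>, the short intervals of slope
  below \<open>p\<close> form a Vitali cover of \<open>E\<close>. A disjoint countable subfamily
  covers almost all of \<open>E\<close>; summing over it gives the bound with \<open>U\<close>, and
  outer regularity shrinks \<open>U\<close> to \<open>E\<close>.\<close>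

lemma interval_measure_le_of_lower_derivate:
  fixes F :: "real \<Rightarrow> real"
  assumes mono: "mono F" and lip: "L-lipschitz_on UNIV F" and "p \<ge> 0"
    and E: "E \<in> sets borel" 
    and low: "\<And>x d. x \<in> E \<Longrightarrow> d > 0 \<Longrightarrow> \<exists>u v. u \<le> x \<and> x \<le> v \<and> u < v \<and> v - u < d \<and> F v - F u < p * (v - u)"
  shows "emeasure (interval_measure F) E \<le> ennreal p * emeasure lborel E"
proof -
  have cont: "continuous_on UNIV F" using lip by (rule lipschitz_on_continuous_on)
  then have rc: "continuous (at_right a) F" for a
    by (simp add: continuous_on_eq_continuous_within continuous_at_imp_continuous_within)
  have Ioc: "emeasure (interval_measure F) {a<..b} = ennreal (F b - F a)" if "a \<le> b" for a b
    by (rule emeasure_interval_measure_Ioc) (use that mono rc in \<open>auto simp: mono_def\<close>)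
  have bound: "emeasure (interval_measure F) E \<le> ennreal p * emeasure lborel U" 
    if U: "open U" "E \<subseteq> U" for U
  proof -
    define K where "K = {(u, v). u < v \<and> {u..v} \<subseteq> U \<and> F v - F u < p * (v - u)}"
    define a r where "a = (\<lambda>(u, v). (u + v) / 2 :: real)" and "r = (\<lambda>(u, v). (v - u) / 2 :: real)"
    have ball: "cball (a i) (r i) = {fst i..snd i}" for i
      by (auto simp: a_def r_def dist_real_def abs_if field_simps split: prod.splits if_splits)
    obtain C where C: "countable C" "C \<subseteq> K"
        "pairwise (\<lambda>i j. disjnt (cball (a i) (r i)) (cball (a j) (r j))) C"
        "negligible (E - (\<Union>i \<in> C. cball (a i) (r i)))"
    proof (rule Vitali_covering_theorem_cballs[of K r E a])
      show "0 < r i" if "i \<in> K" for i using that by (auto simp: K_def r_def)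
      fix x d :: real assume x: "x \<in> E" "0 < d"
      obtain e where e: "e > 0" "ball x e \<subseteq> U" using U x openE by blast
      obtain u v where uv: "u \<le> x" "x \<le> v" "u < v" "v - u < min d e" "F v - F u < p * (v - u)"
        using low[OF x(1), of "min d e"] x e by auto
      have "{u..v} \<subseteq> ball x e" using uv by (auto simp: dist_real_def)
      then have "(u, v) \<in> K" using uv e by (auto simp: K_def)
      moreover have "x \<in> cball (a (u, v)) (r (u, v))" using uv by (simp add: ball)
      moreover have "r (u, v) < d" using uv by (simp add: r_def)
      ultimately show "\<exists>i. i \<in> K \<and> x \<in> cball (a i) (r i) \<and> r i < d" by blast
    qed
    define V where "V = (\<Union>i\<in>C. {fst i..snd i})"
    have V: "V \<in> sets borel" using C(1) by (auto simp: V_def)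
    have disj: "disjoint_family_on (\<lambda>i. {fst i..snd i}) C"
      using C(3) by (auto simp: disjoint_family_on_def pairwise_def disjnt_def ball)
    \<comment> \<open>Vitali leaves only a Lebesgue null set uncovered, and it is also null for the
      Stieltjes measure by absolute continuity.\<close>
    have "E - V \<in> null_sets lborel"
      using C(4) E V by (auto simp: negligible_iff_null_sets ball V_def[symmetric] null_sets_completion_iff)
    then have "E - V \<in> null_sets (interval_measure F)"
      by (rule absolutely_continuous_interval_measure[OF mono lip])
    have Icc: "emeasure (interval_measure F) {fst i..snd i} \<le> ennreal p * emeasure lborel {fst i..snd i}"
      if "i \<in> C" for i
    proof -
      have i: "fst i < snd i" "F (snd i) - F (fst i) < p * (snd i - fst i)"
        using that C(2) by (auto simp: K_def)
      have "{fst i} \<in> null_sets (interval_measure F)"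
        by (rule absolutely_continuous_interval_measure[OF mono lip]) auto
      then have "emeasure (interval_measure F) ({fst i<..snd i} \<union> {fst i}) = emeasure (interval_measure F) {fst i<..snd i}"
        by (intro emeasure_Un_null_set) auto
      also have "{fst i<..snd i} \<union> {fst i} = {fst i..snd i}" using i by auto
      finally have "emeasure (interval_measure F) {fst i..snd i} = ennreal (F (snd i) - F (fst i))"
        using Ioc[of "fst i" "snd i"] i by simp
      also have "\<dots> \<le> ennreal (p * (snd i - fst i))" using i by (intro ennreal_leI) auto
      also have "\<dots> = ennreal p * emeasure lborel {fst i..snd i}"
        using i \<open>p \<ge> 0\<close> by (simp add: ennreal_mult)
      finally show ?thesis .
    qed
    have "emeasure (interval_measure F) E \<le> emeasure (interval_measure F) (V \<union> (E - V))"
      using V E by (intro emeasure_mono) auto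
    also have "\<dots> = emeasure (interval_measure F) V"
      using \<open>E - V \<in> null_sets (interval_measure F)\<close> V by (intro emeasure_Un_null_set) auto
    also have "\<dots> = (\<integral>\<^sup>+i. emeasure (interval_measure F) {fst i..snd i} \<partial>count_space C)"
      unfolding V_def using C(1) disj by (intro emeasure_UN_countable) auto
    also have "\<dots> \<le> (\<integral>\<^sup>+i. ennreal p * emeasure lborel {fst i..snd i} \<partial>count_space C)"
      using Icc by (intro nn_integral_mono) auto
    also have "\<dots> = ennreal p * (\<integral>\<^sup>+i. emeasure lborel {fst i..snd i} \<partial>count_space C)"
      by (rule nn_integral_cmult) auto
    also have "(\<integral>\<^sup>+i. emeasure lborel {fst i..snd i} \<partial>count_space C) = emeasure lborel V"
      unfolding V_def using C(1) disj by (intro emeasure_UN_countable[symmetric]) auto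
    also have "emeasure lborel V \<le> emeasure lborel U"
      using U(1) C(2) by (intro emeasure_mono) (fastforce simp: V_def K_def)+
    finally show ?thesis by (simp add: mult_left_mono)
  qed
  show ?thesis
  proof (rule ennreal_le_epsilon)
    fix e :: real assume fin: "ennreal p * emeasure lborel E < top" and e: "0 < e"
    show "emeasure (interval_measure F) E \<le> ennreal p * emeasure lborel E + ennreal e"
    proof -
      \<comment> \<open>The denominator \<open>p + 1\<close> stays positive for
        \<open>p = 0\<close>, and \<open>p * (e / (p + 1)) \<le> e\<close>.\<close>
      have "0 < e / (p + 1)" using e \<open>p \<ge> 0\<close> by simp
      obtain U where U: "open U" "E \<subseteq> U" "emeasure lborel (U - E) < ennreal (e / (p + 1))"
        using outer_regular_lborel[OF E \<open>0 < e / (p + 1)\<close>] by metis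
      have "emeasure lborel U = emeasure lborel (E \<union> (U - E))" using U by (simp add: Un_absorb1)
      also have "\<dots> \<le> emeasure lborel E + ennreal (e / (p + 1))"
        using U E by (intro order.trans[OF emeasure_subadditive] add_left_mono) (auto intro: less_imp_le)
      finally have "ennreal p * emeasure lborel U \<le> ennreal p * (emeasure lborel E + ennreal (e / (p + 1)))"
        by (rule mult_left_mono) simp
      also have "\<dots> = ennreal p * emeasure lborel E + ennreal (p * (e / (p + 1)))"
        using \<open>p \<ge> 0\<close> e by (subst ennreal_mult) (auto simp: distrib_left)
      also have "\<dots> \<le> ennreal p * emeasure lborel E + ennreal e"
        using \<open>p \<ge> 0\<close> e by (intro add_left_mono ennreal_leI) (simp add: field_simps)
      finally show ?thesis using bound[OF U(1,2)] by (rule order.trans[rotated])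
    qed
  qed
qed

text \<open>On the set where the derivates of \<open>F\<close> straddle \<open>p < q\<close>, the Stieltjes measures of \<open>F\<close> and of
  \<open>L x - F x\<close> are at most \<open>p\<close> and \<open>L - q\<close> times Lebesgue measure, but they add up to \<open>L\<close> times
  Lebesgue measure. Derivates over intervals around the point make this set a \<open>G\<^sub>\<delta>\<close>.\<close>

lemma lipschitz_differentiable_AE_mono:
  fixes F :: "real \<Rightarrow> real"
  assumes mono: "mono F" and lip: "L-lipschitz_on UNIV F"
  shows "AE x in lborel. F differentiable (at x)"
proof -
  have cont: "continuous_on UNIV F" using lip by (rule lipschitz_on_continuous_on)
  have L: "L \<ge> 0" using lip by (rule lipschitz_on_nonneg)
  have quot: "0 \<le> (F v - F u) / (v - u)" "(F v - F u) / (v - u) \<le> L" if "u < v" for u v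
  proof -
    show "0 \<le> (F v - F u) / (v - u)" using mono that by (auto simp: mono_def)
    show "(F v - F u) / (v - u) \<le> L"
      using lipschitz_onD[OF lip, of v u] that by (simp add: dist_real_def field_simps)
  qed
  define S where "S = (\<lambda>P. {x. \<forall>n::nat. \<exists>u v. u < x \<and> x < v \<and> v - u < 1 / Suc n \<and> P ((F v - F u) / (v - u))})"
  have S_borel: "S P \<in> sets borel" for P
  proof -
    have "S P = (\<Inter>n::nat. \<Union>(u,v)\<in>{(u,v). v - u < 1 / Suc n \<and> P ((F v - F u) / (v - u))}. {u<..<v})"
      by (rule set_eqI) (simp add: S_def, blast)
    also have "\<dots> \<in> sets borel"
      by (intro sets.countable_INT'') (auto intro!: borel_open open_UN)
    finally show ?thesis .
  qed
  have S_E: "\<exists>u v. u \<le> x \<and> x \<le> v \<and> u < v \<and> v - u < d \<and> P ((F v - F u) / (v - u))" if "x \<in> S P" "d > 0" for x d P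
  proof -
    obtain n where "1 / Suc n < d" using \<open>d > 0\<close> nat_approx_posE by blast
    moreover obtain u v where "u < x" "x < v" "v - u < 1 / Suc n" "P ((F v - F u) / (v - u))"
      using \<open>x \<in> S P\<close> unfolding S_def by blast
    ultimately show ?thesis by (intro exI[of _ u] exI[of _ v]) auto
  qed
  define E where "E = (\<lambda>p q. S (\<lambda>a. a < p) \<inter> S (\<lambda>a. a > q))"
  have E_null: "E p q \<in> null_sets lborel" if pq: "p < q" for p q
  proof -
    show ?thesis
    \<comment> \<open>All slopes of \<open>F\<close> lie between 0 and \<open>L\<close>, so in the
      first case \<open>E p q\<close> is empty; in the second the coefficients \<open>p\<close> and
      \<open>L - q\<close> are nonnegative.\<close>
    proof (cases "p < 0 \<or> q > L")
      case True
      have "x \<notin> E p q" for x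
      proof
        assume "x \<in> E p q"
        then obtain u v u' v' where "u < x" "x < v" "(F v - F u) / (v - u) < p"
          and "u' < x" "x < v'" "(F v' - F u') / (v' - u') > q"
          unfolding E_def S_def by blast
        then show False using True quot[of u v] quot[of u' v'] by linarith
      qed
      then have "E p q = {}" by blast
      then show ?thesis by simp
    next
      case False
      define G where "G = (\<lambda>x. L * x - F x)"
      have G: "mono G" unfolding G_def by (rule mono_linear_minus_lipschitz[OF lip])
      have lipG: "L-lipschitz_on UNIV G"
      proof (rule lipschitz_on_leI)
        fix x y :: real assume "x \<le> y"
        with G mono have "G x \<le> G y" "F x \<le> F y" by (auto simp: mono_def)
        then show "dist (G x) (G y) \<le> L * dist x y"
          using \<open>x \<le> y\<close> by (simp add: dist_real_def G_def algebra_simps)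
      qed (rule L)
      \<comment> \<open>Bounded pieces have finite measure \<open>b\<close>, so that
        \<open>L * b \<le> p * b + (L - q) * b\<close> can be solved for \<open>b\<close>.\<close>
      have "E p q \<inter> {- real n..real n} \<in> null_sets lborel" for n
      proof -
        define B where "B = E p q \<inter> {- real n..real n}"
        have B: "B \<in> sets borel" unfolding B_def E_def using S_borel by auto
        have fin: "emeasure lborel B < \<infinity>"
          using emeasure_mono[of B "{- real n..real n}" lborel] by (auto simp: B_def le_less_trans)
        have "emeasure (interval_measure F) B \<le> ennreal p * emeasure lborel B"
        proof (rule interval_measure_le_of_lower_derivate[OF mono lip _ B])
          fix x d :: real assume "x \<in> B" "d > 0"
          then have "x \<in> S (\<lambda>a. a < p)" by (auto simp: B_def E_def)
          from S_E[OF this \<open>d > 0\<close>] obtain u v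
            where "u \<le> x" "x \<le> v" "u < v" "v - u < d" "(F v - F u) / (v - u) < p" by blast
          then show "\<exists>u v. u \<le> x \<and> x \<le> v \<and> u < v \<and> v - u < d \<and> F v - F u < p * (v - u)"
            by (intro exI[of _ u] exI[of _ v]) (simp add: pos_divide_less_eq)
        qed (use False in auto)
        moreover have "emeasure (interval_measure G) B \<le> ennreal (L - q) * emeasure lborel B"
        proof (rule interval_measure_le_of_lower_derivate[OF G lipG _ B])
          fix x d :: real assume "x \<in> B" "d > 0"
          then have "x \<in> S (\<lambda>a. a > q)" by (auto simp: B_def E_def)
          from S_E[OF this \<open>d > 0\<close>] obtain u v
            where "u \<le> x" "x \<le> v" "u < v" "v - u < d" "q < (F v - F u) / (v - u)" by blast
          then show "\<exists>u v. u \<le> x \<and> x \<le> v \<and> u < v \<and> v - u < d \<and> G v - G u < (L - q) * (v - u)"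
            by (intro exI[of _ u] exI[of _ v]) (simp add: G_def pos_less_divide_eq algebra_simps)
        qed (use False in auto)
        moreover have "emeasure (interval_measure F) B + emeasure (interval_measure G) B = ennreal L * emeasure lborel B"
          using L G mono cont lipG by (intro emeasure_interval_measure_add B lipschitz_on_continuous_on[OF lipG])
            (auto simp: G_def)
        ultimately have "ennreal L * emeasure lborel B \<le> ennreal p * emeasure lborel B + ennreal (L - q) * emeasure lborel B"
          by (metis add_mono)
        moreover obtain b where b: "emeasure lborel B = ennreal b" "b \<ge> 0"
          using fin by (cases "emeasure lborel B") auto
        ultimately have "L * b \<le> p * b + (L - q) * b"
          using False L by (simp flip: ennreal_mult ennreal_plus)
        then have "(q - p) * b \<le> 0" by (simp add: algebra_simps)
        then have "b = 0" using pq b by (simp add: mult_le_0_iff)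
        then show ?thesis using b B by (simp add: null_sets_def B_def[symmetric])
      qed
      then have "(\<Union>n. E p q \<inter> {- real n..real n}) \<in> null_sets lborel"
        by (rule null_sets_UN)
      also have "(\<Union>n. E p q \<inter> {- real n..real n}) = E p q"
      proof -
        have "x \<in> (\<Union>n. {- real n..real n})" for x :: real
        proof -
          obtain n :: nat where "\<bar>x\<bar> \<le> n" using real_arch_simple by blast
          then show ?thesis by (intro UN_I[of n]) auto
        qed
        then show ?thesis by blast
      qed
      finally show ?thesis .
    qed
  qed
  have "AE x in lborel. \<forall>p\<in>\<rat>. \<forall>q\<in>\<rat>. p < q \<longrightarrow> x \<notin> E p q"
    using E_null by (simp add: AE_ball_countable countable_rat AE_not_in)
  then show ?thesis
  proof (rule eventually_mono)
    fix x assume x: "\<forall>p\<in>\<rat>. \<forall>q\<in>\<rat>. p < q \<longrightarrow> x \<notin> E p q"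
    have notS: "\<exists>d>0. \<forall>u v. u < x \<longrightarrow> x < v \<longrightarrow> v - u < d \<longrightarrow> \<not> P ((F v - F u) / (v - u))" if "x \<notin> S P" for P
    proof -
      obtain n :: nat where "\<forall>u v. u < x \<longrightarrow> x < v \<longrightarrow> v - u < 1 / Suc n \<longrightarrow> \<not> P ((F v - F u) / (v - u))"
        using \<open>x \<notin> S P\<close> unfolding S_def by blast
      then show ?thesis by (intro exI[of _ "1 / Suc n"]) auto
    qed
    \<comment> \<open>The levels undercut by slopes of arbitrarily short intervals around
      \<open>x\<close>. The infimum \<open>D\<close> of \<open>A\<close> is the lower derivate and
      becomes the derivative.\<close>
    define A where "A = {a. x \<in> S (\<lambda>b. b < a)}"
    have A_up: "b \<in> A" if "a \<in> A" "a \<le> b" for a b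
    proof -
      have "S (\<lambda>c. c < a) \<subseteq> S (\<lambda>c. c < b)"
        using less_le_trans[OF _ \<open>a \<le> b\<close>] unfolding S_def by blast
      then show ?thesis using that by (auto simp: A_def)
    qed
    have "L + 1 \<in> A"
    proof -
      have "\<exists>u v. u < x \<and> x < v \<and> v - u < r \<and> (F v - F u) / (v - u) < L + 1" if "r > 0" for r
        using that quot(2)[of "x - r / 3" "x + r / 3"]
        by (intro exI[of _ "x - r / 3"] exI[of _ "x + r / 3"]) auto
      then show ?thesis by (simp add: A_def S_def)
    qed
    have A_nonneg: "0 \<le> a" if aA: "a \<in> A" for a
    proof -
      obtain u v where "u < x" "x < v" "(F v - F u) / (v - u) < a"
        using aA unfolding A_def S_def by blast
      then show ?thesis using quot[of u v] by linarith
    qed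
    define D where "D = Inf A"
    have bdd: "bdd_below A" using A_nonneg by (auto simp: bdd_below_def)
    have key: "\<exists>d>0. \<forall>u v. u < x \<longrightarrow> x < v \<longrightarrow> v - u < d \<longrightarrow> \<bar>F v - F u - D * (v - u)\<bar> \<le> e * (v - u)" if "e > 0" for e
    proof -
      have "D - e \<notin> A" using cInf_lower[OF _ bdd, of "D - e"] \<open>e > 0\<close> by (auto simp: D_def)
      then obtain d1 where d1: "d1 > 0" "\<forall>u v. u < x \<longrightarrow> x < v \<longrightarrow> v - u < d1 \<longrightarrow> \<not> (F v - F u) / (v - u) < D - e"
        using notS unfolding A_def by blast
      \<comment> \<open>The rational \<open>p\<close> just above \<open>D\<close> belongs to
        \<open>A\<close>; as \<open>x\<close> lies outside \<open>E p q\<close>, short intervals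
        cannot have slope above \<open>q\<close>.\<close>
      obtain p where p: "p \<in> \<rat>" "D < p" "p < D + e" using Rats_dense_in_real[of D "D + e"] \<open>e > 0\<close> by auto
      obtain q where q: "q \<in> \<rat>" "p < q" "q < D + e" using Rats_dense_in_real[of p "D + e"] p by auto
      have "p \<in> A" using cInf_lessD[of A p] \<open>L + 1 \<in> A\<close> p A_up by (force simp: D_def)
      then have "x \<notin> S (\<lambda>a. a > q)" using x p q by (auto simp: E_def A_def)
      then obtain d2 where d2: "d2 > 0" "\<forall>u v. u < x \<longrightarrow> x < v \<longrightarrow> v - u < d2 \<longrightarrow> \<not> (F v - F u) / (v - u) > q"
        using notS by blast
      show ?thesis
      proof (intro exI[of _ "min d1 d2"] conjI allI impI)
        fix u v assume uv: "u < x" "x < v" "v - u < min d1 d2"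
        then have "D - e \<le> (F v - F u) / (v - u)" "(F v - F u) / (v - u) \<le> D + e"
          using d1(2)[rule_format, OF uv(1,2)] d2(2)[rule_format, OF uv(1,2)] q uv(3) by linarith+
        then have "(D - e) * (v - u) \<le> F v - F u" "F v - F u \<le> (D + e) * (v - u)"
          using uv by (simp_all add: pos_le_divide_eq pos_divide_le_eq)
        then show "\<bar>F v - F u - D * (v - u)\<bar> \<le> e * (v - u)" by (simp add: algebra_simps abs_le_iff)
      qed (use d1 d2 in auto)
    qed
    have "(F has_derivative (*) D) (at x)"
      unfolding has_derivative_at_alt
    proof (intro conjI allI impI)
      fix e :: real assume "0 < e"
      from key[OF this] obtain d where d: "d > 0"
        "\<And>u v. u < x \<Longrightarrow> x < v \<Longrightarrow> v - u < d \<Longrightarrow> \<bar>F v - F u - D * (v - u)\<bar> \<le> e * (v - u)" by auto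
      have isCont: "isCont F y" for y using cont by (simp add: continuous_on_eq_continuous_at)
      show "\<exists>d>0. \<forall>y. norm (y - x) < d \<longrightarrow> norm (F y - F x - D * (y - x)) \<le> e * norm (y - x)"
      proof (intro exI[of _ d] conjI allI impI)
        fix y assume y: "norm (y - x) < d"
        consider "y = x" | "y > x" | "y < x" by linarith
        then show "norm (F y - F x - D * (y - x)) \<le> e * norm (y - x)"
        proof cases
          case 2
          \<comment> \<open>The estimate \<open>key\<close> concerns intervals with \<open>x\<close>
            strictly inside. Continuity of \<open>F\<close> lets one end tend to \<open>x\<close>,
            which gives the interval from \<open>x\<close> to \<open>y\<close>.\<close>
          have lim: "((\<lambda>u. e * (y - u) - \<bar>F y - F u - D * (y - u)\<bar>) \<longlongrightarrow> e * (y - x) - \<bar>F y - F x - D * (y - x)\<bar>) (at_left x)"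
            by (intro tendsto_intros isCont_tendsto_compose[OF isCont])
          have "\<forall>\<^sub>F u in at_left x. u > y - d \<and> u < x"
            using y 2 by (intro eventually_conj eventually_at_left_real[of "y - d" x, THEN eventually_mono]) auto
          then have "\<forall>\<^sub>F u in at_left x. 0 \<le> e * (y - u) - \<bar>F y - F u - D * (y - u)\<bar>"
            by eventually_elim (use d 2 in auto)
          from tendsto_lowerbound[OF lim this] 2 show ?thesis by simp
        next
          case 3
          have lim: "((\<lambda>v. e * (v - y) - \<bar>F v - F y - D * (v - y)\<bar>) \<longlongrightarrow> e * (x - y) - \<bar>F x - F y - D * (x - y)\<bar>) (at_right x)"
            by (intro tendsto_intros isCont_tendsto_compose[OF isCont])
          have "\<forall>\<^sub>F v in at_right x. v < y + d \<and> x < v"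
            using y 3 by (intro eventually_conj eventually_at_right_real[of x "y + d", THEN eventually_mono]) auto
          then have "\<forall>\<^sub>F v in at_right x. 0 \<le> e * (v - y) - \<bar>F v - F y - D * (v - y)\<bar>"
            by eventually_elim (use d 3 in auto)
          from tendsto_lowerbound[OF lim this] have "\<bar>F x - F y - D * (x - y)\<bar> \<le> e * (x - y)" by simp
          moreover have "F y - F x - D * (y - x) = - (F x - F y - D * (x - y))" by (simp add: algebra_simps)
          ultimately show ?thesis using 3 by (simp only: real_norm_def abs_minus) simp
        qed simp
      qed (rule d)
    qed (rule bounded_linear_mult_right)
    then show "F differentiable (at x)" by (auto simp: differentiable_def)
  qed
qed

text \<open>Adding a linear function restores monotonicity: \<open>L * x - F x\<close> is
  increasing, with Lipschitz constant \<open>2 * L\<close>.\<close>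

theorem lipschitz_differentiable_AE:
  fixes F :: "real \<Rightarrow> real"
  assumes lip: "L-lipschitz_on UNIV F"
  shows "AE x in lborel. F differentiable (at x)"
proof -
  define G where "G = (\<lambda>x. L * x - F x)"
  have "mono G" unfolding G_def by (rule mono_linear_minus_lipschitz[OF lip])
  moreover have "(2 * L)-lipschitz_on UNIV G"
  proof (rule lipschitz_onI)
    fix x y :: real
    have "\<bar>F x - F y\<bar> \<le> L * \<bar>x - y\<bar>" using lipschitz_onD[OF lip, of x y] by (simp add: dist_real_def)
    moreover have "\<bar>L * x - L * y\<bar> = L * \<bar>x - y\<bar>"
      using lipschitz_on_nonneg[OF lip] by (simp add: abs_mult flip: right_diff_distrib)
    ultimately show "dist (G x) (G y) \<le> 2 * L * dist x y" by (simp add: dist_real_def G_def)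
  qed (use lipschitz_on_nonneg[OF lip] in simp)
  ultimately have "AE x in lborel. G differentiable (at x)"
    by (rule lipschitz_differentiable_AE_mono)
  then show ?thesis
  proof (rule eventually_mono)
    fix x assume "G differentiable (at x)"
    then have "(\<lambda>x. L * x - G x) differentiable (at x)" by (intro derivative_intros) auto
    then show "F differentiable (at x)" by (simp add: G_def)
  qed
qed

text \<open>The difference quotients of \<open>F\<close> are bounded by \<open>L\<close>, so their
  integrals converge to that of \<open>F'\<close>. With an antiderivative \<open>\<Phi>\<close> of
  \<open>F\<close>, the same integrals are differences of averages of \<open>F\<close> over short
  intervals starting at \<open>b\<close> and \<open>a\<close>, which tend to
  \<open>F b - F a\<close>.\<close>

lemma lipschitz_integral_derivative:
  fixes F F' :: "real \<Rightarrow> real"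
  assumes lip: "L-lipschitz_on UNIV F" and F': "F' \<in> borel_measurable borel" and ab: "a \<le> b"
    and deriv: "AE x in lborel. a < x \<longrightarrow> x < b \<longrightarrow> (F has_real_derivative F' x) (at x)"
  shows "(\<integral>x. indicator {a..b} x * F' x \<partial>lborel) = F b - F a"
proof -
  have cont: "continuous_on S F" for S using lip by (meson continuous_on_subset lipschitz_on_continuous_on subset_UNIV)
  define h where "h = (\<lambda>n. 1 / real (Suc n))"
  have h: "h n > 0" "h n \<le> 1" for n by (auto simp: h_def)
  have h0: "h \<longlonglongrightarrow> 0" unfolding h_def by real_asymp
  have filt: "filterlim h (at 0) sequentially"
    using h0 h(1) by (auto simp: filterlim_at eventually_at_filter less_imp_neq[symmetric])
  define \<phi> where "\<phi> = (\<lambda>n x. (F (x + h n) - F x) / h n)"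
  have \<phi>_cont: "continuous_on S (\<phi> n)" for n S
    unfolding \<phi>_def using h(1)[of n] by (intro continuous_intros continuous_on_compose2[OF cont[of UNIV]]) auto
  have L: "L \<ge> 0" using lip by (rule lipschitz_on_nonneg)
  have "(\<lambda>n. \<integral>x. indicator {a..b} x * \<phi> n x \<partial>lborel) \<longlonglongrightarrow> (\<integral>x. indicator {a..b} x * F' x \<partial>lborel)"
  proof (rule integral_dominated_convergence)
    show "integrable lborel (\<lambda>x. L * indicator {a..b} x)" 
      using ab by (intro integrable_mult_right integrable_real_indicator) auto
    show "AE x in lborel. (\<lambda>n. indicator {a..b} x * \<phi> n x) \<longlonglongrightarrow> indicator {a..b} x * F' x"
    proof -
      have "AE x in lborel. x \<noteq> a" "AE x in lborel. x \<noteq> b" by (auto intro: AE_lborel_singleton)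
      with deriv show ?thesis
      proof eventually_elim
        case (elim x)
        show ?case
        proof (cases "x \<in> {a..b}")
          case True
          with elim have "(F has_real_derivative F' x) (at x)" by auto
          then have "((\<lambda>h. (F (x + h) - F x) / h) \<longlongrightarrow> F' x) (at 0)" by (simp add: DERIV_def)
          then have "(\<lambda>n. \<phi> n x) \<longlonglongrightarrow> F' x" unfolding \<phi>_def by (rule filterlim_compose[OF _ filt])
          then show ?thesis by (intro tendsto_intros)
        qed simp
      qed
    qed
    show "AE x in lborel. norm (indicator {a..b} x * \<phi> n x) \<le> L * indicator {a..b} x" for n
    proof (rule AE_I2)
      fix x
      have "\<bar>F (x + h n) - F x\<bar> \<le> L * h n"
        using lipschitz_onD[OF lip, of "x + h n" x] h(1)[of n] by (simp add: dist_real_def)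
      then show "norm (indicator {a..b} x * \<phi> n x) \<le> L * indicator {a..b} x"
        using h(1)[of n] by (auto simp: \<phi>_def abs_div field_simps split: split_indicator)
    qed
    show "(\<lambda>x. indicator {a..b} x * \<phi> n x) \<in> borel_measurable lborel" for n
      using borel_measurable_continuous_onI[OF \<phi>_cont] by simp
  qed (use F' in simp)
  moreover have "(\<lambda>n. \<integral>x. indicator {a..b} x * \<phi> n x \<partial>lborel) \<longlonglongrightarrow> F b - F a"
  proof -
    \<comment> \<open>The margins put \<open>{a..b + 1}\<close> into the interior; steps satisfy
      \<open>h n \<le> 1\<close>, so the shifted points never leave it.\<close>
    obtain \<Phi> where \<Phi>': "\<And>x. x \<in> {a - 1..b + 2} \<Longrightarrow> (\<Phi> has_vector_derivative F x) (at x within {a - 1..b + 2})"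
      using antiderivative_continuous[OF cont] by blast
    have \<Phi>: "(\<Phi> has_real_derivative F x) (at x)" if "a \<le> x" "x \<le> b + 1" for x
      using \<Phi>'[of x] that at_within_interior[of x "{a - 1..b + 2}"]
      by (simp add: has_real_derivative_iff_has_vector_derivative)
    have "(\<integral>x. indicator {a..b} x * \<phi> n x \<partial>lborel) = (\<Phi> (b + h n) - \<Phi> b) / h n - (\<Phi> (a + h n) - \<Phi> a) / h n" for n
    proof -
      have "(\<integral>x. indicator {a..b} x *\<^sub>R \<phi> n x \<partial>lborel) = (\<Phi> (b + h n) - \<Phi> b) / h n - (\<Phi> (a + h n) - \<Phi> a) / h n"
      proof (rule integral_FTC_atLeastAtMost[OF ab _ \<phi>_cont])
        fix x assume x: "a \<le> x" "x \<le> b"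
        have "((\<lambda>x. \<Phi> (x + h n)) has_real_derivative F (x + h n)) (at x)"
          using h[of n] x by (intro DERIV_shift[THEN iffD1] \<Phi>) auto
        then have "((\<lambda>x. (\<Phi> (x + h n) - \<Phi> x) / h n) has_real_derivative \<phi> n x) (at x)"
          unfolding \<phi>_def using x h[of n] by (intro DERIV_cdivide DERIV_diff \<Phi>) auto
        then show "((\<lambda>x. (\<Phi> (x + h n) - \<Phi> x) / h n) has_vector_derivative \<phi> n x) (at x within {a..b})"
          by (simp add: has_real_derivative_iff_has_vector_derivative has_vector_derivative_at_within)
      qed
      then show ?thesis by simp
    qed
    moreover have "(\<lambda>n. (\<Phi> (x + h n) - \<Phi> x) / h n) \<longlonglongrightarrow> F x" if "a \<le> x" "x \<le> b" for x
    proof -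
      have "((\<lambda>h. (\<Phi> (x + h) - \<Phi> x) / h) \<longlongrightarrow> F x) (at 0)"
        using \<Phi>[of x] that by (simp add: DERIV_def)
      then show ?thesis by (rule filterlim_compose[OF _ filt])
    qed
    ultimately show ?thesis using ab by (auto intro!: tendsto_diff)
  qed
  ultimately show ?thesis by (rule LIMSEQ_unique)
qed

section \<open>The Loewner equation\<close>

lemma has_vector_derivative_iff_quotient:
  fixes g :: "real \<Rightarrow> complex"
  shows "(g has_vector_derivative d) (at t) \<longleftrightarrow> ((\<lambda>s. (g s - g t) / of_real (s - t)) \<longlongrightarrow> d) (at t)"
proof -
  have "norm (g s - g t - (s - t) *\<^sub>R d) / norm (s - t) = norm ((g s - g t) / of_real (s - t) - d)" if "s \<noteq> t" for s
  proof -
    have "g s - g t - (s - t) *\<^sub>R d = of_real (s - t) * ((g s - g t) / of_real (s - t) - d)"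
    proof -
      have "complex_of_real (s - t) \<noteq> 0" using that by simp
      moreover have "a - c * d = c * (a / c - d)" if "c \<noteq> 0" for a c d :: complex
        using that by (simp add: right_diff_distrib)
      ultimately show ?thesis unfolding scaleR_conv_of_real by blast
    qed
    then show ?thesis using that by (simp add: norm_mult del: of_real_diff)
  qed
  then have "((\<lambda>s. norm (g s - g t - (s - t) *\<^sub>R d) / norm (s - t)) \<longlongrightarrow> 0) (at t)
      \<longleftrightarrow> ((\<lambda>s. norm ((g s - g t) / of_real (s - t) - d)) \<longlongrightarrow> 0) (at t)"
    by (intro tendsto_cong) (simp add: eventually_at_filter)
  then show ?thesis
    by (simp add: has_vector_derivative_def has_derivative_iff_norm bounded_linear_scaleR_left
        tendsto_norm_zero_iff LIM_zero_iff)
qed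

text \<open>Freezing time outside \<open>{0..T}\<close> turns \<open>f t z\<close> into a function
  that is Lipschitz on the whole line, to which the preceding theorems apply.\<close>

definition time_clamp :: "real \<Rightarrow> real \<Rightarrow> real" where
  "time_clamp T t = max 0 (min T t)"

lemma time_clamp_bounds: "0 \<le> T \<Longrightarrow> 0 \<le> time_clamp T t" "0 \<le> T \<Longrightarrow> time_clamp T t \<le> T"
  and time_clamp_eq: "0 \<le> t \<Longrightarrow> t \<le> T \<Longrightarrow> time_clamp T t = t"
  and time_clamp_diff_le: "\<bar>time_clamp T s - time_clamp T t\<bar> \<le> \<bar>s - t\<bar>"
  by (auto simp: time_clamp_def)

text \<open>Representing measures are fixed once: \<open>D t\<close> for \<open>f t\<close>, and
  \<open>E s t\<close> for the map through which \<open>f t\<close> factors over \<open>f s\<close>.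
  The order structure is thereby replaced by estimates on Cauchy transforms.\<close>

locale Loewner_chain =
  fixes f :: "real \<Rightarrow> complex \<Rightarrow> complex" and D :: "real \<Rightarrow> real measure"
    and E :: "real \<Rightarrow> real \<Rightarrow> real measure"
  assumes D: "t \<ge> 0 \<Longrightarrow> real_distribution (D t)"
    and f_eq: "t \<ge> 0 \<Longrightarrow> Im z > 0 \<Longrightarrow> f t z = z - of_real t * cauchy_transform (D t) z"
    and E: "0 \<le> s \<Longrightarrow> s < t \<Longrightarrow> real_distribution (E s t)"
    and transition: "0 \<le> s \<Longrightarrow> s < t \<Longrightarrow> Im z > 0 \<Longrightarrow>
          f t z = f s (z - of_real (t - s) * cauchy_transform (E s t) z)"
    and inj: "t \<ge> 0 \<Longrightarrow> inj_on (f t) upper_half_plane"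
begin

definition tr :: "real \<Rightarrow> real \<Rightarrow> complex \<Rightarrow> complex" where
  "tr s t z = z - of_real (t - s) * cauchy_transform (E s t) z"

lemma Im_tr_ge:
  assumes "0 \<le> s" "s < t" "Im z > 0" shows "Im z \<le> Im (tr s t z)"
  using real_distribution.Im_cauchy_transform_nonpos[OF E[OF assms(1,2)] assms(3)] assms
  by (simp add: tr_def mult_nonneg_nonpos del: of_real_diff)

text \<open>Expanding \<open>f s\<close> at \<open>tr s t z\<close> and at \<open>z\<close>, the
  resolvent identity extracts \<open>tr s t z - z\<close>, which is proportional to
  \<open>t - s\<close>. The last factor is the divided difference of \<open>f s\<close> between
  these points and becomes \<open>deriv (f s) z\<close> when they merge.\<close>

lemma increment:
  assumes "0 \<le> s" "s < t" "Im z > 0"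
  shows "f t z - f s z = - (of_real (t - s) * cauchy_transform (E s t) z * (1 + of_real s * resolvent_product (D s) z (tr s t z)))"
proof -
  interpret D: real_distribution "D s" by (rule D[OF assms(1)])
  have pos: "Im (tr s t z) > 0" using Im_tr_ge[OF assms] assms(3) by linarith
  have "f t z = f s (tr s t z)" using transition[OF assms] by (simp add: tr_def)
  then have "f t z - f s z = tr s t z - z + of_real s * (cauchy_transform (D s) z - cauchy_transform (D s) (tr s t z))"
    using f_eq[OF assms(1,3)] f_eq[OF assms(1) pos] by (simp add: algebra_simps)
  also have "\<dots> = (tr s t z - z) * (1 + of_real s * resolvent_product (D s) z (tr s t z))"
    unfolding D.cauchy_transform_diff[OF assms(3) pos] by (simp add: algebra_simps)
  also have "tr s t z - z = - (of_real (t - s) * cauchy_transform (E s t) z)" by (simp add: tr_def)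
  finally show ?thesis by simp
qed

lemma norm_increment_factor_le:
  assumes "0 \<le> s" "0 < y" "y \<le> Im z" "y \<le> Im w"
  shows "norm (1 + of_real s * resolvent_product (D s) z w) \<le> 1 + s / y\<^sup>2"
proof -
  interpret D: real_distribution "D s" by (rule D[OF assms(1)])
  have "norm (resolvent_product (D s) z w) \<le> 1 / (Im z * Im w)"
    using assms by (intro D.norm_resolvent_product_integral_le) auto
  also have "\<dots> \<le> 1 / y\<^sup>2"
    using assms by (intro divide_left_mono) (auto simp: power2_eq_square intro!: mult_mono mult_pos_pos)
  finally have "s * norm (resolvent_product (D s) z w) \<le> s * (1 / y\<^sup>2)" using assms by (intro mult_left_mono)
  then have "norm (of_real s * resolvent_product (D s) z w) \<le> s / y\<^sup>2" using assms by (simp add: norm_mult)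
  then show ?thesis using norm_triangle_ineq[of 1 "of_real s * resolvent_product (D s) z w"] by simp
qed

lemma norm_increment_le:
  assumes "0 \<le> s" "s \<le> t" "t \<le> T" "Im z > 0"
  shows "norm (f t z - f s z) \<le> (t - s) * ((1 + T / (Im z)\<^sup>2) / Im z)"
proof (cases "s = t")
  case False
  then have st: "s < t" using assms by simp
  have "norm (f t z - f s z) = (t - s) * (norm (cauchy_transform (E s t) z) * norm (1 + of_real s * resolvent_product (D s) z (tr s t z)))"
    unfolding increment[OF assms(1) st assms(4)] using st by (simp add: norm_mult del: of_real_diff)
  also have "\<dots> \<le> (t - s) * (1 / Im z * (1 + T / (Im z)\<^sup>2))"
  proof (intro mult_left_mono mult_mono)
    show "norm (cauchy_transform (E s t) z) \<le> 1 / Im z"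
      by (rule real_distribution.norm_cauchy_transform_le[OF E[OF assms(1) st] assms(4)])
    have "norm (1 + of_real s * resolvent_product (D s) z (tr s t z)) \<le> 1 + s / (Im z)\<^sup>2"
      using assms Im_tr_ge[OF assms(1) st assms(4)] by (intro norm_increment_factor_le) auto
    also have "\<dots> \<le> 1 + T / (Im z)\<^sup>2" using assms by (intro add_left_mono divide_right_mono) auto
    finally show "norm (1 + of_real s * resolvent_product (D s) z (tr s t z)) \<le> 1 + T / (Im z)\<^sup>2" .
  qed (use assms st in auto)
  finally show ?thesis by simp
qed simp

lemma lipschitz_clamp:
  assumes "0 \<le> T" "Im z > 0"
  shows "((1 + T / (Im z)\<^sup>2) / Im z)-lipschitz_on UNIV (\<lambda>t. f (time_clamp T t) z)"
proof (rule lipschitz_on_leI)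
  show "0 \<le> (1 + T / (Im z)\<^sup>2) / Im z" using assms by simp
  fix s t :: real assume "s \<le> t"
  then have st: "time_clamp T s \<le> time_clamp T t" by (auto simp: time_clamp_def)
  have "dist (f (time_clamp T s) z) (f (time_clamp T t) z) \<le> (time_clamp T t - time_clamp T s) * ((1 + T / (Im z)\<^sup>2) / Im z)"
    unfolding dist_norm norm_minus_commute[of "f (time_clamp T s) z"]
    by (rule norm_increment_le) (use st assms time_clamp_bounds in auto)
  also have "\<dots> \<le> dist s t * ((1 + T / (Im z)\<^sup>2) / Im z)"
    using time_clamp_diff_le[of T t s] st assms by (intro mult_right_mono) (auto simp: dist_real_def)
  finally show "dist (f (time_clamp T s) z) (f (time_clamp T t) z) \<le> (1 + T / (Im z)\<^sup>2) / Im z * dist s t"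
    by (simp add: mult.commute)
qed

lemma has_field_derivative:
  assumes "t \<ge> 0" "Im z > 0"
  shows "(f t has_field_derivative 1 + of_real t * resolvent_product (D t) z z) (at z)"
proof -
  interpret D: real_distribution "D t" by (rule D[OF assms(1)])
  have "((\<lambda>z. z - of_real t * cauchy_transform (D t) z) has_field_derivative
      1 + of_real t * resolvent_product (D t) z z) (at z)"
    using assms by (auto intro!: derivative_eq_intros D.cauchy_transform_has_field_derivative)
  then show ?thesis
  proof (rule has_field_derivative_transform_within_open)
    show "open {z. Im z > 0}" by (rule open_halfspace_Im_gt)
  qed (use assms f_eq in auto)
qed

lemma deriv_eq: "t \<ge> 0 \<Longrightarrow> Im z > 0 \<Longrightarrow> deriv (f t) z = 1 + of_real t * resolvent_product (D t) z z"
  using has_field_derivative by (rule DERIV_imp_deriv)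

text \<open>Univalence enters here; it allows the equation to be solved for the Cauchy
  transform.\<close>

lemma deriv_nonzero:
  assumes "t \<ge> 0" "Im z > 0" shows "deriv (f t) z \<noteq> 0"
proof (rule holomorphic_injective_imp_regular)
  show "f t holomorphic_on upper_half_plane"
    unfolding holomorphic_on_def upper_half_plane_def field_differentiable_def
    using has_field_derivative[OF assms(1)] has_field_derivative_at_within by blast
qed (use assms inj in \<open>auto simp: upper_half_plane_def open_halfspace_Im_gt\<close>)

text \<open>Product rule for differences, applied to the factorisation in \<open>increment\<close>.
  The first summand of the constant comes from the transforms of \<open>E s t\<close>. The second
  comes from the divided differences of \<open>D s\<close>, where \<open>2 + T / y\<^sup>2\<close>
  adds the displacement of \<open>z\<close> to that of \<open>tr s t z\<close>.\<close>

lemma increment_lipschitz: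
  assumes st: "0 \<le> s" "s < t" "t \<le> T" and y: "0 < y" "y \<le> Im z" "y \<le> Im z'"
  shows "norm ((f t z - f s z) - (f t z' - f s z'))
    \<le> (t - s) * (((1 + T / y\<^sup>2) / y\<^sup>2 + T * ((2 + T / y\<^sup>2) / y ^ 3) / y) * norm (z - z'))"
proof -
  interpret D: real_distribution "D s" by (rule D[OF st(1)])
  interpret E: real_distribution "E s t" by (rule E[OF st(1,2)])
  have z: "Im z > 0" "Im z' > 0" using y by auto
  define w w' where "w = tr s t z" and "w' = tr s t z'"
  have w: "y \<le> Im w" "y \<le> Im w'" 
    using Im_tr_ge[OF st(1,2) z(1)] Im_tr_ge[OF st(1,2) z(2)] y unfolding w_def w'_def by linarith+
  define k k' where "k = resolvent_product (D s) z w" and "k' = resolvent_product (D s) z' w'"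
  have E_diff: "norm (cauchy_transform (E s t) z - cauchy_transform (E s t) z') \<le> norm (z - z') / y\<^sup>2"
  proof -
    have "norm (cauchy_transform (E s t) z - cauchy_transform (E s t) z') \<le> norm (z - z') / (Im z * Im z')"
      using E.dist_cauchy_transform_le[OF z] by (simp add: dist_norm)
    also have "\<dots> \<le> norm (z - z') / y\<^sup>2"
      using y by (intro divide_left_mono) (auto simp: power2_eq_square intro!: mult_mono mult_pos_pos)
    finally show ?thesis .
  qed
  have w_diff: "norm (w - w') \<le> (1 + T / y\<^sup>2) * norm (z - z')"
  proof -
    have "w - w' = (z - z') - of_real (t - s) * (cauchy_transform (E s t) z - cauchy_transform (E s t) z')"
      by (simp add: w_def w'_def tr_def algebra_simps)
    then have "norm (w - w') \<le> norm (z - z') + (t - s) * norm (cauchy_transform (E s t) z - cauchy_transform (E s t) z')"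
      using norm_triangle_ineq4 st by (metis abs_of_pos diff_gt_0_iff_gt norm_mult norm_of_real)
    also have "\<dots> \<le> norm (z - z') + T * (norm (z - z') / y\<^sup>2)"
      using E_diff st by (intro add_left_mono mult_mono) auto
    finally show ?thesis by (simp add: algebra_simps)
  qed
  have swap: "resolvent_product (D s) a b = resolvent_product (D s) b a" for a b
    by (simp add: resolvent_product_def mult.commute)
  have res: "norm (resolvent_product (D s) a b - resolvent_product (D s) a c) \<le> norm (b - c) / y ^ 3"
    if "y \<le> Im a" "y \<le> Im b" "y \<le> Im c" for a b c
  proof -
    have "norm (resolvent_product (D s) a b - resolvent_product (D s) a c) \<le> norm (b - c) / (Im a * Im b * Im c)"
      using that y by (intro D.resolvent_product_diff_le) auto
    also have "\<dots> \<le> norm (b - c) / y ^ 3"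
      using that y by (intro divide_left_mono) (auto simp: power3_eq_cube intro!: mult_mono mult_pos_pos)
    finally show ?thesis .
  qed
  have k_diff: "norm (k - k') \<le> (2 + T / y\<^sup>2) / y ^ 3 * norm (z - z')"
  proof -
    have "norm (k - k') \<le> norm (k - resolvent_product (D s) z w') + norm (resolvent_product (D s) w' z - resolvent_product (D s) w' z')"
    proof -
      have "k - k' = (k - resolvent_product (D s) z w') + (resolvent_product (D s) w' z - resolvent_product (D s) w' z')"
        by (simp add: k'_def swap[of w'])
      then show ?thesis by (simp only: norm_triangle_ineq)
    qed
    also have "\<dots> \<le> norm (w - w') / y ^ 3 + norm (z - z') / y ^ 3"
      unfolding k_def using w y by (intro add_mono res) auto
    also have "\<dots> \<le> (1 + T / y\<^sup>2) * norm (z - z') / y ^ 3 + norm (z - z') / y ^ 3"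
      using w_diff y by (intro add_right_mono divide_right_mono) auto
    also have "\<dots> = (2 + T / y\<^sup>2) / y ^ 3 * norm (z - z')" by (simp add: add_divide_distrib algebra_simps)
    finally show ?thesis .
  qed
  define c c' where "c = cauchy_transform (E s t) z" and "c' = cauchy_transform (E s t) z'"
  have "(f t z - f s z) - (f t z' - f s z') = - (of_real (t - s) * ((c - c') * (1 + of_real s * k) + of_real s * (c' * (k - k'))))"
    unfolding increment[OF st(1,2) z(1)] increment[OF st(1,2) z(2)] c_def c'_def k_def k'_def w_def w'_def
    by (simp add: algebra_simps)
  then have "norm ((f t z - f s z) - (f t z' - f s z')) = (t - s) * norm ((c - c') * (1 + of_real s * k) + of_real s * (c' * (k - k')))"
    using st by (simp add: norm_mult del: of_real_diff)
  also have "norm ((c - c') * (1 + of_real s * k) + of_real s * (c' * (k - k')))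
     \<le> norm (c - c') * norm (1 + of_real s * k) + s * (norm c' * norm (k - k'))"
    using norm_triangle_ineq[of "(c - c') * (1 + of_real s * k)" "of_real s * (c' * (k - k'))"] st
    by (simp add: norm_mult)
  also have "\<dots> \<le> norm (z - z') / y\<^sup>2 * (1 + T / y\<^sup>2) + T * (1 / y * ((2 + T / y\<^sup>2) / y ^ 3 * norm (z - z')))"
  proof (intro add_mono mult_mono)
    show "norm (c - c') \<le> norm (z - z') / y\<^sup>2" unfolding c_def c'_def by (rule E_diff)
    have "norm (1 + of_real s * k) \<le> 1 + s / y\<^sup>2"
      unfolding k_def using y w st by (intro norm_increment_factor_le) auto
    also have "\<dots> \<le> 1 + T / y\<^sup>2" using st by (intro add_left_mono divide_right_mono) auto
    finally show "norm (1 + of_real s * k) \<le> 1 + T / y\<^sup>2" .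
    have "norm c' \<le> 1 / Im z'" unfolding c'_def by (rule E.norm_cauchy_transform_le[OF z(2)])
    also have "\<dots> \<le> 1 / y" using y by (intro divide_left_mono) auto
    finally show "norm c' \<le> 1 / y" .
  qed (use k_diff y st in auto)
  also have "\<dots> = ((1 + T / y\<^sup>2) / y\<^sup>2 + T * ((2 + T / y\<^sup>2) / y ^ 3) / y) * norm (z - z')"
  proof -
    have "n / a * b + T * (1 / y * (e * n)) = (b / a + T * e / y) * n" for n a b e :: real
      by (simp add: algebra_simps)
    then show ?thesis .
  qed
  finally show ?thesis using st by simp
qed

section \<open>Differentiability in time at almost every time\<close>

text \<open>Differentiability is local, so it passes from the clamped functions to \<open>f\<close>.
  The null set still depends on \<open>z\<close>, which \<open>differentiable_of_dense\<close>
  overcomes.\<close>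

lemma AE_differentiable_at_point:
  assumes z: "Im z > 0"
  shows "AE t in lborel. t > 0 \<longrightarrow> (\<exists>d. ((\<lambda>s. f s z) has_vector_derivative d) (at t))"
proof -
  have "AE t in lborel. t > 0 \<and> t < real n \<longrightarrow> (\<exists>d. ((\<lambda>s. f s z) has_vector_derivative d) (at t))" for n :: nat
  proof -
    define L where "L = (1 + real n / (Im z)\<^sup>2) / Im z"
    have lip: "L-lipschitz_on UNIV (\<lambda>t. f (time_clamp n t) z)"
      unfolding L_def using z by (intro lipschitz_clamp) auto
    have "L-lipschitz_on UNIV (\<lambda>t. Re (f (time_clamp n t) z))" "L-lipschitz_on UNIV (\<lambda>t. Im (f (time_clamp n t) z))"
    proof -
      have *: "dist (Re a) (Re b) \<le> dist a b" "dist (Im a) (Im b) \<le> dist a b" for a b :: complex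
        using abs_Re_le_cmod[of "a - b"] abs_Im_le_cmod[of "a - b"] by (simp_all add: dist_norm)
      then show "L-lipschitz_on UNIV (\<lambda>t. Re (f (time_clamp n t) z))" "L-lipschitz_on UNIV (\<lambda>t. Im (f (time_clamp n t) z))"
        using lipschitz_on_nonneg[OF lip] order.trans[OF *(1) lipschitz_onD[OF lip]] order.trans[OF *(2) lipschitz_onD[OF lip]]
        by (auto intro!: lipschitz_onI)
    qed
    from this[THEN lipschitz_differentiable_AE] show ?thesis
    proof eventually_elim
      case (elim t)
      show ?case
      proof
        assume t: "0 < t \<and> t < n"
        obtain a b where ab: "((\<lambda>t. Re (f (time_clamp n t) z)) has_real_derivative a) (at t)"
           "((\<lambda>t. Im (f (time_clamp n t) z)) has_real_derivative b) (at t)"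
          using elim by (auto simp: real_differentiable_def)
        have "((\<lambda>t. of_real (Re (f (time_clamp n t) z)) + \<i> * of_real (Im (f (time_clamp n t) z))) has_vector_derivative of_real a + \<i> * of_real b) (at t)"
          using ab[THEN has_vector_derivative_of_real[unfolded has_real_derivative_iff_has_vector_derivative[symmetric]]]
          by (intro has_vector_derivative_add has_vector_derivative_mult_right) auto
        then have "((\<lambda>t. f (time_clamp n t) z) has_vector_derivative of_real a + \<i> * of_real b) (at t)"
          by (simp flip: complex_eq)
        then have "((\<lambda>t. f t z) has_vector_derivative of_real a + \<i> * of_real b) (at t)"
        proof (rule has_vector_derivative_transform_within_open)
          show "open {0<..<real n}" by simp
        qed (use t in \<open>auto simp: time_clamp_eq\<close>)
        then show "\<exists>d. ((\<lambda>s. f s z) has_vector_derivative d) (at t)" by blast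
      qed
    qed
  qed
  then have "AE t in lborel. \<forall>n::nat. t > 0 \<and> t < real n \<longrightarrow> (\<exists>d. ((\<lambda>s. f s z) has_vector_derivative d) (at t))"
    by (intro AE_all_countable[THEN iffD2] allI)
  then show ?thesis
  proof eventually_elim
    case (elim t)
    then show ?case using reals_Archimedean2[of t] by blast
  qed
qed

text \<open>Near \<open>z\<close> the difference quotients in time are Lipschitz in \<open>z\<close>
  with one constant \<open>A\<close> for all \<open>s\<close> near \<open>t\<close>. Their limits
  along points \<open>u n\<close> tending to \<open>z\<close> thus form a Cauchy sequence, and the
  two limits may be interchanged.\<close>

lemma differentiable_of_dense:
  assumes t: "t > 0"
    and d: "\<And>i::nat. Im (d i) > 0" and dense: "\<And>z e. Im z > 0 \<Longrightarrow> e > 0 \<Longrightarrow> \<exists>i. dist (d i) z < e"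
    and diff: "\<And>i. \<exists>l. ((\<lambda>s. f s (d i)) has_vector_derivative l) (at t)"
    and z: "Im z > 0"
  shows "\<exists>l. ((\<lambda>s. f s z) has_vector_derivative l) (at t)"
proof -
  define q where "q = (\<lambda>s w. (f s w - f t w) / of_real (s - t))"
  \<comment> \<open>Room for \<open>s\<close> on both sides of \<open>t\<close>, and for
    approximating points below the height of \<open>z\<close>.\<close>
  define T y where "T = t + 1" and "y = Im z / 2"
  define A where "A = (1 + T / y\<^sup>2) / y\<^sup>2 + T * ((2 + T / y\<^sup>2) / y ^ 3) / y"
  have y: "y > 0" "y \<le> Im z" using z by (auto simp: y_def)
  have "A \<ge> 0" unfolding A_def using y t by (auto simp: T_def)
  have q_lip: "dist (q s w) (q s w') \<le> A * dist w w'"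
    if s: "0 < s" "s < T" "s \<noteq> t" and w: "y \<le> Im w" "y \<le> Im w'" for s w w'
  proof -
    have "norm ((f s w - f t w) - (f s w' - f t w')) \<le> \<bar>s - t\<bar> * (A * norm (w - w'))"
    proof (cases "s < t")
      case True
      have "norm ((f s w - f t w) - (f s w' - f t w')) = norm ((f t w - f s w) - (f t w' - f s w'))"
        using norm_minus_commute[of "f s w - f t w" "f s w' - f t w'"] by (simp add: algebra_simps)
      then show ?thesis
        using increment_lipschitz[of s t T y w w'] True s w y unfolding A_def by (simp add: T_def)
    next
      case False
      then show ?thesis
        using increment_lipschitz[of t s T y w w'] t s w y unfolding A_def by simp
    qed
    moreover have "q s w - q s w' = ((f s w - f t w) - (f s w' - f t w')) / of_real (s - t)"
      by (simp add: q_def diff_divide_distrib)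
    ultimately show ?thesis using s
      by (simp add: dist_norm norm_divide pos_divide_le_eq mult.commute del: of_real_diff)
  qed
  have ev: "\<forall>\<^sub>F s in at t. 0 < s \<and> s < T \<and> s \<noteq> t"
  proof -
    have "\<forall>\<^sub>F s in at t. s \<in> {0<..<T}"
      using t by (intro eventually_at_in_open') (auto simp: T_def)
    moreover have "\<forall>\<^sub>F s in at t. s \<noteq> t" by (simp add: eventually_at_filter)
    ultimately show ?thesis by eventually_elim auto
  qed
  have "\<exists>i. dist (d i) z < min y (1 / Suc n)" for n using y by (intro dense z) auto
  then obtain i where i: "\<And>n. dist (d (i n)) z < min y (1 / Suc n)" by metis
  define u where "u = (\<lambda>n. d (i n))"
  have u_Im: "y \<le> Im (u n)" for n
  proof -
    have "dist (u n) z < Im z / 2" using i[of n] by (simp add: u_def y_def)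
    moreover have "\<bar>Im (u n) - Im z\<bar> \<le> dist (u n) z"
      using abs_Im_le_cmod[of "u n - z"] by (simp add: dist_norm)
    ultimately show ?thesis unfolding y_def by linarith
  qed
  have u_lim: "u \<longlonglongrightarrow> z"
  proof (rule metric_tendsto_imp_tendsto)
    show "(\<lambda>n. 1 / real (Suc n)) \<longlonglongrightarrow> 0" by real_asymp
    show "\<forall>\<^sub>F n in sequentially. dist (u n) z \<le> dist (1 / real (Suc n)) 0"
      using i by (intro always_eventually) (auto simp: u_def intro: less_imp_le)
  qed
  have "\<exists>l. ((\<lambda>s. q s (u n)) \<longlongrightarrow> l) (at t)" for n
    using diff[of "i n"] unfolding has_vector_derivative_iff_quotient q_def u_def .
  then have "\<exists>l. \<forall>n. ((\<lambda>s. q s (u n)) \<longlongrightarrow> l n) (at t)" by (intro choice allI)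
  then obtain l where l: "\<And>n. ((\<lambda>s. q s (u n)) \<longlongrightarrow> l n) (at t)" by blast
  have l_dist: "dist (l m) (l n) \<le> A * dist (u m) (u n)" for m n
  proof (rule tendsto_upperbound)
    show "((\<lambda>s. dist (q s (u m)) (q s (u n))) \<longlongrightarrow> dist (l m) (l n)) (at t)"
      by (intro tendsto_intros l)
    show "\<forall>\<^sub>F s in at t. dist (q s (u m)) (q s (u n)) \<le> A * dist (u m) (u n)"
      using ev by eventually_elim (use q_lip u_Im in auto)
  qed simp
  have "Cauchy l"
  proof (rule metric_CauchyI)
    fix e :: real assume "e > 0"
    have "Cauchy u" using u_lim by (rule LIMSEQ_imp_Cauchy)
    then obtain N where N: "\<And>m n. m \<ge> N \<Longrightarrow> n \<ge> N \<Longrightarrow> dist (u m) (u n) < e / (A + 1)"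
      using metric_CauchyD[of u "e / (A + 1)"] \<open>e > 0\<close> \<open>A \<ge> 0\<close> by auto
    have "dist (l m) (l n) < e" if "m \<ge> N" "n \<ge> N" for m n
    proof -
      have "dist (l m) (l n) \<le> (A + 1) * dist (u m) (u n)"
        using l_dist[of m n] by (simp add: distrib_right add_increasing2)
      also have "\<dots> < e" using N[OF that] \<open>A \<ge> 0\<close> by (simp add: pos_less_divide_eq mult.commute)
      finally show ?thesis .
    qed
    then show "\<exists>M. \<forall>m\<ge>M. \<forall>n\<ge>M. dist (l m) (l n) < e" by blast
  qed
  then obtain l0 where l0: "l \<longlonglongrightarrow> l0" using Cauchy_convergent_iff convergent_def by blast
  have "((\<lambda>s. q s z) \<longlongrightarrow> l0) (at t)"
  proof (rule tendstoI)
    fix e :: real assume "e > 0"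
    have "(\<lambda>n. A * dist z (u n)) \<longlonglongrightarrow> A * dist z z" by (intro tendsto_intros u_lim)
    then have "\<forall>\<^sub>F n in sequentially. A * dist z (u n) < e / 3"
      using \<open>e > 0\<close> by (intro order_tendstoD(2)) auto
    moreover have "\<forall>\<^sub>F n in sequentially. dist (l n) l0 < e / 3"
      using l0 \<open>e > 0\<close> by (intro tendstoD) auto
    ultimately have "\<forall>\<^sub>F n in sequentially. A * dist z (u n) < e / 3 \<and> dist (l n) l0 < e / 3"
      by (rule eventually_conj)
    then obtain n where n: "A * dist z (u n) < e / 3" "dist (l n) l0 < e / 3"
      using eventually_happens'[OF sequentially_bot] by blast
    have "\<forall>\<^sub>F s in at t. dist (q s (u n)) (l n) < e / 3" using l \<open>e > 0\<close> by (intro tendstoD) auto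
    with ev show "\<forall>\<^sub>F s in at t. dist (q s z) l0 < e"
    proof eventually_elim
      case (elim s)
      have "dist (q s z) (q s (u n)) \<le> A * dist z (u n)" using elim u_Im y by (intro q_lip) auto
      moreover have "dist (q s z) l0 \<le> dist (q s z) (q s (u n)) + dist (q s (u n)) (l n) + dist (l n) l0"
        by metric
      ultimately show ?case using elim n by linarith
    qed
  qed
  then show ?thesis unfolding has_vector_derivative_iff_quotient q_def by blast
qed

text \<open>Divided by \<open>h n\<close>, the forward increment is minus a Cauchy transform
  \<open>g n z\<close> times a factor tending to \<open>deriv (f t) z\<close>, so
  \<open>g n z\<close> converges. Only \<open>m \<le> 1\<close> survives the limit: the measures
  behind \<open>g n\<close> need not be tight.\<close>

lemma time_derivative_representation:
  assumes t: "t \<ge> 0"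
    and d: "\<And>z. Im z > 0 \<Longrightarrow> ((\<lambda>s. f s z) has_vector_derivative d z) (at t)"
  shows "\<exists>m M. 0 \<le> m \<and> m \<le> 1 \<and> real_distribution M \<and>
    (\<forall>z. Im z > 0 \<longrightarrow> - d z / deriv (f t) z = of_real m * cauchy_transform M z)"
proof -
  define h where "h = (\<lambda>n. 1 / real (Suc n))"
  have h: "h n > 0" for n by (simp add: h_def)
  have h0: "h \<longlonglongrightarrow> 0" unfolding h_def by real_asymp
  define g where "g = (\<lambda>n. cauchy_transform (E t (t + h n)))"
  have E': "real_distribution (E t (t + h n))" for n using t h by (intro E) auto
  interpret D: real_distribution "D t" by (rule D[OF t])
  have g_le: "norm (g n z) \<le> 1 / Im z" if "Im z > 0" for n z
    unfolding g_def by (rule real_distribution.norm_cauchy_transform_le[OF E' that])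
  have g_lim: "(\<lambda>n. g n z) \<longlonglongrightarrow> - d z / deriv (f t) z" if z: "Im z > 0" for z
  proof -
    have "filterlim (\<lambda>n. t + h n) (at t) sequentially"
      using tendsto_add[OF tendsto_const h0, of t] h
      by (auto simp: filterlim_at eventually_at_filter less_imp_neq[symmetric])
    with d[OF z] have lim1: "(\<lambda>n. (f (t + h n) z - f t z) / of_real (t + h n - t)) \<longlonglongrightarrow> d z"
      unfolding has_vector_derivative_iff_quotient by (rule filterlim_compose)
    define c where "c = (\<lambda>n. 1 + of_real t * resolvent_product (D t) z (tr t (t + h n) z))"
    have "(f (t + h n) z - f t z) / of_real (t + h n - t) = - (g n z * c n)" for n
      using increment[of t "t + h n" z] t h[of n] z by (simp add: g_def c_def)
    with lim1 have lim1': "(\<lambda>n. - (g n z * c n)) \<longlonglongrightarrow> d z" by simp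
    have "(\<lambda>n. tr t (t + h n) z) \<longlonglongrightarrow> z"
    proof -
      have "(\<lambda>n. of_real (h n) * g n z) \<longlonglongrightarrow> 0"
      proof (rule Lim_null_comparison)
        show "\<forall>\<^sub>F n in sequentially. norm (of_real (h n) * g n z) \<le> h n * (1 / Im z)"
        proof (intro always_eventually allI)
          fix n
          have "norm (of_real (h n) * g n z) = h n * norm (g n z)" using h[of n] by (simp add: norm_mult)
          also have "\<dots> \<le> h n * (1 / Im z)" using g_le[OF z, of n] h[of n] by (intro mult_left_mono) auto
          finally show "norm (of_real (h n) * g n z) \<le> h n * (1 / Im z)" .
        qed
        show "(\<lambda>n. h n * (1 / Im z)) \<longlonglongrightarrow> 0" using tendsto_mult_right[OF h0, of "1 / Im z"] by simp
      qed
      from tendsto_diff[OF tendsto_const this, of z] show ?thesis by (simp add: tr_def g_def)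
    qed
    then have "c \<longlonglongrightarrow> 1 + of_real t * resolvent_product (D t) z z"
      unfolding c_def by (intro tendsto_intros isCont_tendsto_compose[OF D.isCont_resolvent_product[OF z z]])
    then have c: "c \<longlonglongrightarrow> deriv (f t) z" by (simp add: deriv_eq[OF t z])
    have lim2: "(\<lambda>n. - (- (g n z * c n)) / c n) \<longlonglongrightarrow> - d z / deriv (f t) z"
      by (intro tendsto_intros lim1' c deriv_nonzero[OF t z])
    have "\<forall>\<^sub>F n in sequentially. c n \<noteq> 0"
      using c deriv_nonzero[OF t z] by (rule tendsto_imp_eventually_ne)
    then have "\<forall>\<^sub>F n in sequentially. - (- (g n z * c n)) / c n = g n z" by eventually_elim simp
    with lim2 show ?thesis by (rule Lim_transform_eventually)
  qed
  \<comment> \<open>Pointwise convergence does not make the limit holomorphic. Montel does, as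
    \<open>norm (g n z) \<le> 1 / Im z\<close> is a locally uniform bound.\<close>
  obtain G r where G: "G holomorphic_on upper_half_plane" and r: "strict_mono (r :: nat \<Rightarrow> nat)"
    and Gr: "\<And>x. x \<in> upper_half_plane \<Longrightarrow> (\<lambda>n. g (r n) x) \<longlonglongrightarrow> G x"
  proof (rule Montel[of upper_half_plane "range g" g])
    show "open upper_half_plane" by (simp add: upper_half_plane_def open_halfspace_Im_gt)
    show "h holomorphic_on upper_half_plane" if "h \<in> range g" for h
      using that real_distribution.holomorphic_cauchy_transform[OF E'] by (auto simp: g_def)
    show "\<exists>B. \<forall>h\<in>range g. \<forall>z\<in>K. norm (h z) \<le> B" if K: "compact K" "K \<subseteq> upper_half_plane" for K
    proof -
      have "compact ((\<lambda>z. 1 / Im z) ` K)"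
        using K by (intro compact_continuous_image continuous_intros) (auto simp: upper_half_plane_def)
      then obtain B where "\<And>z. z \<in> K \<Longrightarrow> norm (1 / Im z) \<le> B"
        by (force simp: bounded_iff dest: compact_imp_bounded)
      then have "norm (g n z) \<le> B" if "z \<in> K" for n z
        using g_le[of z n] that K by (force simp: upper_half_plane_def)
      then show ?thesis by blast
    qed
  qed auto
  have G_eq: "G z = - d z / deriv (f t) z" if "Im z > 0" for z
    using LIMSEQ_unique[OF Gr LIMSEQ_subseq_LIMSEQ[OF g_lim[OF that] r, unfolded o_def]] that
    by (simp add: upper_half_plane_def)
  have "\<exists>m M. 0 \<le> m \<and> m \<le> 1 \<and> real_distribution M \<and>
      (\<forall>z. Im z > 0 \<longrightarrow> G z = of_real m * cauchy_transform M z)"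
  proof (rule cauchy_representation[OF G])
    fix z :: complex assume z: "Im z > 0"
    have lim: "(\<lambda>n. g n z) \<longlonglongrightarrow> G z" using g_lim[OF z] G_eq[OF z] by simp
    show "Im (G z) \<le> 0"
      by (rule LIMSEQ_le_const2[OF tendsto_Im[OF lim]])
         (use real_distribution.Im_cauchy_transform_nonpos[OF E' z] in \<open>auto simp: g_def\<close>)
    show "norm (G z) \<le> 1 / Im z"
      by (rule LIMSEQ_le_const2[OF tendsto_norm[OF lim]]) (use g_le[OF z] in auto)
  qed
  then show ?thesis using G_eq by auto
qed

end

lemma real_distribution_return: "real_distribution (return borel (x::real))"
  by (auto simp: real_distribution_def real_distribution_axioms_def intro: prob_space_return)

context Loewner_chain begin

lemma borel_measurable_time:
  assumes z: "Im z > 0" shows "(\<lambda>t. f (max 0 t) z) \<in> borel_measurable borel"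
proof (rule borel_measurable_LIMSEQ_metric)
  show "(\<lambda>t. f (time_clamp (real n) t) z) \<in> borel_measurable borel" for n
    using z by (intro borel_measurable_continuous_onI lipschitz_on_continuous_on[OF lipschitz_clamp]) auto
  show "(\<lambda>n. f (time_clamp (real n) t) z) \<longlonglongrightarrow> f (max 0 t) z" for t
  proof (rule tendsto_eventually)
    obtain m :: nat where m: "t \<le> m" using real_arch_simple by blast
    show "\<forall>\<^sub>F n in sequentially. f (time_clamp (real n) t) z = f (max 0 t) z"
      using eventually_ge_at_top[of m]
    proof eventually_elim
      case (elim n)
      then have "t \<le> real n" using m by linarith
      then show ?case by (simp add: time_clamp_def min_absorb2)
    qed
  qed
qed

lemma borel_measurable_deriv:
  assumes z: "Im z > 0" shows "(\<lambda>t. deriv (f (max 0 t)) z) \<in> borel_measurable borel"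
proof (rule borel_measurable_LIMSEQ_metric)
  show "(\<lambda>t. (f (max 0 t) (z + of_real (1 / Suc n)) - f (max 0 t) z) / of_real (1 / Suc n)) \<in> borel_measurable borel" for n
    using z by (intro borel_measurable_divide borel_measurable_diff borel_measurable_time borel_measurable_const) auto
  show "(\<lambda>n. (f (max 0 t) (z + of_real (1 / Suc n)) - f (max 0 t) z) / of_real (1 / Suc n)) \<longlonglongrightarrow> deriv (f (max 0 t)) z" for t
  proof -
    have "(f (max 0 t) has_field_derivative deriv (f (max 0 t)) z) (at z)"
      using has_field_derivative[of "max 0 t" z] deriv_eq[of "max 0 t" z] z by simp
    then have "((\<lambda>h. (f (max 0 t) (z + h) - f (max 0 t) z) / h) \<longlongrightarrow> deriv (f (max 0 t)) z) (at 0)"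
      by (simp add: DERIV_def)
    moreover have "filterlim (\<lambda>n. complex_of_real (1 / Suc n)) (at 0) sequentially"
    proof -
      have "(\<lambda>n. complex_of_real (1 / Suc n)) \<longlonglongrightarrow> of_real 0"
        by (intro tendsto_of_real LIMSEQ_inverse_real_of_nat[unfolded inverse_eq_divide])
      moreover have "complex_of_real (1 / Suc n) \<noteq> 0" for n by (simp del: of_nat_Suc)
      ultimately show ?thesis by (auto simp: filterlim_at)
    qed
    ultimately show ?thesis by (rule filterlim_compose)
  qed
qed

lemma AE_differentiable:
  "AE t in lborel. t > 0 \<longrightarrow> (\<forall>z. Im z > 0 \<longrightarrow> (\<exists>d. ((\<lambda>s. f s z) has_vector_derivative d) (at t)))"
proof -
  obtain d :: "nat \<Rightarrow> complex" where "\<forall>n. Im (d n) > 0"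
    and "\<forall>z e. Im z > 0 \<longrightarrow> e > 0 \<longrightarrow> (\<exists>n. dist (d n) z < e)"
    using upper_half_plane_dense_sequence by blast
  then have d: "\<And>n. Im (d n) > 0" and dense: "\<And>z e. Im z > 0 \<Longrightarrow> e > 0 \<Longrightarrow> \<exists>n. dist (d n) z < e"
    by auto
  have "AE t in lborel. \<forall>n. t > 0 \<longrightarrow> (\<exists>l. ((\<lambda>s. f s (d n)) has_vector_derivative l) (at t))"
    by (intro AE_all_countable[THEN iffD2] allI AE_differentiable_at_point d)
  then show ?thesis
  proof eventually_elim
    case (elim t)
    show ?case
    proof (intro impI allI)
      fix z :: complex assume "t > 0" "Im z > 0"
      show "\<exists>l. ((\<lambda>s. f s z) has_vector_derivative l) (at t)"
        by (rule differentiable_of_dense[OF \<open>t > 0\<close> d dense _ \<open>Im z > 0\<close>]) (use elim \<open>t > 0\<close> in blast)+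
    qed
  qed
qed

lemma exists_time_derivatives:
  "\<exists>N\<in>null_sets lborel. \<exists>d m M. \<forall>t. t > 0 \<longrightarrow> t \<notin> N \<longrightarrow>
     0 \<le> m t \<and> m t \<le> 1 \<and> real_distribution (M t) \<and>
     (\<forall>z. Im z > 0 \<longrightarrow> ((\<lambda>s. f s z) has_vector_derivative d t z) (at t) \<and>
        d t z = - of_real (m t) * cauchy_transform (M t) z * deriv (f t) z)"
proof -
  obtain N where N_null: "N \<in> null_sets lborel"
    and N: "{t \<in> space lborel. \<not> (t > 0 \<longrightarrow> (\<forall>z. Im z > 0 \<longrightarrow> (\<exists>d. ((\<lambda>s. f s z) has_vector_derivative d) (at t))))} \<subseteq> N"
    using AE_differentiable unfolding eventually_ae_filter by blast
  define d where "d = (\<lambda>t z. vector_derivative (\<lambda>s. f s z) (at t))"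
  have d: "((\<lambda>s. f s z) has_vector_derivative d t z) (at t)" if "t > 0" "t \<notin> N" "Im z > 0" for t z
  proof -
    obtain l where "((\<lambda>s. f s z) has_vector_derivative l) (at t)"
      using N \<open>t > 0\<close> \<open>t \<notin> N\<close> \<open>Im z > 0\<close> by auto
    then show ?thesis unfolding d_def by (simp add: vector_derivative_at)
  qed
  have "\<exists>m M. t > 0 \<longrightarrow> t \<notin> N \<longrightarrow> 0 \<le> m \<and> m \<le> 1 \<and> real_distribution M \<and>
      (\<forall>z. Im z > 0 \<longrightarrow> - d t z / deriv (f t) z = of_real m * cauchy_transform M z)" for t
  proof (cases "t > 0 \<and> t \<notin> N")
    case True
    then show ?thesis using time_derivative_representation[of t "d t"] d[of t] by auto
  qed auto
  then have "\<exists>m M. \<forall>t. t > 0 \<longrightarrow> t \<notin> N \<longrightarrow> 0 \<le> m t \<and> m t \<le> 1 \<and> real_distribution (M t) \<and>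
      (\<forall>z. Im z > 0 \<longrightarrow> - d t z / deriv (f t) z = of_real (m t) * cauchy_transform (M t) z)"
    by (subst choice_iff[symmetric])+ blast
  then obtain m M where mM: "\<And>t. t > 0 \<Longrightarrow> t \<notin> N \<Longrightarrow> 0 \<le> m t \<and> m t \<le> 1 \<and> real_distribution (M t)"
    and rep: "\<And>t z. t > 0 \<Longrightarrow> t \<notin> N \<Longrightarrow> Im z > 0 \<Longrightarrow> - d t z / deriv (f t) z = of_real (m t) * cauchy_transform (M t) z"
    by blast
  have "d t z = - of_real (m t) * cauchy_transform (M t) z * deriv (f t) z"
    if *: "t > 0" "t \<notin> N" "Im z > 0" for t z
  proof -
    have "deriv (f t) z \<noteq> 0" using * by (intro deriv_nonzero) auto
    then show ?thesis using arg_cong[OF rep[OF *], of "\<lambda>u. - u * deriv (f t) z"] by simp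
  qed
  then show ?thesis using N_null d mM
    by (intro bexI[of _ N] exI[of _ d] exI[of _ m] exI[of _ M]) auto
qed

text \<open>The masses of the limit measures are recovered from the derivative along the imaginary
  axis: since the capacity of \<^term>\<open>f T\<close> is \<^term>\<open>T\<close>, they integrate to \<^term>\<open>T\<close> over
  \<^term>\<open>{0..T}\<close>, so no mass escapes to infinity at almost every time.\<close>

lemma AE_mass_eq_1:
  assumes N: "N \<in> null_sets lborel"
    and d: "\<And>t z. t > 0 \<Longrightarrow> t \<notin> N \<Longrightarrow> Im z > 0 \<Longrightarrow> ((\<lambda>s. f s z) has_vector_derivative d t z) (at t)"
    and m: "\<And>t. t > 0 \<Longrightarrow> t \<notin> N \<Longrightarrow> 0 \<le> m t \<and> m t \<le> 1 \<and> real_distribution (M t)"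
    and d_eq: "\<And>t z. t > 0 \<Longrightarrow> t \<notin> N \<Longrightarrow> Im z > 0 \<Longrightarrow> d t z = - of_real (m t) * cauchy_transform (M t) z * deriv (f t) z"
    and d_meas: "\<And>z. Im z > 0 \<Longrightarrow> (\<lambda>t. if t > 0 \<and> t \<notin> N then d t z else 0) \<in> borel_measurable borel"
  shows "AE t in lborel. t > 0 \<longrightarrow> t \<notin> N \<longrightarrow> m t = 1"
    and "(\<lambda>t. if t > 0 \<and> t \<notin> N then m t else 0) \<in> borel_measurable borel"
proof -
  \<comment> \<open>Heights start at 1, so \<open>deriv (f t)\<close> there is bounded by
    \<open>1 + T\<close> for all \<open>n\<close>; this yields the dominating function.\<close>
  define Y where "Y = (\<lambda>n. real (Suc n))"
  \<comment> \<open>On the times considered this is the real part of \<open>m t\<close> times two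
    factors tending to 1: \<open>\<i> * Y n\<close> times the transform of \<open>M t\<close>, and
    \<open>deriv (f t)\<close>, both at \<open>\<i> * Y n\<close>.\<close>
  define g where "g = (\<lambda>n t. if t > 0 \<and> t \<notin> N then Y n * Im (d t (\<i> * of_real (Y n))) else 0)"
  define m' where "m' = (\<lambda>t. if t > 0 \<and> t \<notin> N then m t else 0)"
  have Y: "Y n > 0" "Y n \<ge> 1" for n by (auto simp: Y_def)
  have Y_top: "filterlim Y at_top sequentially" unfolding Y_def by real_asymp
  have g_meas: "g n \<in> borel_measurable borel" for n
  proof -
    have "g n = (\<lambda>t. Y n * Im (if t > 0 \<and> t \<notin> N then d t (\<i> * of_real (Y n)) else 0))"
      by (auto simp: g_def)
    also have "\<dots> \<in> borel_measurable borel"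
      by (intro borel_measurable_times borel_measurable_const
          measurable_compose[OF d_meas borel_measurable_Im]) (use Y in simp)
    finally show ?thesis .
  qed
  have g_lim: "(\<lambda>n. g n t) \<longlonglongrightarrow> m' t" for t
  proof (cases "t > 0 \<and> t \<notin> N")
    case True
    interpret M: real_distribution "M t" using m True by blast
    interpret D: real_distribution "D t" using True by (intro D) simp
    have "(\<lambda>n. deriv (f t) (\<i> * of_real (Y n))) \<longlonglongrightarrow> 1"
    proof -
      have "(\<lambda>n. of_real t * resolvent_product (D t) (\<i> * of_real (Y n)) (\<i> * of_real (Y n))) \<longlonglongrightarrow> 0"
      proof (rule Lim_null_comparison)
        show "\<forall>\<^sub>F n in sequentially. norm (of_real t * resolvent_product (D t) (\<i> * of_real (Y n)) (\<i> * of_real (Y n))) \<le> t * (1 / (Y n * Y n))"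
        proof (intro always_eventually allI)
          fix n
          have "norm (resolvent_product (D t) (\<i> * of_real (Y n)) (\<i> * of_real (Y n))) \<le> 1 / (Y n * Y n)"
            using D.norm_resolvent_product_integral_le[of "\<i> * of_real (Y n)" "\<i> * of_real (Y n)"] Y by simp
          then show "norm (of_real t * resolvent_product (D t) (\<i> * of_real (Y n)) (\<i> * of_real (Y n))) \<le> t * (1 / (Y n * Y n))"
            using True by (simp only: norm_mult norm_of_real) (intro mult_mono, auto)
        qed
        show "(\<lambda>n. t * (1 / (Y n * Y n))) \<longlonglongrightarrow> 0" unfolding Y_def by real_asymp
      qed
      from tendsto_add[OF tendsto_const this, of 1] show ?thesis
        using True Y by (simp add: deriv_eq)
    qed
    moreover have "(\<lambda>n. \<i> * of_real (Y n) * cauchy_transform (M t) (\<i> * of_real (Y n))) \<longlonglongrightarrow> 1"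
      using M.cauchy_transform_asymptotics Y_top by (rule filterlim_compose)
    ultimately have "(\<lambda>n. Re (of_real (m t) * (\<i> * of_real (Y n) * cauchy_transform (M t) (\<i> * of_real (Y n))) * deriv (f t) (\<i> * of_real (Y n)))) \<longlonglongrightarrow> Re (of_real (m t) * 1 * 1)"
      by (intro tendsto_intros)
    moreover have "g n t = Re (of_real (m t) * (\<i> * of_real (Y n) * cauchy_transform (M t) (\<i> * of_real (Y n))) * deriv (f t) (\<i> * of_real (Y n)))" for n
    proof -
      have "of_real (m t) * (\<i> * of_real (Y n) * cauchy_transform (M t) (\<i> * of_real (Y n))) * deriv (f t) (\<i> * of_real (Y n))
        = - (\<i> * (of_real (Y n) * d t (\<i> * of_real (Y n))))"
        using d_eq[of t "\<i> * of_real (Y n)"] True Y by (simp add: mult_ac)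
      then show ?thesis using True by (simp add: g_def)
    qed
    ultimately show ?thesis using True by (simp add: m'_def)
  next
    case False
    then have "g n t = 0" "m' t = 0" for n by (auto simp: g_def m'_def)
    then show ?thesis by simp
  qed
  show m'_meas: "(\<lambda>t. if t > 0 \<and> t \<notin> N then m t else 0) \<in> borel_measurable borel"
    unfolding m'_def[symmetric] by (rule borel_measurable_LIMSEQ_metric[OF g_meas g_lim])
  have int_m': "(\<integral>t. indicator {0..T} t * m' t \<partial>lborel) = T" if T: "T \<ge> 0" for T
  proof (rule LIMSEQ_unique)
    show "(\<lambda>n. \<integral>t. indicator {0..T} t * g n t \<partial>lborel) \<longlonglongrightarrow> (\<integral>t. indicator {0..T} t * m' t \<partial>lborel)"
    proof (rule integral_dominated_convergence)
      show "integrable lborel (\<lambda>t. (1 + T) * indicator {0..T} t)"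
        using T by (intro integrable_mult_right integrable_real_indicator) auto
      show "AE t in lborel. (\<lambda>n. indicator {0..T} t * g n t) \<longlonglongrightarrow> indicator {0..T} t * m' t"
        by (intro AE_I2 tendsto_intros g_lim)
      show "AE t in lborel. norm (indicator {0..T} t * g n t) \<le> (1 + T) * indicator {0..T} t" for n
      proof (rule AE_I2)
        fix t
        show "norm (indicator {0..T} t * g n t) \<le> (1 + T) * indicator {0..T} t"
        proof (cases "t > 0 \<and> t \<notin> N \<and> t \<le> T")
          case True
          interpret M: real_distribution "M t" using m True by blast
          define z where "z = \<i> * complex_of_real (Y n)"
          have z: "Im z > 0" "Im z = Y n" using Y by (simp_all add: z_def)
          have "norm (d t z) = m t * norm (cauchy_transform (M t) z) * norm (deriv (f t) z)"
            using d_eq[of t z] m[of t] True z by (simp add: norm_mult)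
          also have "\<dots> \<le> 1 * (1 / Y n) * (1 + T)"
          proof (intro mult_mono)
            show "norm (cauchy_transform (M t) z) \<le> 1 / Y n"
              using M.norm_cauchy_transform_le[OF z(1)] z by simp
            have "norm (deriv (f t) z) \<le> 1 + t / 1\<^sup>2"
              using norm_increment_factor_le[of t 1 z z] deriv_eq[of t z] True z Y by simp
            then show "norm (deriv (f t) z) \<le> 1 + T" using True by simp
          qed (use m[of t] True Y(1)[of n, THEN less_imp_le] in auto)
          finally have "\<bar>Im (d t z)\<bar> \<le> (1 + T) / Y n"
            using abs_Im_le_cmod[of "d t z"] by simp
          then have "Y n * \<bar>Im (d t z)\<bar> \<le> 1 + T" using Y[of n] by (simp add: field_simps)
          then show ?thesis using True Y[of n] by (simp add: g_def z_def abs_mult)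
        next
          case False
          then show ?thesis using T by (auto simp: g_def split: split_indicator)
        qed
      qed
      show "(\<lambda>t. indicator {0..T} t * m' t) \<in> borel_measurable lborel"
        using m'_meas unfolding m'_def by simp
      show "(\<lambda>t. indicator {0..T} t * g n t) \<in> borel_measurable lborel" for n
        using g_meas by simp
    qed
    \<comment> \<open>The integral of the time derivative is the increment
      \<open>Y n * Im (f T z - f 0 z)\<close>, and \<open>f 0 z = z\<close>; the capacity of
      \<open>f T\<close> gives its limit.\<close>
    have "(\<integral>t. indicator {0..T} t * g n t \<partial>lborel) = T * Re (\<i> * of_real (Y n) * cauchy_transform (D T) (\<i> * of_real (Y n)))" for n
    proof -
      define z where "z = \<i> * complex_of_real (Y n)"
      have z: "Im z > 0" "Im z = Y n" using Y by (simp_all add: z_def)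
      define F where "F = (\<lambda>t. Y n * Im (f (time_clamp T t) z))"
      define L where "L = (1 + T / (Im z)\<^sup>2) / Im z"
      have lip: "L-lipschitz_on UNIV (\<lambda>t. f (time_clamp T t) z)"
        unfolding L_def by (rule lipschitz_clamp[OF T z(1)])
      have "(\<integral>t. indicator {0..T} t * g n t \<partial>lborel) = F T - F 0"
      proof (rule lipschitz_integral_derivative[OF _ g_meas T])
        show "(Y n * L)-lipschitz_on UNIV F"
        proof (rule lipschitz_onI)
          fix s t
          have "\<bar>Im (f (time_clamp T s) z) - Im (f (time_clamp T t) z)\<bar> \<le> L * dist s t"
            using order.trans[OF abs_Im_le_cmod, of "f (time_clamp T s) z - f (time_clamp T t) z" "L * dist s t"]
              lipschitz_onD[OF lip, of s t] by (simp add: dist_norm)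
          then have "Y n * \<bar>Im (f (time_clamp T s) z) - Im (f (time_clamp T t) z)\<bar> \<le> Y n * (L * dist s t)"
            using Y[of n] by (intro mult_left_mono) auto
          then show "dist (F s) (F t) \<le> Y n * L * dist s t"
            using Y[of n] by (simp add: F_def dist_real_def abs_mult flip: right_diff_distrib)
        qed (use lipschitz_on_nonneg[OF lip] Y[of n] in simp)
        have "AE t in lborel. t \<notin> N" using N by (rule AE_not_in)
        then show "AE t in lborel. 0 < t \<longrightarrow> t < T \<longrightarrow> (F has_real_derivative g n t) (at t)"
        proof eventually_elim
          case (elim t)
          show ?case
          proof (intro impI)
            assume t: "0 < t" "t < T"
            have "((\<lambda>s. Y n * Im (f s z)) has_real_derivative g n t) (at t)"
              using d[OF t(1) elim z(1)] t elim
              unfolding has_real_derivative_iff_has_vector_derivative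
              by (auto simp: g_def z_def[symmetric] intro!: has_vector_derivative_mult_right bounded_linear.has_vector_derivative[OF bounded_linear_Im])
            then show "(F has_real_derivative g n t) (at t)"
            proof (rule has_field_derivative_transform_within_open[where S="{0<..<T}"])
              show "Y n * Im (f s z) = F s" if "s \<in> {0<..<T}" for s
                using that by (simp add: F_def time_clamp_eq)
            qed (use t in auto)
          qed
        qed
      qed
      also have "\<dots> = - (Y n * (T * Im (cauchy_transform (D T) z)))"
      proof -
        have *: "Im (f T z) = Im z - T * Im (cauchy_transform (D T) z)" "Im (f 0 z) = Im z"
          using f_eq[OF T z(1)] f_eq[of 0 z] z by simp_all
        show ?thesis using T by (simp add: F_def time_clamp_eq * right_diff_distrib)
      qed
      also have "\<dots> = T * Re (\<i> * of_real (Y n) * cauchy_transform (D T) z)" by simp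
      finally show ?thesis by (simp add: z_def)
    qed
    moreover have "(\<lambda>n. T * Re (\<i> * of_real (Y n) * cauchy_transform (D T) (\<i> * of_real (Y n)))) \<longlonglongrightarrow> T * Re 1"
      by (intro tendsto_intros filterlim_compose[OF real_distribution.cauchy_transform_asymptotics[OF D[OF T]] Y_top])
    ultimately show "(\<lambda>n. \<integral>t. indicator {0..T} t * g n t \<partial>lborel) \<longlonglongrightarrow> T" by simp
  qed
  \<comment> \<open>The defect \<open>1 - m'\<close> is nonnegative and has integral 0 over
    \<open>{0..T}\<close>.\<close>
  have AE_T: "AE t in lborel. indicator {0..T} t * (1 - m' t) = 0" if T: "T \<ge> 0" for T
  proof -
    have m'_bd: "0 \<le> m' t" "m' t \<le> 1" for t using m[of t] by (auto simp: m'_def)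
    have int1: "integrable lborel (\<lambda>t. indicator {0..T} t :: real)"
      using T by (intro integrable_real_indicator) auto
    have int2: "integrable lborel (\<lambda>t. indicator {0..T} t * m' t)"
      by (rule Bochner_Integration.integrable_bound[OF int1])
         (use m'_meas m'_bd in \<open>auto simp: m'_def[symmetric] split: split_indicator\<close>)
    have eq: "indicator {0..T} t * (1 - m' t) = indicator {0..T} t - indicator {0..T} t * m' t" for t
      by (simp add: algebra_simps)
    have "integrable lborel (\<lambda>t. indicator {0..T} t * (1 - m' t))"
      unfolding eq using int1 int2 by (rule Bochner_Integration.integrable_diff)
    moreover have "(\<integral>t. indicator {0..T} t * (1 - m' t) \<partial>lborel) = 0"
      unfolding eq using int1 int2 int_m'[OF T] T by simp
    ultimately show ?thesis
      using m'_bd by (subst (asm) integral_nonneg_eq_0_iff_AE) auto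
  qed
  have "AE t in lborel. \<forall>n::nat. indicator {0..real n} t * (1 - m' t) = 0"
    by (intro AE_all_countable[THEN iffD2] allI AE_T) simp
  then show "AE t in lborel. t > 0 \<longrightarrow> t \<notin> N \<longrightarrow> m t = 1"
  proof eventually_elim
    case (elim t)
    obtain n :: nat where "t \<le> n" using real_arch_simple by blast
    then show ?case using elim[rule_format, of n] by (auto simp: m'_def)
  qed
qed

theorem exists_solution: "\<exists>\<mu>. measurable_family \<mu> \<and> solves_Loewner_equation f \<mu>"
proof -
  obtain N d m M where N: "N \<in> null_sets lborel"
    and *: "\<forall>t. t > 0 \<longrightarrow> t \<notin> N \<longrightarrow> 0 \<le> m t \<and> m t \<le> 1 \<and> real_distribution (M t) \<and>
     (\<forall>z. Im z > 0 \<longrightarrow> ((\<lambda>s. f s z) has_vector_derivative d t z) (at t) \<and>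
        d t z = - of_real (m t) * cauchy_transform (M t) z * deriv (f t) z)"
    using exists_time_derivatives by blast
  have d: "((\<lambda>s. f s z) has_vector_derivative d t z) (at t)"
    and d_eq: "d t z = - of_real (m t) * cauchy_transform (M t) z * deriv (f t) z"
    if "t > 0" "t \<notin> N" "Im z > 0" for t z
    using * that by blast+
  have m: "0 \<le> m t \<and> m t \<le> 1 \<and> real_distribution (M t)" if "t > 0" "t \<notin> N" for t
    using * that by blast
  have N_borel: "N \<in> sets borel" using N by auto
  have d_meas: "(\<lambda>t. if t > 0 \<and> t \<notin> N then d t z else 0) \<in> borel_measurable borel" if z: "Im z > 0" for z
  \<comment> \<open>Forward difference quotients are measurable in \<open>t\<close> and converge off
    \<open>N\<close>; the indicator removes the other times.\<close>
  proof (rule borel_measurable_LIMSEQ_metric)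
    show "(\<lambda>t. indicator ({0<..} - N) t * ((f (max 0 (t + 1 / Suc n)) z - f (max 0 t) z) / of_real (1 / Suc n))) \<in> borel_measurable borel" for n
      using N_borel measurable_compose[OF _ borel_measurable_time[OF z], of "\<lambda>t. t + 1 / Suc n" borel] borel_measurable_time[OF z]
      by (intro borel_measurable_times borel_measurable_divide borel_measurable_diff borel_measurable_indicator borel_measurable_const) auto
    show "(\<lambda>n. indicator ({0<..} - N) t * ((f (max 0 (t + 1 / Suc n)) z - f (max 0 t) z) / of_real (1 / Suc n)))
        \<longlonglongrightarrow> (if t > 0 \<and> t \<notin> N then d t z else 0)" for t
    proof (cases "t > 0 \<and> t \<notin> N")
      case True
      have "filterlim (\<lambda>n. t + 1 / real (Suc n)) (at t) sequentially"
      proof -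
        have "(\<lambda>n. t + 1 / real (Suc n)) \<longlonglongrightarrow> t + 0"
          by (intro tendsto_intros LIMSEQ_inverse_real_of_nat[unfolded inverse_eq_divide])
        then show ?thesis by (auto simp: filterlim_at)
      qed
      moreover have "((\<lambda>s. (f s z - f t z) / of_real (s - t)) \<longlongrightarrow> d t z) (at t)"
        using d[of t z] True z unfolding has_vector_derivative_iff_quotient by simp
      ultimately have "(\<lambda>n. (f (t + 1 / real (Suc n)) z - f t z) / of_real (t + 1 / real (Suc n) - t)) \<longlonglongrightarrow> d t z"
        by (rule filterlim_compose[rotated])
      moreover have "max 0 (t + 1 / real (Suc n)) = t + 1 / real (Suc n)" "max 0 t = t" for n
        using True by (simp_all add: max_absorb2)
      ultimately show ?thesis using True by simp
    next
      case False
      then have "indicator ({0<..} - N) t = (0::complex)" by (intro indicator_simps(2)) auto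
      then show ?thesis unfolding if_not_P[OF False] by simp
    qed
  qed
  have mass: "AE t in lborel. t > 0 \<longrightarrow> t \<notin> N \<longrightarrow> m t = 1"
    "(\<lambda>t. if t > 0 \<and> t \<notin> N then m t else 0) \<in> borel_measurable borel"
    by (rule AE_mass_eq_1[OF N d m d_eq d_meas]; assumption)+
  \<comment> \<open>The times of full mass. A point mass is used at all others, a null set within
    \<open>{0..}\<close>, so that every \<open>\<mu> t\<close> is a probability measure.\<close>
  define V where "V = {t. t > 0 \<and> t \<notin> N \<and> m t = 1}"
  have V_eq: "V = ({0<..} - N) \<inter> (\<lambda>t. if t > 0 \<and> t \<notin> N then m t else 0) -` {1}"
    by (auto simp: V_def)
  have V_borel: "V \<in> sets borel"
    unfolding V_eq using N_borel measurable_sets[OF mass(2), of "{1}"] by auto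
  have V_null: "{0..} - V \<in> null_sets lborel"
  proof (rule AE_iff_null_sets[THEN iffD2])
    show "{0..} - V \<in> sets lborel" using V_borel by auto
    have "AE t in lborel. t \<notin> N" using N by (rule AE_not_in)
    moreover have "AE t in lborel. t \<noteq> (0::real)" by (rule AE_lborel_singleton)
    ultimately show "AE t in lborel. t \<notin> {0..} - V"
      using mass(1) by eventually_elim (auto simp: V_def)
  qed
  define \<mu> where "\<mu> = (\<lambda>t. if t \<in> V then M t else return borel (0::real))"
  have \<mu>: "real_distribution (\<mu> t)" for t
    using m[of t] real_distribution_return by (auto simp: \<mu>_def V_def)
  have \<mu>_V: "cauchy_transform (\<mu> t) z = - d t z / deriv (f t) z" if "t \<in> V" "Im z > 0" for t z
    using d_eq[of t z] deriv_nonzero[of t z] that by (auto simp: \<mu>_def V_def)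
  have "measurable_family \<mu>"
  proof (rule measurable_familyI)
    show "\<mu> t \<in> real_prob_measures" for t using \<mu> by (simp add: real_prob_measures_iff)
    fix z :: complex assume z: "Im z > 0"
    \<comment> \<open>The measures \<open>M t\<close> were chosen without regard to measurability.
      On \<open>V\<close> their transform is a quotient of measurable derivatives, which settles the
      matter.\<close>
    have "(\<lambda>t. cauchy_transform (\<mu> t) z)
      = (\<lambda>t. if t \<in> V then - (if t > 0 \<and> t \<notin> N then d t z else 0) / deriv (f (max 0 t)) z else cauchy_transform (return borel 0) z)"
    proof
      fix t show "cauchy_transform (\<mu> t) z
        = (if t \<in> V then - (if t > 0 \<and> t \<notin> N then d t z else 0) / deriv (f (max 0 t)) z else cauchy_transform (return borel 0) z)"
      proof (cases "t \<in> V")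
        case True
        then have "max 0 t = t" "t > 0 \<and> t \<notin> N" by (auto simp: V_def)
        then show ?thesis using True \<mu>_V[OF True z] by simp
      qed (simp add: \<mu>_def)
    qed
    also have "\<dots> \<in> borel_measurable borel"
      using V_borel d_meas[OF z] borel_measurable_deriv[OF z]
      by (intro measurable_If_set borel_measurable_divide borel_measurable_uminus borel_measurable_const) auto
    finally show "(\<lambda>t. cauchy_transform (\<mu> t) z) \<in> borel_measurable (restrict_space borel {0..})"
      by (rule measurable_restrict_space1)
  qed
  moreover have "solves_Loewner_equation f \<mu>"
    unfolding solves_Loewner_equation_def
  proof (intro bexI[of _ "{0..} - V"] conjI ballI)
    show "{0..} - V \<in> null_sets lebesgue" using V_null by (rule null_sets_completionI)
    fix t z assume t: "t \<in> {0..} - ({0..} - V)" and "z \<in> upper_half_plane"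
    then have z: "Im z > 0" by (simp add: upper_half_plane_def)
    have tV: "t \<in> V" "t > 0" "t \<notin> N" using t by (auto simp: V_def)
    have "d t z = - cauchy_transform (\<mu> t) z * deriv (f t) z"
      using \<mu>_V[OF tV(1) z] deriv_nonzero[of t z] tV z by simp
    then show "((\<lambda>s. f s z) has_vector_derivative - (\<integral>x. 1 / (z - of_real x) \<partial>\<mu> t) * deriv (f t) z) (at t within {0..})"
      using d[OF tV(2,3) z] by (simp add: cauchy_transform_def has_vector_derivative_at_within)
  qed auto
  ultimately show ?thesis by blast
qed

text \<open>Off both null sets the two families give the same derivative, the filter at
  \<open>t\<close> within \<open>{0..}\<close> being nontrivial even at 0. Cancelling
  \<open>deriv (f t) z\<close> leaves equal Cauchy transforms.\<close>

theorem solution_unique: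
  assumes \<mu>: "measurable_family \<mu>" "solves_Loewner_equation f \<mu>"
    and \<nu>: "measurable_family \<nu>" "solves_Loewner_equation f \<nu>"
  shows "families_identified \<mu> \<nu>"
proof -
  obtain A where A: "A \<in> null_sets lebesgue" "A \<subseteq> {0..}"
    and eqA: "\<And>t z. t \<in> {0..} - A \<Longrightarrow> Im z > 0 \<Longrightarrow>
      ((\<lambda>s. f s z) has_vector_derivative - cauchy_transform (\<mu> t) z * deriv (f t) z) (at t within {0..})"
    using \<mu>(2) by (auto simp: solves_Loewner_equation_def cauchy_transform_def upper_half_plane_def)
  obtain B where B: "B \<in> null_sets lebesgue" "B \<subseteq> {0..}"
    and eqB: "\<And>t z. t \<in> {0..} - B \<Longrightarrow> Im z > 0 \<Longrightarrow>
      ((\<lambda>s. f s z) has_vector_derivative - cauchy_transform (\<nu> t) z * deriv (f t) z) (at t within {0..})"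
    using \<nu>(2) by (auto simp: solves_Loewner_equation_def cauchy_transform_def upper_half_plane_def)
  have "\<mu> t = \<nu> t" if t: "t \<in> {0..} - (A \<union> B)" for t
  proof (rule cauchy_transform_unique)
    show "real_distribution (\<mu> t)" "real_distribution (\<nu> t)"
      using measurable_familyD[OF \<mu>(1)] measurable_familyD[OF \<nu>(1)] t by (auto simp: real_prob_measures_iff)
    fix z :: complex assume z: "Im z > 0"
    have "at t within {0..} \<noteq> bot"
    proof -
      have "at_right t \<le> at t within {0..}" using t by (intro at_le) auto
      then show ?thesis by (auto simp: bot.extremum_unique)
    qed
    then have "- cauchy_transform (\<mu> t) z * deriv (f t) z = - cauchy_transform (\<nu> t) z * deriv (f t) z"
      using eqA[of t z] eqB[of t z] t z by (intro vector_derivative_unique_within[of t "{0..}" "\<lambda>s. f s z"]) auto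
    then show "cauchy_transform (\<mu> t) z = cauchy_transform (\<nu> t) z"
      using deriv_nonzero[of t z] t z by simp
  qed
  then show ?thesis
    unfolding families_identified_def using A B by (intro bexI[of _ "A \<union> B"]) auto
qed

end

theorem theorem5p3:
  fixes f :: "real \<Rightarrow> complex \<Rightarrow> complex"
  assumes "chordal_Loewner_family f"
  shows "\<exists>\<mu>. measurable_family \<mu> \<and> solves_Loewner_equation f \<mu> \<and>
           (\<forall>\<nu>. measurable_family \<nu> \<and> solves_Loewner_equation f \<nu> \<longrightarrow>
                 families_identified \<mu> \<nu>)"
proof -
  have "\<forall>t. \<exists>D. t \<ge> 0 \<longrightarrow> real_distribution D \<and> (\<forall>z. Im z > 0 \<longrightarrow> f t z = z - of_real t * cauchy_transform D z)"
    using Loewner_representation[OF assms] by blast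
  from choice[OF this] obtain D where D: "\<And>t. t \<ge> 0 \<Longrightarrow> real_distribution (D t)"
    "\<And>t z. t \<ge> 0 \<Longrightarrow> Im z > 0 \<Longrightarrow> f t z = z - of_real t * cauchy_transform (D t) z" by blast
  define E where "E = (\<lambda>s t. SOME E. real_distribution E \<and>
      (\<forall>z. Im z > 0 \<longrightarrow> f t z = f s (z - of_real (t - s) * cauchy_transform E z)))"
  have E: "real_distribution (E s t) \<and>
      (\<forall>z. Im z > 0 \<longrightarrow> f t z = f s (z - of_real (t - s) * cauchy_transform (E s t) z))"
    if "0 \<le> s" "s < t" for s t
    unfolding E_def by (rule someI_ex) (rule Loewner_transition[OF assms that])
  interpret Loewner_chain f D E
  proof (rule Loewner_chain.intro)
    show "real_distribution (D t)" if "t \<ge> 0" for t using D(1)[OF that] .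
    show "f t z = z - of_real t * cauchy_transform (D t) z" if "t \<ge> 0" "Im z > 0" for t z
      using D(2)[OF that] .
    show "real_distribution (E s t)" if "0 \<le> s" "s < t" for s t
      using E[OF that] by blast
    show "f t z = f s (z - of_real (t - s) * cauchy_transform (E s t) z)" if "0 \<le> s" "s < t" "Im z > 0" for s t z
      using E[OF that(1,2)] that(3) by blast
    show "inj_on (f t) upper_half_plane" if "t \<ge> 0" for t
      using assms that by (auto simp: chordal_Loewner_family_def chordal_Loewner_set_def
          pred_on.maxchain_def pred_on.chain_def class_R_def)
  qed
  show ?thesis using exists_solution solution_unique by blast
qed

end
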